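(* Let $n\ge1$. For every multi-partition $\pmb\lambda=(\lambda^{(1)},\dots,\lambda^{(n)})$, the multi-Macdonald polynomial is given explicitly by $$P_{\pmb\lambda}^{(q,t)}(x^{(1)},\ldots,x^{(n)})=P_{\lambda^{(1)}}^{(q,q^{n-1}t)}[A_{n-1}]\;P_{\lambda^{(2)}}^{(q^{n-1}t,q^{n-2}t)}[A_{n-2}]\cdots P_{\lambda^{(n)}}^{(qt,t)}[A_0],$$ that is, $P_{\pmb\lambda}^{(q,t)}=\prod_{i=1}^nP_{\lambda^{(i)}}^{(q_i,t_i)}[A_{n-i}]$ with $(q_1,t_1)=(q,q^{n-1}t)$ and $(q_i,t_i)=(q^{n-i+1}t,q^{n-i}t)$ for $2\le i\le n$, where the alphabets $A_i$ are defined recursively, starting from $A_0=X^{(n)}$, by $$A_i=X^{(n-i)}+\frac{q(1-q^{i-1}t)}{1-q^it}A_{i-1},\qquad 1\le i\le n-1.$$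
   Context: For $i=1,\dots,n$ let $x^{(i)}=(x^{(i)}_1,x^{(i)}_2,\dots)$ be an infinite alphabet and $X^{(i)}=x^{(i)}_1+x^{(i)}_2+\cdots$. A multi-partition is an $n$-tuple of partitions. Set $m_{\pmb\lambda}=m_{\lambda^{(1)}}(x^{(1)})\cdots m_{\lambda^{(n)}}(x^{(n)})$ and $p_{\pmb\lambda}=p_{\lambda^{(1)}}(x^{(1)})\,p_{\lambda^{(2)}}(x^{(1)},x^{(2)})\cdots p_{\lambda^{(n)}}(x^{(1)},\dots,x^{(n)})$, with $m_\lambda,p_\lambda$ the usual monomial and power-sum symmetric functions; the space of multi-symmetric functions is the $\mathbb Q(q,t)$-vector space with basis $\{m_{\pmb\lambda}\}$. Dominance ordering on multi-partitions: $\pmb\mu\le\pmb\lambda$ iff $\big(\sum_{i<k}|\mu^{(i)}|\big)+\mu^{(k)}_1+\cdots+\mu^{(k)}_j\le\big(\sum_{i<k}|\lambda^{(i)}|\big)+\lambda^{(k)}_1+\cdots+\lambda^{(k)}_j$ for all $j,k$. Let $\overline{\pmb\lambda}=(|\lambda^{(1)}|,\dots,|\lambda^{(n)}|)$, $|\alpha|=\sum_i\alpha_i$ and $n(\alpha)=\sum_i(i-1)\alpha_i$ for $\alpha\in\mathbb N^n$, and $z_\lambda=\prod_{i\ge1}i^{m_i(\lambda)}m_i(\lambda)!$ with $m_i(\lambda)$ the number of parts of $\lambda$ equal to $i$. The bilinear scalar product is $\langle\!\langle p_{\pmb\lambda},p_{\pmb\mu}\rangle\!\rangle_{q,t,n}=\delta_{\pmb\lambda,\pmb\mu}\,q^{(n-1)|\overline{\pmb\lambda}|-n(\overline{\pmb\lambda})}z_{\lambda^{(1)}}\cdots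 z_{\lambda^{(n)}}\prod_{i=1}^{\ell(\lambda^{(n)})}\frac{1-q^{\lambda^{(n)}_i}}{1-t^{\lambda^{(n)}_i}}$. The multi-Macdonald polynomials $\{P^{(q,t)}_{\pmb\lambda}(x^{(1)},\dots,x^{(n)})\}$ are the unique basis of the space of multi-symmetric functions with $P^{(q,t)}_{\pmb\lambda}=m_{\pmb\lambda}+$ (a linear combination of $m_{\pmb\mu}$, $\pmb\mu<\pmb\lambda$) and $\langle\!\langle P^{(q,t)}_{\pmb\lambda},P^{(q,t)}_{\pmb\mu}\rangle\!\rangle_{q,t,n}=0$ for $\pmb\lambda\ne\pmb\mu$. $P_\lambda^{(Q,T)}$ (single partition $\lambda$) is the usual Macdonald polynomial with parameters $Q,T$: the unique basis of symmetric functions that is unitriangular in the monomial basis for dominance order and orthogonal for $\langle\!\langle p_\lambda,p_\mu\rangle\!\rangle_{Q,T}=\delta_{\lambda\mu}z_\lambda\prod_{i=1}^{\ell(\lambda)}\frac{1-Q^{\lambda_i}}{1-T^{\lambda_i}}$. Plethystic notation: for $A=\sum_jc_j(q,t)X^{(j)}$, $p_r[A]=\sum_jc_j(q^r,t^r)\,p_r(x^{(j)})$, and $f[A]$ for a symmetric function $f$ with coefficients in $\mathbb Q(q,t)$ is obtained by writing $f$ as a polynomial in the $p_r$ and replacing each $p_r$ by $p_r[A]$, leaving the coefficients of $f$ unchanged. *)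

theory Defs
  imports
    "HOL-Library.Multiset"
    "HOL-Computational_Algebra.Computational_Algebra"
    "HOL-Computational_Algebra.Field_as_Ring"
begin

text \<open>
  A monomial in variables of type 'v is a finite multiset of variables. A series assigns a
  coefficient to every monomial; infinitely many variables may occur.
\<close>

typedef ('v, 'a) series = "UNIV :: ('v multiset \<Rightarrow> 'a) set"
  morphisms coeff_series Series ..

setup_lifting type_definition_series

lemma series_eqI: "(\<And>M. coeff_series f M = coeff_series g M) \<Longrightarrow> f = g"
  by transfer auto

lemma finite_submultisets: "finite {A. A \<subseteq># M}"
proof -
  have "A \<in> mset ` {xs. set xs \<subseteq> set_mset M \<and> length xs \<le> size M}" if "A \<subseteq># M" for A
  proof -
    obtain xs where "mset xs = A" by (metis ex_mset)
    moreover from this that have "set xs \<subseteq> set_mset M" "length xs \<le> size M"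
      by (auto dest: mset_subset_eqD size_mset_mono)
    ultimately show ?thesis by blast
  qed
  then have "{A. A \<subseteq># M} \<subseteq> mset ` {xs. set xs \<subseteq> set_mset M \<and> length xs \<le> size M}"
    by blast
  then show ?thesis
    by (rule finite_subset) (simp add: finite_lists_length_le)
qed

instantiation series :: (type, comm_ring_1) comm_ring_1
begin

lift_definition zero_series :: "('a, 'b) series" is "\<lambda>_. 0" .
lift_definition one_series :: "('a, 'b) series" is "\<lambda>M. if M = {#} then 1 else 0" .
lift_definition plus_series :: "('a, 'b) series \<Rightarrow> ('a, 'b) series \<Rightarrow> ('a, 'b) series"
  is "\<lambda>f g M. f M + g M" .
lift_definition minus_series :: "('a, 'b) series \<Rightarrow> ('a, 'b) series \<Rightarrow> ('a, 'b) series"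
  is "\<lambda>f g M. f M - g M" .
lift_definition uminus_series :: "('a, 'b) series \<Rightarrow> ('a, 'b) series"
  is "\<lambda>f M. - f M" .
lift_definition times_series :: "('a, 'b) series \<Rightarrow> ('a, 'b) series \<Rightarrow> ('a, 'b) series"
  is "\<lambda>f g M. \<Sum>A | A \<subseteq># M. f A * g (M - A)" .

instance
proof
  fix a b c :: "('a, 'b) series"
  show "a + b + c = a + (b + c)" by transfer (simp add: add.assoc)
  show "a + b = b + a" by transfer (simp add: add.commute)
  show "0 + a = a" by transfer simp
  show "- a + a = 0" by transfer simp
  show "a - b = a + - b" by transfer simp
  show "(a + b) * c = a * c + b * c"
    by transfer (simp add: distrib_right sum.distrib)
  show "(0 :: ('a, 'b) series) \<noteq> 1" by transfer (metis zero_neq_one)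
  show "1 * a = a"
  proof transfer
    fix a :: "'a multiset \<Rightarrow> 'b"
    show "(\<lambda>M. \<Sum>A | A \<subseteq># M. (if A = {#} then 1 else 0) * a (M - A)) = a"
    proof
      fix M :: "'a multiset"
      have "(\<Sum>A | A \<subseteq># M. (if A = {#} then 1 else 0) * a (M - A))
          = (\<Sum>A \<in> {{#}}. (if A = {#} then 1 else 0) * a (M - A))"
        by (rule sum.mono_neutral_right) (auto simp: finite_submultisets)
      then show "(\<Sum>A | A \<subseteq># M. (if A = {#} then 1 else 0) * a (M - A)) = a M" by simp
    qed
  qed
  show "a * b = b * a"
  proof transfer
    fix a b :: "'a multiset \<Rightarrow> 'b"
    show "(\<lambda>M. \<Sum>A | A \<subseteq># M. a A * b (M - A)) = (\<lambda>M. \<Sum>A | A \<subseteq># M. b A * a (M - A))"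
    proof
      fix M :: "'a multiset"
      have [simp]: "M - (M - A) = A" if "A \<subseteq># M" for A
        using that by (auto simp: multiset_eq_iff subseteq_mset_def)
      show "(\<Sum>A | A \<subseteq># M. a A * b (M - A)) = (\<Sum>A | A \<subseteq># M. b A * a (M - A))"
        by (rule sum.reindex_bij_witness[where i = "\<lambda>A. M - A" and j = "\<lambda>A. M - A"])
           (auto simp: mult.commute)
    qed
  qed
  show "a * b * c = a * (b * c)"
  proof transfer
    fix a b c :: "'a multiset \<Rightarrow> 'b"
    show "(\<lambda>M. \<Sum>A | A \<subseteq># M. (\<Sum>B | B \<subseteq># A. a B * b (A - B)) * c (M - A)) =
          (\<lambda>M. \<Sum>A | A \<subseteq># M. a A * (\<Sum>B | B \<subseteq># M - A. b B * c (M - A - B)))"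
    proof
      fix M :: "'a multiset"
      have "(\<Sum>A | A \<subseteq># M. (\<Sum>B | B \<subseteq># A. a B * b (A - B)) * c (M - A))
          = (\<Sum>(A, B) \<in> Sigma {A. A \<subseteq># M} (\<lambda>A. {B. B \<subseteq># A}). a B * b (A - B) * c (M - A))"
        by (simp add: sum_distrib_right sum.Sigma finite_submultisets)
      also have "\<dots> = (\<Sum>(A, B) \<in> Sigma {A. A \<subseteq># M} (\<lambda>A. {B. B \<subseteq># M - A}).
                        a A * (b B * c (M - A - B)))"
      proof (rule sum.reindex_bij_witness
          [where i = "\<lambda>(A, B). (A + B, A)" and j = "\<lambda>(A, B). (B, A - B)"], goal_cases)
        case (1 x) then show ?case by (auto simp: subset_mset.add_diff_inverse)
      next
        case (2 x) then show ?case
          by (auto simp: subseteq_mset_def intro: order_trans intro!: diff_le_mono)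
      next
        case (3 x) then show ?case by auto
      next
        case (4 x) then show ?case
          apply (auto simp: subseteq_mset_def)
          by (metis add.commute le_diff_conv2 order_trans)
      next
        case (5 x) then show ?case
          by (auto simp: mult.assoc multiset_eq_iff subseteq_mset_def
              intro!: arg_cong[of _ _ "\<lambda>z. a _ * (b _ * c z)"])
      qed
      also have "\<dots> = (\<Sum>A | A \<subseteq># M. a A * (\<Sum>B | B \<subseteq># M - A. b B * c (M - A - B)))"
        by (simp add: sum_distrib_left sum.Sigma finite_submultisets)
      finally show "(\<Sum>A | A \<subseteq># M. (\<Sum>B | B \<subseteq># A. a B * b (A - B)) * c (M - A)) =
          (\<Sum>A | A \<subseteq># M. a A * (\<Sum>B | B \<subseteq># M - A. b B * c (M - A - B)))" .
    qed
  qed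
qed

end

lift_definition scale_series :: "'a::comm_ring_1 \<Rightarrow> ('v, 'a) series \<Rightarrow> ('v, 'a) series"
  is "\<lambda>c f M. c * f M" .

global_interpretation series: vector_space "scale_series :: 'a::field \<Rightarrow> ('v, 'a) series \<Rightarrow> _"
  by unfold_locales (transfer; simp add: fun_eq_iff algebra_simps)+

definition family_basis ::
  "'i set \<Rightarrow> ('i \<Rightarrow> ('v, 'a::field) series) \<Rightarrow> ('v, 'a) series set \<Rightarrow> bool" where
  "family_basis I b W \<longleftrightarrow>
     inj_on b I \<and> series.independent (b ` I) \<and> series.span (b ` I) = W"

text \<open>\<open>representation\<close> is 0 for vectors outside the span and for families that are not independent.\<close>

definition coord ::
  "'i set \<Rightarrow> ('i \<Rightarrow> ('v, 'a::field) series) \<Rightarrow> ('v, 'a) series \<Rightarrow> 'i \<Rightarrow> 'a" where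
  "coord I b f i = series.representation (b ` I) f (b i)"

text \<open>The bilinear form with value \<open>N i j\<close> on the pair of basis vectors \<open>b i\<close>, \<open>b j\<close>.\<close>

definition bilinear_form ::
  "'i set \<Rightarrow> ('i \<Rightarrow> ('v, 'a::field) series) \<Rightarrow> ('i \<Rightarrow> 'i \<Rightarrow> 'a) \<Rightarrow>
     ('v, 'a) series \<Rightarrow> ('v, 'a) series \<Rightarrow> 'a" where
  "bilinear_form I b N f g =
     (\<Sum>i | i \<in> I \<and> coord I b f i \<noteq> 0. \<Sum>j | j \<in> I \<and> coord I b g j \<noteq> 0.
        coord I b f i * coord I b g j * N i j)"

definition unitriangular_orthogonal_basis ::
  "'i set \<Rightarrow> ('i \<Rightarrow> 'i \<Rightarrow> bool) \<Rightarrow> ('i \<Rightarrow> ('v, 'a::field) series) \<Rightarrow>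
     (('v, 'a) series \<Rightarrow> ('v, 'a) series \<Rightarrow> 'a) \<Rightarrow> ('i \<Rightarrow> ('v, 'a) series) \<Rightarrow> bool" where
  "unitriangular_orthogonal_basis I le m B P \<longleftrightarrow>
     family_basis I P (series.span (m ` I)) \<and>
     (\<forall>i\<in>I. P i - m i \<in> series.span (m ` {j \<in> I. le j i \<and> j \<noteq> i})) \<and>
     (\<forall>i\<in>I. \<forall>j\<in>I. i \<noteq> j \<longrightarrow> B (P i) (P j) = 0)"

text \<open>
  Partitions are weakly decreasing lists of positive parts. Missing parts count as zero, so
  the sum of the first \<open>j\<close> parts is \<open>sum_list (take j l)\<close> for every \<open>j\<close>.
\<close>

definition is_partition :: "nat list \<Rightarrow> bool" where
  "is_partition l \<longleftrightarrow> sorted_wrt (\<ge>) l \<and> 0 \<notin> set l"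

definition dominance :: "nat list \<Rightarrow> nat list \<Rightarrow> bool" where
  "dominance m l \<longleftrightarrow>
     sum_list m = sum_list l \<and> (\<forall>j. sum_list (take j m) \<le> sum_list (take j l))"

definition zee :: "nat list \<Rightarrow> nat" where
  "zee l = (\<Prod>i\<in>set l. i ^ count_list l i * fact (count_list l i))"

text \<open>
  Symmetric functions in the alphabet consisting of the variables in \<open>V\<close>: a monomial occurs in
  \<open>msym V l\<close>, with coefficient 1, iff its nonzero exponents are the parts of \<open>l\<close> in some order.
\<close>

definition msym :: "'v set \<Rightarrow> nat list \<Rightarrow> ('v, 'a::comm_ring_1) series" where
  "msym V l = Series (\<lambda>M. if set_mset M \<subseteq> V \<and>
     image_mset (count M) (mset_set (set_mset M)) = mset l then 1 else 0)"

definition power_sum :: "'v set \<Rightarrow> nat \<Rightarrow> ('v, 'a::comm_ring_1) series" where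
  "power_sum V r = Series (\<lambda>M. if \<exists>x\<in>V. M = replicate_mset r x then 1 else 0)"

definition psym :: "'v set \<Rightarrow> nat list \<Rightarrow> ('v, 'a::comm_ring_1) series" where
  "psym V l = (\<Prod>r\<leftarrow>l. power_sum V r)"

text \<open>The inner polynomial variable is \<open>q\<close>, the outer one is \<open>t\<close>.\<close>

type_synonym qt_field = "rat poly poly fract"

definition qq :: qt_field where "qq = Fract [:[:0, 1:]:] 1"
definition tt :: qt_field where "tt = Fract [:0, 1:] 1"

text \<open>\<open>qt_power r c\<close> is \<open>c(q^r, t^r)\<close>, for \<open>r \<ge> 1\<close>.\<close>

definition qt_power_poly :: "nat \<Rightarrow> rat poly poly \<Rightarrow> rat poly poly" where
  "qt_power_poly r a = pcompose (map_poly (\<lambda>p. pcompose p (monom 1 r)) a) (monom 1 r)"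

definition qt_power :: "nat \<Rightarrow> qt_field \<Rightarrow> qt_field" where
  "qt_power r c = (case quot_of_fract c of (a, b) \<Rightarrow>
     Fract (qt_power_poly r a) (qt_power_poly r b))"

text \<open>A single infinite alphabet is indexed by the natural numbers.\<close>

type_synonym sym = "(nat, qt_field) series"

definition macdonald_form :: "qt_field \<Rightarrow> qt_field \<Rightarrow> sym \<Rightarrow> sym \<Rightarrow> qt_field" where
  "macdonald_form Q T = bilinear_form {l. is_partition l} (psym UNIV)
     (\<lambda>l m. if l = m then of_nat (zee l) * (\<Prod>r\<leftarrow>l. (1 - Q ^ r) / (1 - T ^ r)) else 0)"

definition macdonald_basis :: "qt_field \<Rightarrow> qt_field \<Rightarrow> (nat list \<Rightarrow> sym) \<Rightarrow> bool" where
  "macdonald_basis Q T P \<longleftrightarrow>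
     unitriangular_orthogonal_basis {l. is_partition l} dominance (msym UNIV)
       (macdonald_form Q T) P"

text \<open>
  The variable \<open>(i, j)\<close> is the \<open>j\<close>-th letter of the \<open>i\<close>-th alphabet. Alphabets are numbered
  from 1 to \<open>n\<close>, letters from 0.
\<close>

type_synonym msf = "(nat \<times> nat, qt_field) series"

abbreviation alphabets :: "nat set \<Rightarrow> (nat \<times> nat) set" where
  "alphabets K \<equiv> K \<times> UNIV"

text \<open>
  An \<open>n\<close>-tuple of partitions is a function on \<open>{1..n}\<close>, taken empty elsewhere so that
  equality of functions is equality of tuples.
\<close>

definition multipartitions :: "nat \<Rightarrow> (nat \<Rightarrow> nat list) set" where
  "multipartitions n = {L. (\<forall>i. is_partition (L i)) \<and> (\<forall>i. i \<notin> {1..n} \<longrightarrow> L i = [])}"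

text \<open>Equality of total sizes is not required, unlike in \<open>dominance\<close>.\<close>

definition multi_dominance ::
  "nat \<Rightarrow> (nat \<Rightarrow> nat list) \<Rightarrow> (nat \<Rightarrow> nat list) \<Rightarrow> bool" where
  "multi_dominance n M L \<longleftrightarrow> (\<forall>k\<in>{1..n}. \<forall>j.
     (\<Sum>i\<in>{1..<k}. sum_list (M i)) + sum_list (take j (M k)) \<le>
     (\<Sum>i\<in>{1..<k}. sum_list (L i)) + sum_list (take j (L k)))"

definition multi_msym :: "nat \<Rightarrow> (nat \<Rightarrow> nat list) \<Rightarrow> msf" where
  "multi_msym n L = (\<Prod>i=1..n. msym (alphabets {i}) (L i))"

definition multi_psym :: "nat \<Rightarrow> (nat \<Rightarrow> nat list) \<Rightarrow> msf" where
  "multi_psym n L = (\<Prod>i=1..n. psym (alphabets {1..i}) (L i))"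

text \<open>The subtraction in the exponent of \<open>q\<close> is not truncated, since \<open>i - 1 \<le> n - 1\<close>.\<close>

definition multi_form :: "nat \<Rightarrow> msf \<Rightarrow> msf \<Rightarrow> qt_field" where
  "multi_form n = bilinear_form (multipartitions n) (multi_psym n)
     (\<lambda>L M. if L = M then
        qq ^ ((n - 1) * (\<Sum>i=1..n. sum_list (L i)) - (\<Sum>i=1..n. (i - 1) * sum_list (L i)))
        * (\<Prod>i=1..n. of_nat (zee (L i)))
        * (\<Prod>r\<leftarrow>L n. (1 - qq ^ r) / (1 - tt ^ r))
      else 0)"

definition multi_macdonald_basis :: "nat \<Rightarrow> ((nat \<Rightarrow> nat list) \<Rightarrow> msf) \<Rightarrow> bool" where
  "multi_macdonald_basis n P \<longleftrightarrow>
     unitriangular_orthogonal_basis (multipartitions n) (multi_dominance n) (multi_msym n)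
       (multi_form n) P"

text \<open>
  A multi-Macdonald basis is determined only on multi-partitions, so the description
  is applied to its value at \<open>L\<close>.
\<close>

definition multi_macdonald :: "nat \<Rightarrow> (nat \<Rightarrow> nat list) \<Rightarrow> msf" where
  "multi_macdonald n L = (THE F. \<exists>P. multi_macdonald_basis n P \<and> F = P L)"

text \<open>The function \<open>A\<close> stands for the combination \<open>\<Sum>j=1..n. A j * X^(j)\<close> of the alphabets.\<close>

definition power_sum_plethysm :: "nat \<Rightarrow> (nat \<Rightarrow> qt_field) \<Rightarrow> nat \<Rightarrow> msf" where
  "power_sum_plethysm n A r =
     (\<Sum>j=1..n. scale_series (qt_power r (A j)) (power_sum (alphabets {j}) r))"

definition plethysm :: "nat \<Rightarrow> sym \<Rightarrow> (nat \<Rightarrow> qt_field) \<Rightarrow> msf" where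
  "plethysm n f A =
     (\<Sum>l | is_partition l \<and> coord {l. is_partition l} (psym UNIV) f l \<noteq> 0.
        scale_series (coord {l. is_partition l} (psym UNIV) f l)
          (\<Prod>r\<leftarrow>l. power_sum_plethysm n A r))"

fun alphabet_A :: "nat \<Rightarrow> nat \<Rightarrow> nat \<Rightarrow> qt_field" where
  "alphabet_A n 0 = (\<lambda>j. if j = n then 1 else 0)"
| "alphabet_A n (Suc i) = (\<lambda>j. (if j = n - Suc i then 1 else 0) +
     qq * (1 - qq ^ i * tt) / (1 - qq ^ Suc i * tt) * alphabet_A n i j)"

definition param_q :: "nat \<Rightarrow> nat \<Rightarrow> qt_field" where
  "param_q n i = (if i = 1 then qq else qq ^ (n - i + 1) * tt)"

definition param_t :: "nat \<Rightarrow> nat \<Rightarrow> qt_field" where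
  "param_t n i = qq ^ (n - i) * tt"

end

theory Submission
  imports Defs "HOL-Combinatorics.Permutations" "HOL-Library.FuncSet"
begin

text \<open>
  A basis that is unitriangular over the monomial functions and orthogonal for a nondegenerate form
  is unique (\<open>unitriangular_orthogonal_basis_unique\<close>), so it suffices that the family of products of
  plethysms has both properties.

  Orthogonality. The products of power sums \<open>p_r(x^(1), ..., x^(i))\<close> are orthogonal, and their norms
  are those of a Gaussian form: the form on polynomials in these power sums that is determined by its
  values on the power sums themselves, because multiplication by a generator is adjoint to a
  derivation. Such a form does not care which orthogonal generators are chosen
  (\<open>orthogonal_products\<close>). For each \<open>r\<close> the power sums \<open>p_r[A_(n-1)], ..., p_r[A_0]\<close> are another
  orthogonal choice: the recursion for the alphabets is a Gram-Schmidt process starting from the last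
  alphabet (\<open>alphabet_gram_matrix\<close>). The norm of \<open>p_r[A_(n-i)]\<close> turns out to be \<open>q^(r(n-i))\<close> times the
  norm of \<open>p_r\<close> in the Macdonald form with the parameters of the \<open>i\<close>-th factor. Hence the scalar
  product of two products is, up to a power of \<open>q\<close>, the product of the Macdonald scalar products of
  the factors (\<open>form_product_series\<close>), which vanishes if the factors differ somewhere.

  Triangularity. The alphabet \<open>A_(n-i)\<close> is \<open>X^(i)\<close> plus multiples of later alphabets. Finitely many
  letters of \<open>X^(i)\<close> can be separated from the rest before the rest is specialised
  (\<open>coeff_specialize_slice\<close>); therefore the exponents of these letters in a monomial of the \<open>i\<close>-th
  factor are the exponents in a monomial of the ordinary Macdonald polynomial, which are controlled by
  dominance, and all other degree goes to later alphabets. Adding this up over the factors gives the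
  dominance bound (\<open>product_series_dominance\<close>), and the monomial attaining it arises in one way only
  (\<open>product_series_leading\<close>).

  The scalar products and the plethysms are defined through coordinates with respect to power sums, so
  all of this rests on the fact that products of power sums form a basis. It is proved by
  triangularity as well: expanding a product of power sums merges parts and moves them to earlier
  alphabets, which increases them in the dominance order (\<open>triangular_power_product\<close>).
\<close>

section \<open>Linear algebra of families of series\<close>

lemma independent_familyI:
  fixes b :: "'i \<Rightarrow> ('v, 'a::field) series"
  assumes "\<And>S u i. finite S \<Longrightarrow> S \<subseteq> I \<Longrightarrow> (\<Sum>i\<in>S. scale_series (u i) (b i)) = 0 \<Longrightarrow> i \<in> S \<Longrightarrow> u i = 0"
  shows "inj_on b I" "series.independent (b ` I)"
proof -
  show inj: "inj_on b I"
  proof (rule inj_onI, rule ccontr)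
    fix i j assume ij: "i \<in> I" "j \<in> I" "b i = b j" "i \<noteq> j"
    have "(\<Sum>k\<in>{i, j}. scale_series (if k = i then 1 else - 1) (b k)) = 0"
      using ij by simp
    from assms[OF _ _ this, of i] ij show False by auto
  qed
  show "series.independent (b ` I)"
    unfolding series.dependent_explicit
  proof clarify
    fix T u v assume T: "finite T" "T \<subseteq> b ` I" "(\<Sum>v\<in>T. scale_series (u v) v) = 0"
      and v: "v \<in> T" "u v \<noteq> 0"
    from T(2) obtain S where S: "S \<subseteq> I" "T = b ` S" by (meson subset_imageE)
    have injS: "inj_on b S" using inj S inj_on_subset by blast
    have "(\<Sum>i\<in>S. scale_series (u (b i)) (b i)) = 0"
      using T(3) S by (simp add: sum.reindex[OF injS])
    moreover have "finite S" using T(1) S injS finite_image_iff by blast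
    ultimately show False using assms[of S "\<lambda>i. u (b i)"] S v by auto
  qed
qed

context
  fixes I :: "'i set" and b :: "'i \<Rightarrow> ('v, 'a::field) series"
  assumes inj: "inj_on b I" and indep: "series.independent (b ` I)"
begin

lemma coord_basis: "i \<in> I \<Longrightarrow> j \<in> I \<Longrightarrow> coord I b (b i) j = (if i = j then 1 else 0)"
  using inj by (auto simp: coord_def series.representation_basis[OF indep] inj_on_eq_iff)

lemma coord_add: "f \<in> series.span (b ` I) \<Longrightarrow> g \<in> series.span (b ` I) \<Longrightarrow>
    coord I b (f + g) i = coord I b f i + coord I b g i"
  by (simp add: coord_def series.representation_add[OF indep])

lemma coord_scale: "f \<in> series.span (b ` I) \<Longrightarrow>
    coord I b (scale_series c f) i = c * coord I b f i"
  by (simp add: coord_def series.representation_scale[OF indep])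

lemma coord_zero: "coord I b 0 i = 0"
  by (simp add: coord_def series.representation_zero)

lemma coord_sum: "(\<And>k. k \<in> K \<Longrightarrow> f k \<in> series.span (b ` I)) \<Longrightarrow>
    coord I b (sum f K) i = (\<Sum>k\<in>K. coord I b (f k) i)"
  by (simp add: coord_def series.representation_sum[OF indep])

lemma finite_coord: "finite {i. i \<in> I \<and> coord I b f i \<noteq> 0}"
proof -
  have "b ` {i. i \<in> I \<and> coord I b f i \<noteq> 0} \<subseteq> {v. series.representation (b ` I) f v \<noteq> 0}"
    by (auto simp: coord_def)
  then have "finite (b ` {i. i \<in> I \<and> coord I b f i \<noteq> 0})"
    using series.finite_representation finite_subset by blast
  moreover have "inj_on b {i. i \<in> I \<and> coord I b f i \<noteq> 0}"
    using inj by (auto simp: inj_on_def)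
  ultimately show ?thesis using finite_image_iff by blast
qed

lemma sum_coord:
  assumes "f \<in> series.span (b ` I)"
  shows "(\<Sum>i | i \<in> I \<and> coord I b f i \<noteq> 0. scale_series (coord I b f i) (b i)) = f"
proof -
  let ?S = "{i. i \<in> I \<and> coord I b f i \<noteq> 0}"
  have injS: "inj_on b ?S" using inj by (auto simp: inj_on_def)
  have im: "b ` ?S = {v. series.representation (b ` I) f v \<noteq> 0}"
    using series.representation_ne_zero[of "b ` I" f] by (force simp: coord_def)
  have "(\<Sum>i\<in>?S. scale_series (coord I b f i) (b i)) =
     (\<Sum>v\<in>b ` ?S. scale_series (series.representation (b ` I) f v) v)"
    unfolding coord_def by (simp add: sum.reindex[OF injS[unfolded coord_def]])
  also have "\<dots> = f"
    unfolding im by (rule series.sum_nonzero_representation_eq[OF indep assms])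
  finally show ?thesis .
qed

lemma coord_outside:
  assumes "D \<subseteq> I" "f \<in> series.span (b ` D)" "j \<in> I - D"
  shows "coord I b f j = 0"
proof -
  have "series.representation (b ` I) f = series.representation (b ` D) f"
    using assms by (intro series.representation_extend[OF indep]) auto
  moreover have "b j \<notin> b ` D" using inj assms by (auto simp: inj_on_def)
  ultimately show ?thesis using series.representation_ne_zero unfolding coord_def by metis
qed

end

text \<open>
  Off the span of \<open>b\<close> all coordinates are 0, so the value there is 0.
\<close>

definition extend_linearly ::
  "'i set \<Rightarrow> ('i \<Rightarrow> ('v, 'a::field) series) \<Rightarrow> ('i \<Rightarrow> ('w, 'a) series) \<Rightarrow> ('v, 'a) series \<Rightarrow> ('w, 'a) series" where
  "extend_linearly I b h f = (\<Sum>i | i \<in> I \<and> coord I b f i \<noteq> 0. scale_series (coord I b f i) (h i))"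

context
  fixes I :: "'i set" and b :: "'i \<Rightarrow> ('v, 'a::field) series"
  assumes inj: "inj_on b I" and indep: "series.independent (b ` I)"
begin

lemma extend_linearly_superset:
  assumes "finite S" "S \<subseteq> I" "\<And>i. i \<in> I - S \<Longrightarrow> coord I b f i = 0"
  shows "extend_linearly I b h f = (\<Sum>i\<in>S. scale_series (coord I b f i) (h i))"
  unfolding extend_linearly_def using assms by (intro sum.mono_neutral_left) auto

lemma extend_linearly_add:
  assumes "f \<in> series.span (b ` I)" "g \<in> series.span (b ` I)"
  shows "extend_linearly I b h (f + g) = extend_linearly I b h f + extend_linearly I b h g"
proof -
  let ?S = "{i. i \<in> I \<and> coord I b f i \<noteq> 0} \<union> {i. i \<in> I \<and> coord I b g i \<noteq> 0}"
  have fin: "finite ?S" using finite_coord[OF inj indep] by blast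
  note ca = coord_add[OF inj indep assms]
  have "extend_linearly I b h (f + g) = (\<Sum>i\<in>?S. scale_series (coord I b (f + g) i) (h i))"
    by (rule extend_linearly_superset[OF fin]) (auto simp: ca)
  also have "\<dots> = (\<Sum>i\<in>?S. scale_series (coord I b f i) (h i)) + (\<Sum>i\<in>?S. scale_series (coord I b g i) (h i))"
    by (simp add: ca series.scale_left_distrib sum.distrib)
  also have "(\<Sum>i\<in>?S. scale_series (coord I b f i) (h i)) = extend_linearly I b h f"
    by (rule extend_linearly_superset[OF fin, symmetric]) auto
  also have "(\<Sum>i\<in>?S. scale_series (coord I b g i) (h i)) = extend_linearly I b h g"
    by (rule extend_linearly_superset[OF fin, symmetric]) auto
  finally show ?thesis .
qed

lemma extend_linearly_scale:
  assumes "f \<in> series.span (b ` I)"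
  shows "extend_linearly I b h (scale_series c f) = scale_series c (extend_linearly I b h f)"
proof -
  let ?S = "{i. i \<in> I \<and> coord I b f i \<noteq> 0}"
  have fin: "finite ?S" using finite_coord[OF inj indep] by blast
  note ca = coord_scale[OF inj indep assms]
  have "extend_linearly I b h (scale_series c f) = (\<Sum>i\<in>?S. scale_series (coord I b (scale_series c f) i) (h i))"
    by (rule extend_linearly_superset[OF fin]) (auto simp: ca)
  also have "\<dots> = scale_series c (extend_linearly I b h f)"
    by (simp add: ca extend_linearly_def series.scale_sum_right)
  finally show ?thesis .
qed

lemma extend_linearly_zero: "extend_linearly I b h 0 = 0"
  by (simp add: extend_linearly_def coord_zero[OF inj indep])

lemma extend_linearly_sum:
  assumes "\<And>k. k \<in> K \<Longrightarrow> f k \<in> series.span (b ` I)"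
  shows "extend_linearly I b h (sum f K) = (\<Sum>k\<in>K. extend_linearly I b h (f k))"
  using assms by (induction K rule: infinite_finite_induct)
    (auto simp: extend_linearly_zero extend_linearly_add series.span_sum)

lemma extend_linearly_basis:
  assumes "i \<in> I"
  shows "extend_linearly I b h (b i) = h i"
proof -
  have "extend_linearly I b h (b i) = (\<Sum>k\<in>{i}. scale_series (coord I b (b i) k) (h k))"
    using assms by (intro extend_linearly_superset) (auto simp: coord_basis[OF inj indep])
  then show ?thesis using assms by (simp add: coord_basis[OF inj indep])
qed

lemma bilinear_form_superset:
  assumes "finite S" "S \<subseteq> I" "\<And>i. i \<in> I - S \<Longrightarrow> coord I b f i = 0" "\<And>i. i \<in> I - S \<Longrightarrow> coord I b g i = 0"
  shows "bilinear_form I b N f g = (\<Sum>i\<in>S. \<Sum>j\<in>S. coord I b f i * coord I b g j * N i j)"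
proof -
  have "bilinear_form I b N f g = (\<Sum>i | i \<in> I \<and> coord I b f i \<noteq> 0. \<Sum>j\<in>S. coord I b f i * coord I b g j * N i j)"
    unfolding bilinear_form_def
    using assms by (intro sum.cong sum.mono_neutral_left) auto
  also have "\<dots> = (\<Sum>i\<in>S. \<Sum>j\<in>S. coord I b f i * coord I b g j * N i j)"
    using assms by (intro sum.mono_neutral_left) auto
  finally show ?thesis .
qed

lemma bilinear_form_add_left:
  assumes "f \<in> series.span (b ` I)" "f' \<in> series.span (b ` I)"
  shows "bilinear_form I b N (f + f') g = bilinear_form I b N f g + bilinear_form I b N f' g"
proof -
  let ?S = "{i. i \<in> I \<and> coord I b f i \<noteq> 0} \<union> {i. i \<in> I \<and> coord I b f' i \<noteq> 0} \<union> {i. i \<in> I \<and> coord I b g i \<noteq> 0}"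
  have fin: "finite ?S" using finite_coord[OF inj indep] by blast
  note ca = coord_add[OF inj indep assms]
  have 1: "bilinear_form I b N h g = (\<Sum>i\<in>?S. \<Sum>j\<in>?S. coord I b h i * coord I b g j * N i j)"
    if "h \<in> {f + f', f, f'}" for h
    using that by (intro bilinear_form_superset[OF fin]) (auto simp: ca)
  show ?thesis by (simp add: 1 ca sum.distrib algebra_simps)
qed

lemma bilinear_form_scale_left:
  assumes "f \<in> series.span (b ` I)"
  shows "bilinear_form I b N (scale_series c f) g = c * bilinear_form I b N f g"
proof -
  let ?S = "{i. i \<in> I \<and> coord I b f i \<noteq> 0} \<union> {i. i \<in> I \<and> coord I b g i \<noteq> 0}"
  have fin: "finite ?S" using finite_coord[OF inj indep] by blast
  note ca = coord_scale[OF inj indep assms]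
  have 1: "bilinear_form I b N h g = (\<Sum>i\<in>?S. \<Sum>j\<in>?S. coord I b h i * coord I b g j * N i j)"
    if "h \<in> {scale_series c f, f}" for h
    using that by (intro bilinear_form_superset[OF fin]) (auto simp: ca)
  show ?thesis by (simp add: 1 ca sum_distrib_left mult.assoc)
qed

lemma bilinear_form_commute:
  assumes "\<And>i j. N i j = N j i"
  shows "bilinear_form I b N f g = bilinear_form I b N g f"
proof -
  have "bilinear_form I b N f g = (\<Sum>j | j \<in> I \<and> coord I b g j \<noteq> 0. \<Sum>i | i \<in> I \<and> coord I b f i \<noteq> 0.
        coord I b f i * coord I b g j * N i j)"
    unfolding bilinear_form_def by (rule sum.swap)
  also have "\<dots> = bilinear_form I b N g f"
    unfolding bilinear_form_def by (intro sum.cong refl) (simp add: assms mult.commute)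
  finally show ?thesis .
qed

lemma bilinear_form_basis:
  assumes "i \<in> I" "j \<in> I"
  shows "bilinear_form I b N (b i) (b j) = N i j"
proof -
  have "bilinear_form I b N (b i) (b j) = (\<Sum>k\<in>{i,j}. \<Sum>l\<in>{i,j}. coord I b (b i) k * coord I b (b j) l * N k l)"
    using assms by (intro bilinear_form_superset) (auto simp: coord_basis[OF inj indep])
  also have "\<dots> = N i j" using assms by (cases "i = j") (auto simp: coord_basis[OF inj indep])
  finally show ?thesis .
qed

end

lemma symmetric_form_sum_left:
  fixes B :: "('v, 'a::field) series \<Rightarrow> ('v, 'a) series \<Rightarrow> 'a"
  assumes add: "\<And>f g h. f \<in> series.span X \<Longrightarrow> g \<in> series.span X \<Longrightarrow> B (f + g) h = B f h + B g h"
    and scale: "\<And>c f h. f \<in> series.span X \<Longrightarrow> B (scale_series c f) h = c * B f h"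
    and f: "\<And>k. k \<in> K \<Longrightarrow> f k \<in> series.span X"
  shows "B (\<Sum>k\<in>K. scale_series (u k) (f k)) h = (\<Sum>k\<in>K. u k * B (f k) h)"
proof -
  have z: "B 0 h = 0" using scale[of 0 0 h] by (simp add: series.span_zero)
  show ?thesis using f
    by (induction K rule: infinite_finite_induct)
      (auto simp: z add scale series.span_sum series.span_scale)
qed

section \<open>Triangular families\<close>

text \<open>
  The leading coefficients \<open>c\<close> are arbitrary nonzero scalars because the expansion of a product
  of power sums in monomial symmetric functions starts with a product of factorials. Only finitely many indices lie
  below a given one, which makes the relation well-founded where an induction needs it.
\<close>

locale triangular_family =
  fixes I :: "'i set" and lt :: "'i \<Rightarrow> 'i \<Rightarrow> bool"
    and m P :: "'i \<Rightarrow> ('v, 'a::field) series" and c :: "'i \<Rightarrow> 'a"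
  assumes inj_m: "inj_on m I" and indep_m: "series.independent (m ` I)"
    and irrefl: "\<And>i. \<not> lt i i"
    and trans: "\<And>i j k. lt i j \<Longrightarrow> lt j k \<Longrightarrow> lt i k"
    and finite_below: "\<And>i. i \<in> I \<Longrightarrow> finite {j \<in> I. lt j i}"
    and diagonal: "\<And>i. i \<in> I \<Longrightarrow> c i \<noteq> 0"
    and triangular: "\<And>i. i \<in> I \<Longrightarrow> P i - scale_series (c i) (m i) \<in> series.span (m ` {j \<in> I. lt j i})"
begin

lemma P_in_span: "i \<in> I \<Longrightarrow> i \<in> D \<Longrightarrow> {j \<in> I. lt j i} \<subseteq> D \<Longrightarrow> P i \<in> series.span (m ` D)"
proof -
  assume i: "i \<in> I" "i \<in> D" "{j \<in> I. lt j i} \<subseteq> D"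
  have "P i = (P i - scale_series (c i) (m i)) + scale_series (c i) (m i)" by simp
  also have "\<dots> \<in> series.span (m ` D)"
    using triangular[OF i(1)] i series.span_mono[OF image_mono[OF i(3)], of m]
    by (intro series.span_add[OF _ series.span_scale[OF series.span_base]]) auto
  finally show ?thesis .
qed

text \<open>
  The triangular system is solved for \<open>m i\<close> by induction on the number of indices below \<open>i\<close>.
\<close>

lemma span_eq:
  assumes "D \<subseteq> I" "\<And>i j. i \<in> D \<Longrightarrow> j \<in> I \<Longrightarrow> lt j i \<Longrightarrow> j \<in> D"
  shows "series.span (P ` D) = series.span (m ` D)"
proof (rule subset_antisym)
  show "series.span (P ` D) \<subseteq> series.span (m ` D)"
  proof (rule series.span_minimal)
    show "P ` D \<subseteq> series.span (m ` D)" using assms by (auto intro!: P_in_span)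
  qed (rule series.subspace_span)
  have "m i \<in> series.span (P ` D)" if "i \<in> D" for i
    using that
  proof (induction "card {j \<in> I. lt j i}" arbitrary: i rule: less_induct)
    case less
    have iI: "i \<in> I" using less.prems assms by blast
    have "m ` {j \<in> I. lt j i} \<subseteq> series.span (P ` D)"
    proof clarify
      fix j assume j: "j \<in> I" "lt j i"
      have "{k \<in> I. lt k j} \<subset> {k \<in> I. lt k i}"
        using j irrefl trans by blast
      then have "card {k \<in> I. lt k j} < card {k \<in> I. lt k i}"
        using finite_below[OF iI] psubset_card_mono by blast
      moreover have "j \<in> D" using assms less.prems j by blast
      ultimately show "m j \<in> series.span (P ` D)" using less.hyps by blast
    qed
    then have "series.span (m ` {j \<in> I. lt j i}) \<subseteq> series.span (P ` D)"
      by (rule series.span_minimal) (rule series.subspace_span)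
    then have *: "P i - scale_series (c i) (m i) \<in> series.span (P ` D)"
      using triangular[OF iI] by blast
    have "m i = scale_series (inverse (c i)) (P i - (P i - scale_series (c i) (m i)))"
      using diagonal[OF iI] by simp
    also have "\<dots> \<in> series.span (P ` D)"
      using less.prems by (intro series.span_scale series.span_diff[OF series.span_base *]) auto
    finally show ?case .
  qed
  then show "series.span (m ` D) \<subseteq> series.span (P ` D)"
    by (intro series.span_minimal series.subspace_span) auto
qed

text \<open>
  In a vanishing linear combination, a maximal index with nonzero coefficient contributes the
  only term in which the corresponding \<open>m\<close> occurs.
\<close>

lemma independent: "inj_on P I" "series.independent (P ` I)"
proof -
  have *: "u i = 0" if S: "finite S" "S \<subseteq> I" "(\<Sum>i\<in>S. scale_series (u i) (P i)) = 0" "i \<in> S" for S u i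
  proof (rule ccontr)
    assume ne: "u i \<noteq> 0"
    let ?T = "{i \<in> S. u i \<noteq> 0}"
    have fin: "finite ?T" "?T \<noteq> {}" using S ne by auto
    have tr: "asymp_on ?T lt" "transp_on ?T lt"
      using irrefl trans by (auto intro!: asymp_onI transp_onI)
    from Finite_Set.bex_max_element[OF fin(1) tr fin(2)]
    obtain k where k: "k \<in> ?T" "\<And>j. j \<in> ?T \<Longrightarrow> j \<noteq> k \<Longrightarrow> \<not> lt k j" by blast
    have kI: "k \<in> I" using k S by auto
    have Pm: "P j \<in> series.span (m ` I)" if "j \<in> S" for j using S that by (intro P_in_span) auto
    have c: "coord I m (P j) k = (if j = k then c k else 0)" if j: "j \<in> ?T" for j
    proof -
      have jI: "j \<in> I" using j S by auto
      have sp: "series.span (m ` {i \<in> I. lt i j}) \<subseteq> series.span (m ` I)"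
        by (intro series.span_mono) auto
      have "P j = (P j - scale_series (c j) (m j)) + scale_series (c j) (m j)" by simp
      then have "coord I m (P j) k = coord I m ((P j - scale_series (c j) (m j)) + scale_series (c j) (m j)) k"
        by simp
      also have "\<dots> = coord I m (P j - scale_series (c j) (m j)) k + c j * coord I m (m j) k"
        using triangular[OF jI] sp jI
        by (subst coord_add[OF inj_m indep_m])
           (auto simp: coord_scale[OF inj_m indep_m] series.span_base series.span_scale)
      also have "coord I m (P j - scale_series (c j) (m j)) k = 0"
        using triangular[OF jI] k j kI irrefl
        by (intro coord_outside[OF inj_m indep_m, of "{i \<in> I. lt i j}"]) auto
      finally show ?thesis using jI kI by (simp add: coord_basis[OF inj_m indep_m])
    qed
    have "0 = coord I m (\<Sum>i\<in>S. scale_series (u i) (P i)) k"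
      using S by (simp add: coord_zero[OF inj_m indep_m])
    also have "\<dots> = (\<Sum>i\<in>S. u i * coord I m (P i) k)"
      using Pm by (simp add: coord_sum[OF inj_m indep_m] coord_scale[OF inj_m indep_m] series.span_scale)
    also have "\<dots> = (\<Sum>i\<in>?T. u i * coord I m (P i) k)"
      using S by (intro sum.mono_neutral_right) auto
    also have "\<dots> = (\<Sum>i\<in>?T. if i = k then u i * c k else 0)"
      by (intro sum.cong) (auto simp: c)
    also have "\<dots> = u k * c k" using fin k by (simp add: sum.delta)
    finally show False using k diagonal[OF kI] by auto
  qed
  show "inj_on P I" "series.independent (P ` I)"
    using * by (auto intro!: independent_familyI)
qed

lemma family_basis: "family_basis I P (series.span (m ` I))"
  unfolding family_basis_def using independent span_eq[of I] by blast

end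

text \<open>
  Both bases span the same subspaces below every index, so the difference of the two members
  at an index is a combination of the members strictly below it to which it is orthogonal;
  nondegeneracy makes their norms nonzero.
\<close>

lemma unitriangular_orthogonal_basis_unique:
  fixes B :: "('v, 'a::field) series \<Rightarrow> ('v, 'a) series \<Rightarrow> 'a"
  assumes inj_m: "inj_on m I" and indep_m: "series.independent (m ` I)"
    and antisym: "\<And>i j. i \<in> I \<Longrightarrow> j \<in> I \<Longrightarrow> le i j \<Longrightarrow> le j i \<Longrightarrow> i = j"
    and trans: "\<And>i j k. le i j \<Longrightarrow> le j k \<Longrightarrow> le i k"
    and fin: "\<And>i. i \<in> I \<Longrightarrow> finite {j \<in> I. le j i}"
    and add: "\<And>f g h. f \<in> series.span (m ` I) \<Longrightarrow> g \<in> series.span (m ` I) \<Longrightarrow> B (f + g) h = B f h + B g h"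
    and scale: "\<And>c f h. f \<in> series.span (m ` I) \<Longrightarrow> B (scale_series c f) h = c * B f h"
    and commute: "\<And>f g. B f g = B g f"
    and nondeg: "\<And>f. f \<in> series.span (m ` I) \<Longrightarrow> (\<And>g. g \<in> series.span (m ` I) \<Longrightarrow> B f g = 0) \<Longrightarrow> f = 0"
    and P: "unitriangular_orthogonal_basis I le m B P"
    and P': "unitriangular_orthogonal_basis I le m B P'"
    and i: "i \<in> I"
  shows "P i = P' i"
proof -
  let ?W = "series.span (m ` I)"
  define lt where "lt i j \<longleftrightarrow> i \<in> I \<and> j \<in> I \<and> le i j \<and> i \<noteq> j" for i j
  have lt: "{j \<in> I. le j k \<and> j \<noteq> k} = {j \<in> I. lt j k}" if "k \<in> I" for k
    using that by (auto simp: lt_def)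
  have tri: "triangular_family I lt m R (\<lambda>_. 1)" if "unitriangular_orthogonal_basis I le m B R" for R
  proof
    show "inj_on m I" "series.independent (m ` I)" by (fact inj_m indep_m)+
    show "\<not> lt i i" for i by (simp add: lt_def)
    show "lt i j \<Longrightarrow> lt j k \<Longrightarrow> lt i k" for i j k
      unfolding lt_def using trans antisym by metis
    show "finite {j \<in> I. lt j i}" if "i \<in> I" for i
      by (rule finite_subset[OF _ fin[OF that]]) (auto simp: lt_def)
    show "R i - scale_series 1 (m i) \<in> series.span (m ` {j \<in> I. lt j i})" if "i \<in> I" for i
      using \<open>unitriangular_orthogonal_basis I le m B R\<close> that
      by (simp add: unitriangular_orthogonal_basis_def lt)
  qed auto
  interpret P: triangular_family I lt m P "\<lambda>_. 1" by (rule tri[OF P])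
  interpret P': triangular_family I lt m P' "\<lambda>_. 1" by (rule tri[OF P'])
  have orthP: "B (P i) (P j) = 0" if "i \<in> I" "j \<in> I" "i \<noteq> j" for i j
    using P that by (simp add: unitriangular_orthogonal_basis_def)
  have orthP': "B (P' i) (P' j) = 0" if "i \<in> I" "j \<in> I" "i \<noteq> j" for i j
    using P' that by (simp add: unitriangular_orthogonal_basis_def)
  let ?D = "{j \<in> I. lt j i}"
  have closed: "j \<in> ?D" if "k \<in> ?D" "j \<in> I" "lt j k" for j k using that P.trans by blast
  have span: "series.span (P ` ?D) = series.span (m ` ?D)" "series.span (P' ` ?D) = series.span (m ` ?D)"
    using P.span_eq[of ?D] P'.span_eq[of ?D] closed by blast+
  have PW: "P j \<in> ?W" "P' j \<in> ?W" if "j \<in> I" for j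
    using that by (auto intro: P.P_in_span P'.P_in_span)
  have W: "series.span (R ` D) \<subseteq> ?W" if "D \<subseteq> I" "R \<in> {P, P'}" for R D
    using that PW by (intro series.span_minimal series.subspace_span) auto
  have z: "B 0 h = 0" for h using scale[of 0 0 h] by (simp add: series.span_zero)
  have diff: "B (f - g) h = B f h - B g h" if "f \<in> ?W" "g \<in> ?W" for f g h
  proof -
    have "f - g = f + scale_series (- 1) g" by simp
    then show ?thesis
      unfolding \<open>f - g = f + scale_series (- 1) g\<close>
      using add[of f "scale_series (- 1) g" h] scale[of g "- 1" h] that series.span_scale[of g _ "- 1"]
      by (simp del: series.scale_minus_left)
  qed
  have on_span: "B g h = 0" if g: "g \<in> series.span X" and X: "X \<subseteq> ?W" and 0: "\<And>x. x \<in> X \<Longrightarrow> B x h = 0" for X g h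
  proof -
    from g have "g \<in> ?W \<and> B g h = 0"
    proof (induction rule: series.span_induct_alt)
      case (step c x y)
      then show ?case using X 0 add[of "scale_series c x" y h] scale[of x c h]
        by (auto simp: series.span_add series.span_scale)
    qed (simp add: z series.span_zero)
    then show ?thesis ..
  qed
  have orth: "B (P i) g = 0" if g: "g \<in> series.span (P ` ?D)" for g
    unfolding commute[of "P i"] using g
    by (rule on_span) (use PW orthP i in \<open>auto simp: lt_def\<close>)
  have orth': "B (P' i) g = 0" if g: "g \<in> series.span (P' ` ?D)" for g
    unfolding commute[of "P' i"] using g
    by (rule on_span) (use PW orthP' i in \<open>auto simp: lt_def\<close>)
  have orth_imp_0: "g = 0" if g: "g \<in> series.span (P ` ?D)" and o: "\<And>j. j \<in> ?D \<Longrightarrow> B (P j) g = 0" for g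
  proof (rule nondeg)
    show gW: "g \<in> ?W" using g W[of ?D P] by auto
    have zero: "B (P j) g = 0" if j: "j \<in> I" for j
    proof (cases "j \<in> ?D")
      case False
      then show ?thesis unfolding commute[of "P j"] using j
        by (intro on_span[OF g]) (use PW orthP in auto)
    qed (use o in auto)
    fix h assume "h \<in> ?W"
    then have "h \<in> series.span (P ` I)" using P.span_eq[of I] by blast
    then show "B g h = 0" unfolding commute[of g] by (rule on_span) (use zero PW in auto)
  qed
  have "P i - P' i = (P i - scale_series 1 (m i)) - (P' i - scale_series 1 (m i))" by simp
  also have "\<dots> \<in> series.span (m ` ?D)"
    using P.triangular[OF i] P'.triangular[OF i] by (rule series.span_diff)
  finally have d: "P i - P' i \<in> series.span (m ` ?D)" .
  have "P i - P' i = 0"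
  proof (rule orth_imp_0)
    show "P i - P' i \<in> series.span (P ` ?D)" using d span by simp
    fix j assume j: "j \<in> ?D"
    then have "P j \<in> series.span (P ` ?D)" by (intro series.span_base) auto
    then have "B (P i) (P j) = 0" "B (P' i) (P j) = 0" using orth orth' span by auto
    then show "B (P j) (P i - P' i) = 0"
      using diff[OF PW(1)[OF i] PW(2)[OF i], of "P j"] commute by simp
  qed
  then show ?thesis by simp
qed

section \<open>Multi-partitions as multisets of labelled parts\<close>

text \<open>
  A multi-partition is determined by the multiset of its parts, each labelled with the position of
  its partition in the tuple. Products of power sums are multiplicative in this multiset, their norms
  depend on its multiplicities only, and no ordering of the parts has to be maintained when parts are
  added or removed.
\<close>

definition labelled_parts :: "nat \<Rightarrow> (nat \<times> nat) multiset set" where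
  "labelled_parts n = {A. set_mset A \<subseteq> {1..n} \<times> {1..}}"

definition parts_of :: "nat \<Rightarrow> (nat \<Rightarrow> nat list) \<Rightarrow> (nat \<times> nat) multiset" where
  "parts_of n L = (\<Sum>i\<in>{1..n}. image_mset (Pair i) (mset (L i)))"

definition weight :: "(nat \<times> nat) multiset \<Rightarrow> nat" where
  "weight A = \<Sum>\<^sub># (image_mset snd A)"

lemma weight_add [simp]: "weight (A + B) = weight A + weight B"
  and weight_add_mset [simp]: "weight (add_mset y A) = snd y + weight A"
  and weight_empty [simp]: "weight {#} = 0"
  by (simp_all add: weight_def)

lemma weight_sum: "weight (sum f K) = (\<Sum>k\<in>K. weight (f k))"
  by (induction K rule: infinite_finite_induct) auto

lemma weight_mono: "A \<subseteq># B \<Longrightarrow> weight A \<le> weight B"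
  by (metis le_add1 subset_mset.add_diff_inverse weight_add)

lemma weight_image_Pair [simp]: "weight (image_mset (Pair i) X) = \<Sum>\<^sub># X"
  by (simp add: weight_def image_mset.compositionality comp_def)

lemma count_parts_of:
  "count (parts_of n L) (i, r) = (if i \<in> {1..n} then count_list (L i) r else 0)"
proof -
  have c: "count (image_mset (Pair k) X) (i, r) = (if k = i then count X r else 0)" for k and X :: "nat multiset"
    by (induction X) auto
  show ?thesis
    unfolding parts_of_def by (simp add: count_sum c sum.delta' count_mset)
qed

lemma filter_parts_of_eq: "k \<in> {1..n} \<Longrightarrow> {#y \<in># parts_of n L. fst y = k#} = image_mset (Pair k) (mset (L k))"
proof (rule multiset_eqI, clarify)
  fix i r :: nat assume "k \<in> {1..n}"
  have c: "count (image_mset (Pair k) X) (i, r) = (if k = i then count X r else 0)" for X :: "nat multiset"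
    by (induction X) auto
  show "count {#y \<in># parts_of n L. fst y = k#} (i, r) = count (image_mset (Pair k) (mset (L k))) (i, r)"
    using \<open>k \<in> {1..n}\<close> by (simp add: c count_parts_of count_mset)
qed

lemma filter_parts_of_less:
  "k \<in> {1..n} \<Longrightarrow> {#y \<in># parts_of n L. fst y < k#} = (\<Sum>i\<in>{1..<k}. image_mset (Pair i) (mset (L i)))"
proof (rule multiset_eqI, clarify)
  fix i r :: nat assume "k \<in> {1..n}"
  have c: "count (image_mset (Pair k) X) (i, r) = (if k = i then count X r else 0)" for k and X :: "nat multiset"
    by (induction X) auto
  show "count {#y \<in># parts_of n L. fst y < k#} (i, r) = count (\<Sum>i\<in>{1..<k}. image_mset (Pair i) (mset (L i))) (i, r)"
    using \<open>k \<in> {1..n}\<close> by (simp add: c count_parts_of count_mset count_sum sum.delta')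
qed

lemma partition_eqI:
  assumes "is_partition l" "is_partition l'" "mset l = mset l'"
  shows "l = l'"
proof -
  have "sorted (rev l)" "sorted (rev l')"
    using assms by (auto simp: is_partition_def sorted_wrt_rev)
  then have "sort (rev l') = rev l" "sort (rev l') = rev l'"
    using assms(3) by (auto intro!: properties_for_sort)
  then show ?thesis by (metis rev_rev_ident)
qed

definition partition_of :: "nat multiset \<Rightarrow> nat list" where
  "partition_of X = rev (sorted_list_of_multiset X)"

lemma mset_partition_of [simp]: "mset (partition_of X) = X"
  by (simp add: partition_of_def)

lemma is_partition_partition_of: "0 \<notin># X \<Longrightarrow> is_partition (partition_of X)"
  by (auto simp: is_partition_def partition_of_def sorted_wrt_rev)

lemma parts_of_bij: "bij_betw (parts_of n) (multipartitions n) (labelled_parts n)"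
proof (rule bij_betwI')
  fix L L' assume L: "L \<in> multipartitions n" "L' \<in> multipartitions n"
  show "(parts_of n L = parts_of n L') = (L = L')"
  proof
    assume eq: "parts_of n L = parts_of n L'"
    show "L = L'"
    proof
      fix i
      show "L i = L' i"
      proof (cases "i \<in> {1..n}")
        case True
        have "image_mset snd (image_mset (Pair i) (mset (L i))) = image_mset snd (image_mset (Pair i) (mset (L' i)))"
          using filter_parts_of_eq[OF True] eq by metis
        then have "mset (L i) = mset (L' i)"
          by (simp add: image_mset.compositionality comp_def)
        then show ?thesis using L partition_eqI by (auto simp: multipartitions_def)
      qed (use L in \<open>auto simp: multipartitions_def\<close>)
    qed
  qed simp
next
  fix L assume L: "L \<in> multipartitions n"
  show "parts_of n L \<in> labelled_parts n"
  proof -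
    have "i \<in> {1..n} \<and> r \<ge> 1" if "(i, r) \<in># parts_of n L" for i r
    proof -
      have i: "i \<in> {1..n}" "count_list (L i) r \<noteq> 0"
        using that by (auto simp: count_greater_zero_iff[symmetric] count_parts_of simp del: count_greater_zero_iff split: if_splits)
      then have "r \<in> set (L i)" by (metis count_list_0_iff)
      moreover have "0 \<notin> set (L i)" using L by (auto simp: multipartitions_def is_partition_def)
      ultimately have "r \<noteq> 0" by metis
      with i show ?thesis by auto
    qed
    then show ?thesis unfolding labelled_parts_def by auto
  qed
next
  fix A assume A: "A \<in> labelled_parts n"
  define L where "L i = (if i \<in> {1..n} then partition_of (image_mset snd {#y \<in># A. fst y = i#}) else [])" for i
  have "L \<in> multipartitions n"
  proof -
    have "0 \<notin> snd ` set_mset A" using A by (auto simp: labelled_parts_def)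
    then have "is_partition (L i)" for i
      by (cases "i \<in> {1..n}")
        (auto simp: L_def is_partition_def[of "[]"] intro!: is_partition_partition_of)
    then show ?thesis by (simp add: multipartitions_def L_def)
  qed
  moreover have "A = parts_of n L"
  proof (rule multiset_eqI, clarify)
    fix i r
    have "count (image_mset snd {#y \<in># A. fst y = i#}) r = count A (i, r)"
      by (induction A) auto
    then show "count A (i, r) = count (parts_of n L) (i, r)"
      using A by (auto simp: count_parts_of L_def count_mset[symmetric] labelled_parts_def count_eq_zero_iff)
  qed
  ultimately show "\<exists>L\<in>multipartitions n. A = parts_of n L" by blast
qed

text \<open>
  This is the dominance order, expressed without sorting: the partial sum belonging to \<open>k\<close> and \<open>j\<close>
  is the largest weight of a choice of parts with labels at most \<open>k\<close> of which at most \<open>j\<close> have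
  label \<open>k\<close>. In this form a comparison of two multi-partitions can be read off from a matching of
  letters with parts.
\<close>

definition parts_le :: "nat \<Rightarrow> (nat \<times> nat) multiset \<Rightarrow> (nat \<times> nat) multiset \<Rightarrow> bool" where
  "parts_le n A A' \<longleftrightarrow> (\<forall>k\<in>{1..n}. \<forall>B. B \<subseteq># A \<longrightarrow> (\<forall>y\<in>#B. fst y \<le> k) \<longrightarrow>
     (\<exists>B'. B' \<subseteq># A' \<and> (\<forall>y\<in>#B'. fst y \<le> k) \<and>
        size {#y \<in># B'. fst y = k#} \<le> size {#y \<in># B. fst y = k#} \<and> weight B \<le> weight B'))"

lemma parts_leE:
  assumes "parts_le n A A'" "k \<in> {1..n}" "B \<subseteq># A" "\<forall>y\<in>#B. fst y \<le> k"
  obtains B' where "B' \<subseteq># A'" "\<forall>y\<in>#B'. fst y \<le> k"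
    "size {#y \<in># B'. fst y = k#} \<le> size {#y \<in># B. fst y = k#}" "weight B \<le> weight B'"
  using assms unfolding parts_le_def by blast

lemma parts_le_trans:
  assumes "parts_le n A A'" "parts_le n A' A''"
  shows "parts_le n A A''"
  unfolding parts_le_def
proof (intro ballI allI impI)
  fix k B assume B: "k \<in> {1..n}" "B \<subseteq># A" "\<forall>y\<in>#B. fst y \<le> k"
  from parts_leE[OF assms(1) B] obtain B' where B': "B' \<subseteq># A'" "\<forall>y\<in>#B'. fst y \<le> k"
    "size {#y \<in># B'. fst y = k#} \<le> size {#y \<in># B. fst y = k#}" "weight B \<le> weight B'" .
  from parts_leE[OF assms(2) B(1) B'(1,2)] obtain B'' where "B'' \<subseteq># A''" "\<forall>y\<in>#B''. fst y \<le> k"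
    "size {#y \<in># B''. fst y = k#} \<le> size {#y \<in># B'. fst y = k#}" "weight B' \<le> weight B''" .
  with B' show "\<exists>B''. B'' \<subseteq># A'' \<and> (\<forall>y\<in>#B''. fst y \<le> k) \<and>
      size {#y \<in># B''. fst y = k#} \<le> size {#y \<in># B. fst y = k#} \<and> weight B \<le> weight B''"
    by (intro exI[of _ B'']) auto
qed

lemma sum_submultiset_le_take:
  assumes "sorted_wrt (\<ge>) l" "X \<subseteq># mset l" "size X \<le> j"
  shows "\<Sum>\<^sub># X \<le> sum_list (take j (l :: nat list))"
  using assms
proof (induction l arbitrary: X j)
  case Nil then show ?case by simp
next
  case (Cons x l)
  show ?case
  proof (cases j)
    case 0 then show ?thesis using Cons.prems by simp
  next
    case (Suc j')
    show ?thesis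
    proof (cases "x \<in># X")
      case True
      then obtain Y where Y: "X = add_mset x Y" by (metis insert_DiffM)
      then show ?thesis using Cons Suc by auto
    next
      case False
      have sub: "X \<subseteq># mset l"
      proof (rule mset_subset_eqI)
        fix z show "count X z \<le> count (mset l) z"
          using mset_subset_eq_count[OF Cons.prems(2), of z] False
          by (cases "z = x") (auto simp: not_in_iff)
      qed
      show ?thesis
      proof (cases "X = {#}")
        case True then show ?thesis by simp
      next
        case False
        then obtain y Y where Y: "X = add_mset y Y" by (metis multiset_cases)
        then have "y \<in># mset l" using sub by (metis mset_subset_eqD union_single_eq_member)
        then have "y \<le> x" using Cons.prems by simp
        moreover have "Y \<subseteq># mset l" using sub Y by (metis mset_subset_eq_insertD subset_mset.less_imp_le)
        then have "\<Sum>\<^sub># Y \<le> sum_list (take j' l)" using Cons Y Suc by auto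
        ultimately show ?thesis using Y Suc by simp
      qed
    qed
  qed
qed

lemma weight_submultiset_le:
  assumes L: "L \<in> multipartitions n" and k: "k \<in> {1..n}" and B: "B \<subseteq># parts_of n L" "\<forall>y\<in>#B. fst y \<le> k"
    and j: "size {#y \<in># B. fst y = k#} \<le> j"
  shows "weight B \<le> (\<Sum>i\<in>{1..<k}. sum_list (L i)) + sum_list (take j (L k))"
proof -
  have "B = {#y \<in># B. fst y < k#} + {#y \<in># B. \<not> fst y < k#}"
    by (rule multiset_partition)
  also have "{#y \<in># B. \<not> fst y < k#} = {#y \<in># B. fst y = k#}"
    using B(2) by (intro filter_mset_cong) auto
  finally have split: "weight B = weight {#y \<in># B. fst y < k#} + weight {#y \<in># B. fst y = k#}"
    by (metis weight_add)
  have "weight {#y \<in># B. fst y < k#} \<le> weight {#y \<in># parts_of n L. fst y < k#}"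
    using B(1) by (intro weight_mono multiset_filter_mono)
  also have "\<dots> = (\<Sum>i\<in>{1..<k}. sum_list (L i))"
    using k by (simp add: filter_parts_of_less weight_sum sum_mset_sum_list)
  finally have 1: "weight {#y \<in># B. fst y < k#} \<le> (\<Sum>i\<in>{1..<k}. sum_list (L i))" .
  have "{#y \<in># B. fst y = k#} \<subseteq># image_mset (Pair k) (mset (L k))"
    using multiset_filter_mono[OF B(1), of "\<lambda>y. fst y = k"] filter_parts_of_eq[OF k] by simp
  then have "image_mset snd {#y \<in># B. fst y = k#} \<subseteq># image_mset snd (image_mset (Pair k) (mset (L k)))"
    by (rule image_mset_subseteq_mono)
  then have "image_mset snd {#y \<in># B. fst y = k#} \<subseteq># mset (L k)"
    by (simp add: image_mset.compositionality comp_def)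
  then have "weight {#y \<in># B. fst y = k#} \<le> sum_list (take j (L k))"
    unfolding weight_def using L j
    by (intro sum_submultiset_le_take) (auto simp: multipartitions_def is_partition_def)
  with 1 split show ?thesis by simp
qed

text \<open>
  The bound of the previous lemma is attained by all parts with smaller label and the \<open>j\<close> largest parts with label \<open>k\<close>.
\<close>

lemma ex_submultiset_weight_eq:
  assumes k: "k \<in> {1..n}"
  shows "\<exists>B. B \<subseteq># parts_of n L \<and> (\<forall>y\<in>#B. fst y \<le> k) \<and> size {#y \<in># B. fst y = k#} \<le> j \<and>
     weight B = (\<Sum>i\<in>{1..<k}. sum_list (L i)) + sum_list (take j (L k))"
proof -
  let ?B1 = "{#y \<in># parts_of n L. fst y < k#}" and ?B2 = "image_mset (Pair k) (mset (take j (L k)))"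
  have "mset (take j (L k)) \<subseteq># mset (L k)"
    by (metis append_take_drop_id mset_append mset_subset_eq_add_left)
  then have "?B2 \<subseteq># {#y \<in># parts_of n L. fst y = k#}"
    unfolding filter_parts_of_eq[OF k] by (rule image_mset_subseteq_mono)
  also have "\<dots> \<subseteq># {#y \<in># parts_of n L. \<not> fst y < k#}"
    by (rule mset_subset_eqI) auto
  finally have "?B1 + ?B2 \<subseteq># ?B1 + {#y \<in># parts_of n L. \<not> fst y < k#}"
    by (rule subset_mset.add_left_mono)
  then have "?B1 + ?B2 \<subseteq># parts_of n L" unfolding multiset_partition[symmetric] .
  moreover have "\<forall>y\<in>#?B1 + ?B2. fst y \<le> k" by auto
  moreover have "{#y \<in># ?B1. fst y = k#} = {#}" by (auto simp: filter_mset_eq_conv)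
  then have "size {#y \<in># ?B1 + ?B2. fst y = k#} \<le> j"
  proof -
    have "size {#y \<in># ?B2. fst y = k#} \<le> size ?B2" by (rule size_filter_mset_lesseq)
    also have "\<dots> \<le> j" by simp
    finally show ?thesis
      unfolding filter_union_mset \<open>{#y \<in># ?B1. fst y = k#} = {#}\<close> by simp
  qed
  moreover have "weight (?B1 + ?B2) = (\<Sum>i\<in>{1..<k}. sum_list (L i)) + sum_list (take j (L k))"
    using k by (simp add: filter_parts_of_less weight_sum sum_mset_sum_list)
  ultimately show ?thesis by blast
qed

lemma parts_le_iff_multi_dominance:
  assumes L: "L \<in> multipartitions n" "L' \<in> multipartitions n"
  shows "parts_le n (parts_of n L) (parts_of n L') \<longleftrightarrow> multi_dominance n L L'"
proof
  assume le: "parts_le n (parts_of n L) (parts_of n L')"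
  show "multi_dominance n L L'"
    unfolding multi_dominance_def
  proof (intro ballI allI)
    fix k j assume k: "k \<in> {1..n}"
    obtain B where B: "B \<subseteq># parts_of n L" "\<forall>y\<in>#B. fst y \<le> k" "size {#y \<in># B. fst y = k#} \<le> j"
      "weight B = (\<Sum>i\<in>{1..<k}. sum_list (L i)) + sum_list (take j (L k))"
      using ex_submultiset_weight_eq[OF k] by blast
    obtain B' where B': "B' \<subseteq># parts_of n L'" "\<forall>y\<in>#B'. fst y \<le> k"
        "size {#y \<in># B'. fst y = k#} \<le> size {#y \<in># B. fst y = k#}" "weight B \<le> weight B'"
      by (rule parts_leE[OF le k B(1,2)])
    have "weight B' \<le> (\<Sum>i\<in>{1..<k}. sum_list (L' i)) + sum_list (take j (L' k))"
      using B B' by (intro weight_submultiset_le[OF L(2) k]) auto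
    with B B' show "(\<Sum>i\<in>{1..<k}. sum_list (L i)) + sum_list (take j (L k)) \<le>
        (\<Sum>i\<in>{1..<k}. sum_list (L' i)) + sum_list (take j (L' k))" by simp
  qed
next
  assume dom: "multi_dominance n L L'"
  show "parts_le n (parts_of n L) (parts_of n L')"
    unfolding parts_le_def
  proof (intro ballI allI impI)
    fix k B assume k: "k \<in> {1..n}" and B: "B \<subseteq># parts_of n L" "\<forall>y\<in>#B. fst y \<le> k"
    let ?j = "size {#y \<in># B. fst y = k#}"
    obtain B' where B': "B' \<subseteq># parts_of n L'" "\<forall>y\<in>#B'. fst y \<le> k" "size {#y \<in># B'. fst y = k#} \<le> ?j"
      "weight B' = (\<Sum>i\<in>{1..<k}. sum_list (L' i)) + sum_list (take ?j (L' k))"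
      using ex_submultiset_weight_eq[OF k] by blast
    have "weight B \<le> (\<Sum>i\<in>{1..<k}. sum_list (L i)) + sum_list (take ?j (L k))"
      by (rule weight_submultiset_le[OF L(1) k B order_refl])
    also have "\<dots> \<le> weight B'" using dom k B' by (simp add: multi_dominance_def)
    finally show "\<exists>B'. B' \<subseteq># parts_of n L' \<and> (\<forall>y\<in>#B'. fst y \<le> k) \<and>
          size {#y \<in># B'. fst y = k#} \<le> size {#y \<in># B. fst y = k#} \<and> weight B \<le> weight B'"
      using B' by blast
  qed
qed

text \<open>
  A list ends where its partial sums become constant, because all its entries are positive.
\<close>

lemma list_eqI_partial_sums:
  assumes "\<And>j. sum_list (take j l) = sum_list (take j l')" "0 \<notin> set l" "0 \<notin> set l'"
  shows "l = (l' :: nat list)"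
  using assms
proof (induction l arbitrary: l')
  case Nil
  then show ?case using Nil(1)[of 1] by (cases l') auto
next
  case (Cons x l)
  obtain y k where l': "l' = y # k"
    using Cons.prems(1)[of 1] Cons.prems(2) by (cases l') auto
  have "x = y" using Cons.prems(1)[of 1] l' by simp
  moreover have "l = k"
  proof (rule Cons.IH)
    show "sum_list (take j l) = sum_list (take j k)" for j
      using Cons.prems(1)[of "Suc j"] l' \<open>x = y\<close> by simp
  qed (use Cons.prems l' in auto)
  ultimately show ?case using l' by simp
qed

lemma multi_dominance_antisym:
  assumes L: "L \<in> multipartitions n" "L' \<in> multipartitions n"
    and dom: "multi_dominance n L L'" "multi_dominance n L' L"
  shows "L = L'"
proof
  fix k
  show "L k = L' k"
  proof (cases "k \<in> {1..n}")
    case True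
    have eq: "(\<Sum>i\<in>{1..<k}. sum_list (L i)) + sum_list (take j (L k)) =
        (\<Sum>i\<in>{1..<k}. sum_list (L' i)) + sum_list (take j (L' k))" for j
      using dom True unfolding multi_dominance_def by (meson order_antisym)
    have "(\<Sum>i\<in>{1..<k}. sum_list (L i)) = (\<Sum>i\<in>{1..<k}. sum_list (L' i))"
      using eq[of 0] by simp
    then have "sum_list (take j (L k)) = sum_list (take j (L' k))" for j using eq[of j] by simp
    then show ?thesis
      using L by (intro list_eqI_partial_sums) (auto simp: multipartitions_def is_partition_def)
  qed (use L in \<open>auto simp: multipartitions_def\<close>)
qed

lemma parts_le_antisym:
  assumes "A \<in> labelled_parts n" "B \<in> labelled_parts n" "parts_le n A B" "parts_le n B A"
  shows "A = B"
proof -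
  obtain L L' where L: "L \<in> multipartitions n" "L' \<in> multipartitions n" "A = parts_of n L" "B = parts_of n L'"
    using assms(1,2) parts_of_bij[of n] unfolding bij_betw_def by blast
  then have "L = L'"
    using assms by (intro multi_dominance_antisym[of L n L']) (auto simp: parts_le_iff_multi_dominance)
  then show ?thesis using L by simp
qed

lemma finite_weight_le: "finite {A \<in> labelled_parts n. weight A \<le> d}"
proof (rule finite_subset)
  have "size A \<le> weight A \<and> (\<forall>y\<in>#A. snd y \<le> weight A)" if "A \<in> labelled_parts n" for A
    using that
  proof (induction A)
    case (add y A)
    then have "1 \<le> snd y" "A \<in> labelled_parts n" by (auto simp: labelled_parts_def)
    with add.IH show ?case by (auto simp: trans_le_add2)
  qed simp
  then show "{A \<in> labelled_parts n. weight A \<le> d} \<subseteq> mset ` {xs. set xs \<subseteq> {1..n} \<times> {..d} \<and> length xs \<le> d}"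
  proof (intro subsetI)
    fix A assume *: "A \<in> {A \<in> labelled_parts n. weight A \<le> d}"
      and **: "\<And>A. A \<in> labelled_parts n \<Longrightarrow> size A \<le> weight A \<and> (\<forall>y\<in>#A. snd y \<le> weight A)"
    obtain xs where xs: "A = mset xs" by (metis ex_mset)
    have "set xs \<subseteq> {1..n} \<times> {..d}" "length xs \<le> d"
      using * **[of A] xs by (force simp: labelled_parts_def)+
    then show "A \<in> mset ` {xs. set xs \<subseteq> {1..n} \<times> {..d} \<and> length xs \<le> d}" using xs by blast
  qed
  show "finite (mset ` {xs. set xs \<subseteq> {1..n} \<times> {..d} \<and> length xs \<le> d})"
    by (intro finite_imageI finite_lists_length_le) auto
qed

section \<open>Monomials and products of power sums\<close>

lemma coeff_times: "coeff_series (f * g) M = (\<Sum>A | A \<subseteq># M. coeff_series f A * coeff_series g (M - A))"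
  by (rule times_series.rep_eq[THEN fun_cong])

lemma coeff_add [simp]: "coeff_series (f + g) M = coeff_series f M + coeff_series g M"
  by (simp add: plus_series.rep_eq)

lemma coeff_diff [simp]: "coeff_series (f - g) M = coeff_series f M - coeff_series g M"
  by (simp add: minus_series.rep_eq)

lemma coeff_zero [simp]: "coeff_series 0 M = 0"
  by (simp add: zero_series.rep_eq)

lemma coeff_one: "coeff_series 1 M = (if M = {#} then 1 else 0)"
  by (simp add: one_series.rep_eq)

lemma coeff_scale [simp]: "coeff_series (scale_series c f) M = c * coeff_series f M"
  by (simp add: scale_series.rep_eq)

lemma coeff_sum [simp]: "coeff_series (sum f K) M = (\<Sum>k\<in>K. coeff_series (f k) M)"
  by (induction K rule: infinite_finite_induct) auto

lemma coeff_Series [simp]: "coeff_series (Series f) M = f M"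
  by (simp add: Series_inverse)

lemma scale_series_mult: "scale_series c f * g = scale_series c (f * g)"
  by (rule series_eqI) (simp add: coeff_times sum_distrib_left mult.assoc)

lemma mult_scale_series: "f * scale_series c g = scale_series c (f * g)"
  by (simp add: mult.commute[of f] scale_series_mult)

lemma coeff_times_nonzeroE:
  assumes "coeff_series (f * g) M \<noteq> 0"
  obtains A B where "M = A + B" "coeff_series f A \<noteq> 0" "coeff_series g B \<noteq> 0"
proof -
  obtain A where A: "A \<subseteq># M" "coeff_series f A * coeff_series g (M - A) \<noteq> 0"
    using assms unfolding coeff_times by (elim sum.not_neutral_contains_not_neutral) auto
  then show thesis
    by (intro that[of A "M - A"]) auto
qed

text \<open>
  A monomial of the product arises by taking \<open>r\<close> copies of one letter of \<open>V\<close> out of it.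
\<close>

lemma coeff_power_sum_times:
  assumes "r \<ge> 1"
  shows "coeff_series (power_sum V r * g) M =
    (\<Sum>x | x \<in> V \<and> r \<le> count M x. coeff_series g (M - replicate_mset r x))"
proof -
  let ?X = "{x. x \<in> V \<and> r \<le> count M x}"
  have inj: "inj_on (\<lambda>x. replicate_mset r x) ?X"
    using assms by (auto simp: inj_on_def multiset_eq_iff split: if_splits)
  have "coeff_series (power_sum V r * g) M =
      (\<Sum>A | A \<subseteq># M. (if \<exists>x\<in>V. A = replicate_mset r x then 1 else 0) * coeff_series g (M - A))"
    by (simp add: coeff_times power_sum_def)
  also have "\<dots> = (\<Sum>A\<in>(\<lambda>x. replicate_mset r x) ` ?X. (if \<exists>x\<in>V. A = replicate_mset r x then 1 else 0) * coeff_series g (M - A))"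
  proof (rule sum.mono_neutral_right)
    show "finite {A. A \<subseteq># M}" by (rule finite_submultisets)
    show "(\<lambda>x. replicate_mset r x) ` ?X \<subseteq> {A. A \<subseteq># M}"
      by (auto simp: count_le_replicate_mset_subset_eq)
    show "\<forall>A\<in>{A. A \<subseteq># M} - (\<lambda>x. replicate_mset r x) ` ?X.
        (if \<exists>x\<in>V. A = replicate_mset r x then 1 else 0) * coeff_series g (M - A) = 0"
    proof
      fix A assume A: "A \<in> {A. A \<subseteq># M} - (\<lambda>x. replicate_mset r x) ` ?X"
      have "\<not> (\<exists>x\<in>V. A = replicate_mset r x)"
      proof
        assume "\<exists>x\<in>V. A = replicate_mset r x"
        then obtain x where x: "x \<in> V" "A = replicate_mset r x" by blast
        then have "r \<le> count M x" using A by (simp add: count_le_replicate_mset_subset_eq)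
        then show False using A x by blast
      qed
      then show "(if \<exists>x\<in>V. A = replicate_mset r x then 1 else 0) * coeff_series g (M - A) = 0" by simp
    qed
  qed
  also have "\<dots> = (\<Sum>x\<in>?X. coeff_series g (M - replicate_mset r x))"
    unfolding sum.reindex[OF inj] by (intro sum.cong) auto
  finally show ?thesis .
qed

lemma finite_letters_count_ge: "r \<ge> 1 \<Longrightarrow> finite {x. x \<in> V \<and> r \<le> count M x}"
  by (rule finite_subset[OF _ finite_set_mset[of M]])
    (auto simp: count_greater_zero_iff[symmetric] simp del: count_greater_zero_iff)

text \<open>
  The exponents occurring in a monomial, labelled with the alphabets of their letters. For a
  multi-symmetric series the coefficient of a monomial depends only on this multiset.
\<close>

definition exponents :: "('v \<Rightarrow> nat) \<Rightarrow> 'v multiset \<Rightarrow> (nat \<times> nat) multiset" where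
  "exponents a M = image_mset (\<lambda>v. (a v, count M v)) (mset_set (set_mset M))"

lemma weight_exponents: "weight (exponents a M) = size M"
  by (simp add: weight_def exponents_def image_mset.compositionality comp_def size_multiset_overloaded_eq
      flip: sum_unfold_sum_mset)

lemma exponents_empty [simp]: "exponents a {#} = {#}"
  by (simp add: exponents_def)

lemma exponents_eq_empty_iff [simp]: "exponents a M = {#} \<longleftrightarrow> M = {#}"
  by (simp add: exponents_def mset_set_empty_iff)

lemma exponents_add_fresh:
  assumes "v \<notin># M" "r \<ge> 1"
  shows "exponents a (M + replicate_mset r v) = add_mset (a v, r) (exponents a M)"
proof -
  have "set_mset (M + replicate_mset r v) = insert v (set_mset M)" using assms by auto
  moreover have "count M v = 0" using assms by (simp add: not_in_iff)
  moreover have "image_mset (\<lambda>u. (a u, count (M + replicate_mset r v) u)) (mset_set (set_mset M)) =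
      image_mset (\<lambda>u. (a u, count M u)) (mset_set (set_mset M))"
    using assms by (intro image_mset_cong) auto
  ultimately show ?thesis using assms by (simp add: exponents_def)
qed

lemma count_image_mset_inj: "inj \<sigma> \<Longrightarrow> count (image_mset \<sigma> M) (\<sigma> v) = count M v"
  by (induction M) (auto dest: injD)

lemma exponents_image_bij:
  assumes "bij \<sigma>" "\<And>v. a (\<sigma> v) = a v"
  shows "exponents a (image_mset \<sigma> M) = exponents a M"
proof -
  have inj: "inj_on \<sigma> X" for X using assms(1) by (meson bij_is_inj inj_on_subset subset_UNIV)
  have "count (image_mset \<sigma> M) (\<sigma> v) = count M v" for v
    using assms(1) by (intro count_image_mset_inj) (auto dest: bij_is_inj)
  then show ?thesis
    unfolding exponents_def
    by (simp add: image_mset_mset_set[OF inj, symmetric] image_mset.compositionality comp_def assms(2))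
qed

text \<open>
  Two functions with the same multiset of values on a finite set differ by a permutation of the set;
  this is applied to the functions sending a letter to its alphabet and its exponent.
\<close>

lemma exponents_eq_imp_bij:
  assumes "exponents a M = exponents a M'"
  obtains \<sigma> where "bij \<sigma>" "\<And>v. a (\<sigma> v) = a v" "M' = image_mset \<sigma> M"
proof -
  let ?A = "set_mset M \<union> set_mset M'"
  \<comment> \<open>Letters with exponent 0 are included, so that both monomials have exponents on the same set of letters.\<close>
  have split: "image_mset (\<lambda>v. (a v, count N v)) (mset_set ?A) + image_mset (\<lambda>i. (i, 0)) (image_mset fst (exponents a N)) =
      exponents a N + image_mset (\<lambda>i. (i, 0)) (image_mset a (mset_set ?A))" if N: "set_mset N \<subseteq> ?A" for N
  proof -
    have A: "mset_set ?A = mset_set (set_mset N) + mset_set (?A - set_mset N)"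
    proof -
      have "?A = set_mset N \<union> (?A - set_mset N)" using N by blast
      then have "mset_set ?A = mset_set (set_mset N \<union> (?A - set_mset N))" by (rule arg_cong)
      also have "\<dots> = mset_set (set_mset N) + mset_set (?A - set_mset N)"
        by (rule mset_set_Union) auto
      finally show ?thesis .
    qed
    have "image_mset (\<lambda>v. (a v, count N v)) (mset_set (?A - set_mset N)) =
        image_mset (\<lambda>v. (a v, 0)) (mset_set (?A - set_mset N))"
      by (intro image_mset_cong) (auto simp: not_in_iff)
    then show ?thesis
      unfolding A by (simp add: exponents_def image_mset.compositionality comp_def)
  qed
  have "image_mset (\<lambda>v. (a v, count M v)) (mset_set ?A) = image_mset (\<lambda>v. (a v, count M' v)) (mset_set ?A)"
    by (rule add_right_imp_eq[OF trans[OF split[OF Un_upper1, unfolded assms] split[OF Un_upper2, symmetric]]])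
  then obtain p where p: "p permutes ?A" "\<forall>v\<in>?A. (a v, count M v) = (a (p v), count M' (p v))"
    by (rule image_mset_eq_implies_permutes[rotated]) auto
  have pv: "a (p v) = a v \<and> count M' (p v) = count M v" for v
  proof (cases "v \<in> ?A")
    case False
    then have "p v = v" "v \<notin># M" "v \<notin># M'" using permutes_not_in[OF p(1)] by auto
    then show ?thesis by (simp add: not_in_iff)
  qed (use p(2) in auto)
  have bij: "bij p" using p(1) by (rule permutes_bij)
  moreover have "M' = image_mset p M"
  proof (rule multiset_eqI)
    fix w
    obtain v where "w = p v" using surjD[OF bij_is_surj[OF bij], of w] by blast
    then show "count M' w = count (image_mset p M) w"
      using pv bij by (simp add: count_image_mset_inj bij_is_inj)
  qed
  ultimately show thesis using pv that by blast
qed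

text \<open>The product of the monomial symmetric functions of the several alphabets.\<close>

definition monomial_series :: "('v \<Rightarrow> nat) \<Rightarrow> (nat \<times> nat) multiset \<Rightarrow> ('v, 'a::comm_ring_1) series" where
  "monomial_series a A = Series (\<lambda>M. if exponents a M = A then 1 else 0)"

text \<open>
  The power sum \<open>p_r(x^(1), ..., x^(i))\<close> for \<open>y = (i, r)\<close>, where \<open>a\<close> maps a letter to the number of its alphabet.
\<close>

definition cumulative_power_sum :: "('v \<Rightarrow> nat) \<Rightarrow> nat \<times> nat \<Rightarrow> ('v, 'a::comm_ring_1) series" where
  "cumulative_power_sum a y = power_sum {v. a v \<in> {1..fst y}} (snd y)"

definition power_product :: "('v \<Rightarrow> nat) \<Rightarrow> (nat \<times> nat) multiset \<Rightarrow> ('v, 'a::comm_ring_1) series" where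
  "power_product a A = (\<Prod>y\<in>#A. cumulative_power_sum a y)"

lemma power_product_empty [simp]: "power_product a {#} = 1"
  and power_product_add_mset [simp]: "power_product a (add_mset y A) = cumulative_power_sum a y * power_product a A"
  and power_product_add [simp]: "power_product a (A + B) = power_product a A * power_product a B"
  by (simp_all add: power_product_def)

lemma coeff_monomial_series: "coeff_series (monomial_series a A) M = (if exponents a M = A then 1 else 0)"
  by (simp add: monomial_series_def)

definition symmetric_series :: "('v \<Rightarrow> nat) \<Rightarrow> ('v, 'a::comm_ring_1) series \<Rightarrow> bool" where
  "symmetric_series a f \<longleftrightarrow> (\<forall>M M'. exponents a M = exponents a M' \<longrightarrow> coeff_series f M = coeff_series f M')"

lemma symmetric_seriesD: "symmetric_series a f \<Longrightarrow> exponents a M = exponents a M' \<Longrightarrow> coeff_series f M = coeff_series f M'"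
  unfolding symmetric_series_def by blast

lemma symmetric_series_scale_add:
  assumes "symmetric_series a f" "symmetric_series a g"
  shows "symmetric_series a (scale_series c f + g)"
  unfolding symmetric_series_def
proof (intro allI impI)
  fix M M' assume eq: "exponents a M = exponents a M'"
  show "coeff_series (scale_series c f + g) M = coeff_series (scale_series c f + g) M'"
    using symmetric_seriesD[OF assms(1) eq] symmetric_seriesD[OF assms(2) eq] by simp
qed

lemma symmetric_series_monomial_series: "symmetric_series a (monomial_series a A)"
  by (simp add: symmetric_series_def coeff_monomial_series)

lemma symmetric_series_power_sum_times:
  assumes g: "symmetric_series a g" and r: "r \<ge> 1"
  shows "symmetric_series a (power_sum {v. a v \<in> K} r * g)"
  unfolding symmetric_series_def
proof (intro allI impI)
  fix M M' assume "exponents a M = exponents a M'"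
  then obtain \<sigma> where \<sigma>: "bij \<sigma>" "\<And>v. a (\<sigma> v) = a v" "M' = image_mset \<sigma> M"
    by (rule exponents_eq_imp_bij) (rule that)
  have inj: "inj_on \<sigma> X" for X using \<sigma>(1) by (meson bij_is_inj inj_on_subset subset_UNIV)
  have c: "count (image_mset \<sigma> N) (\<sigma> v) = count N v" for v N
    using \<sigma>(1) by (intro count_image_mset_inj) (auto dest: bij_is_inj)
  have set: "{x. x \<in> {v. a v \<in> K} \<and> r \<le> count M' x} = \<sigma> ` {x. x \<in> {v. a v \<in> K} \<and> r \<le> count M x}"
  proof (intro set_eqI iffI)
    fix w assume w: "w \<in> {x. x \<in> {v. a v \<in> K} \<and> r \<le> count M' x}"
    obtain v where v: "w = \<sigma> v" using surjD[OF bij_is_surj[OF \<sigma>(1)], of w] by blast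
    then have "a v \<in> K" "r \<le> count M v" using w c[of M v] \<sigma>(2)[of v] \<sigma>(3) by simp_all
    then show "w \<in> \<sigma> ` {x. x \<in> {v. a v \<in> K} \<and> r \<le> count M x}"
      using v by (intro image_eqI[of _ _ v]) auto
  next
    fix w assume "w \<in> \<sigma> ` {x. x \<in> {v. a v \<in> K} \<and> r \<le> count M x}"
    then obtain v where v: "w = \<sigma> v" "v \<in> {x. x \<in> {v. a v \<in> K} \<and> r \<le> count M x}" by (rule imageE)
    show "w \<in> {x. x \<in> {v. a v \<in> K} \<and> r \<le> count M' x}"
      unfolding v(1) \<sigma>(3) mem_Collect_eq \<sigma>(2) c using v(2) by simp
  qed
  have "coeff_series g (image_mset \<sigma> M - replicate_mset r (\<sigma> x)) = coeff_series g (M - replicate_mset r x)"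
    if "r \<le> count M x" for x
  proof -
    have "image_mset \<sigma> (M - replicate_mset r x) = image_mset \<sigma> M - replicate_mset r (\<sigma> x)"
      using that by (subst image_mset_Diff) (simp_all add: count_le_replicate_mset_subset_eq)
    then have "exponents a (image_mset \<sigma> M - replicate_mset r (\<sigma> x)) = exponents a (image_mset \<sigma> (M - replicate_mset r x))"
      by (simp only:)
    also have "\<dots> = exponents a (M - replicate_mset r x)"
      by (rule exponents_image_bij[OF \<sigma>(1)]) (rule \<sigma>(2))
    finally show ?thesis by (rule symmetric_seriesD[OF g])
  qed
  then show "coeff_series (power_sum {v. a v \<in> K} r * g) M = coeff_series (power_sum {v. a v \<in> K} r * g) M'"
    unfolding coeff_power_sum_times[OF r] set sum.reindex[OF inj]
    unfolding \<sigma>(3) by (intro sum.cong) auto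
qed

lemma symmetric_series_power_product:
  assumes "A \<in> labelled_parts n"
  shows "symmetric_series a (power_product a A)"
  using assms
proof (induction A)
  case empty show ?case by (auto simp: symmetric_series_def coeff_one)
next
  case (add y A)
  then have "snd y \<ge> 1" "A \<in> labelled_parts n" by (auto simp: labelled_parts_def)
  with add.IH show ?case
    by (simp add: cumulative_power_sum_def symmetric_series_power_sum_times del: atLeastAtMost_iff)
qed

text \<open>
  A symmetric series with finitely many types of exponents is determined by one coefficient for each type.
\<close>

lemma in_span_monomial_series:
  assumes f: "symmetric_series a f" and fin: "finite T"
    and supp: "\<And>M. coeff_series f M \<noteq> 0 \<Longrightarrow> exponents a M \<in> T"
  shows "f \<in> series.span (monomial_series a ` T)"
proof -
  define u where "u A = coeff_series f (SOME M. exponents a M = A)" for A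
  have u: "u (exponents a M) = coeff_series f M" for M
  proof -
    have "exponents a (SOME M'. exponents a M' = exponents a M) = exponents a M"
      by (rule someI) (rule refl)
    then show ?thesis unfolding u_def by (rule symmetric_seriesD[OF f])
  qed
  have "f = (\<Sum>A\<in>T. scale_series (u A) (monomial_series a A))"
  proof (rule series_eqI)
    fix M
    have "coeff_series (\<Sum>A\<in>T. scale_series (u A) (monomial_series a A)) M =
      (\<Sum>A\<in>T. if exponents a M = A then u A else 0)"
      by (simp add: coeff_monomial_series if_distrib cong: if_cong)
    also have "\<dots> = (if exponents a M \<in> T then u (exponents a M) else 0)"
      using fin by (simp add: sum.delta')
    also have "\<dots> = coeff_series f M" using supp[of M] by (auto simp: u)
    finally show "coeff_series f M = coeff_series (\<Sum>A\<in>T. scale_series (u A) (monomial_series a A)) M" ..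
  qed
  moreover have "(\<Sum>A\<in>T. scale_series (u A) (monomial_series a A)) \<in> series.span (monomial_series a ` T)"
    by (intro series.span_sum series.span_scale series.span_base imageI)
  ultimately show ?thesis by (simp only:)
qed

lemma span_monomial_series_symmetric:
  assumes "f \<in> series.span (monomial_series a ` T)"
  shows "symmetric_series a f"
  using assms
proof (induction rule: series.span_induct_alt)
  case (step c x y)
  then show ?case using symmetric_series_scale_add symmetric_series_monomial_series by blast
qed (simp add: symmetric_series_def)

lemma span_monomial_series_support:
  assumes "f \<in> series.span (monomial_series a ` T)" "coeff_series f M \<noteq> 0"
  shows "exponents a M \<in> T"
proof -
  have "coeff_series f M = 0" if "exponents a M \<notin> T"
    using assms(1)
  proof (induction rule: series.span_induct_alt)
    case (step c x y)
    then show ?case using that by (auto simp: coeff_monomial_series split: if_splits)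
  qed simp
  with assms(2) show ?thesis by blast
qed

lemma coeff_power_product_nonneg: "A \<in> labelled_parts n \<Longrightarrow> coeff_series (power_product a A :: ('v, 'a::linordered_field) series) M \<ge> 0"
proof (induction A arbitrary: M)
  case (add y A)
  then have y: "snd y \<ge> 1" "A \<in> labelled_parts n" by (auto simp: labelled_parts_def)
  show ?case
    by (simp add: cumulative_power_sum_def coeff_power_sum_times[OF y(1)])
       (intro sum_nonneg add.IH[OF y(2)])
qed (simp add: coeff_one)

text \<open>
  The coefficient counts the assignments of letters to parts that produce the monomial. One such
  assignment gives the part \<open>(a v, count M v)\<close> to the letter \<open>v\<close>, and nothing cancels it, since the
  ground field is ordered.
\<close>

lemma coeff_power_product_pos:
  assumes "exponents a M \<in> labelled_parts n"
  shows "coeff_series (power_product a (exponents a M) :: ('v, 'a::linordered_field) series) M > 0"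
proof -
  have "0 < coeff_series (power_product a (image_mset (\<lambda>v. (a v, c v)) (mset_set U)) :: ('v, 'a) series)
      (\<Sum>v\<in>U. replicate_mset (c v) v)" if "finite U" "\<And>v. v \<in> U \<Longrightarrow> a v \<in> {1..n} \<and> c v \<ge> 1" for U c
    using that
  proof (induction U)
    case empty then show ?case by (simp add: coeff_one)
  next
    case (insert u U)
    let ?A = "image_mset (\<lambda>v. (a v, c v)) (mset_set U)" and ?M = "\<Sum>v\<in>U. replicate_mset (c v) v"
    let ?M' = "\<Sum>v\<in>insert u U. replicate_mset (c v) v"
    have A: "?A \<in> labelled_parts n" using insert by (auto simp: labelled_parts_def)
    have c: "c u \<ge> 1" using insert by auto
    have M': "?M' = replicate_mset (c u) u + ?M" using insert by simp
    let ?X = "{x. x \<in> {v. a v \<in> {1..a u}} \<and> c u \<le> count ?M' x}"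
    have u: "u \<in> ?X" using insert c unfolding M' by auto
    have "0 < coeff_series (power_product a ?A :: ('v, 'a) series) (?M' - replicate_mset (c u) u)"
      using insert by simp
    also have "\<dots> \<le> (\<Sum>x\<in>?X. coeff_series (power_product a ?A) (?M' - replicate_mset (c u) x))"
      using u
      by (intro member_le_sum coeff_power_product_nonneg[OF A] finite_letters_count_ge[OF c])
    finally show ?case using insert
      by (simp add: cumulative_power_sum_def coeff_power_sum_times[OF c] del: sum.insert)
  qed
  moreover have "(a v, count M v) \<in> {1..n} \<times> {1..}" if "v \<in># M" for v
    using assms that unfolding exponents_def labelled_parts_def
    by (auto simp del: mem_Sigma_iff)
  ultimately have "0 < coeff_series (power_product a (exponents a M) :: ('v, 'a) series) (\<Sum>v\<in>set_mset M. replicate_mset (count M v) v)"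
    unfolding exponents_def by (meson finite_set_mset mem_Sigma_iff atLeast_iff)
  moreover have "(\<Sum>v\<in>set_mset M. replicate_mset (count M v) v) = M"
    by (rule multiset_eqI) (simp add: count_sum sum.delta not_in_iff)
  ultimately show ?thesis by simp
qed

lemma power_product_support:
  fixes a :: "'v \<Rightarrow> nat"
  assumes "A \<in> labelled_parts n" "coeff_series (power_product a A :: ('v, 'a::comm_ring_1) series) M \<noteq> 0"
  shows "size M = weight A" "a ` set_mset M \<subseteq> {1..n}"
proof -
  have "size M = weight A \<and> a ` set_mset M \<subseteq> {1..n}" using assms
  proof (induction A arbitrary: M)
    case empty then show ?case by (auto simp: coeff_one split: if_splits)
  next
    case (add y A)
    then have y: "snd y \<ge> 1" "fst y \<le> n" "A \<in> labelled_parts n" by (auto simp: labelled_parts_def)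
    obtain B C where BC: "M = B + C" "coeff_series (cumulative_power_sum a y :: ('v, 'a) series) B \<noteq> 0"
      "coeff_series (power_product a A :: ('v, 'a) series) C \<noteq> 0"
      using add.prems(2) unfolding power_product_add_mset by (rule coeff_times_nonzeroE)
    then obtain x where x: "a x \<in> {1..fst y}" "B = replicate_mset (snd y) x"
      by (auto simp: cumulative_power_sum_def power_sum_def split: if_splits)
    show ?case using add.IH[OF y(3) BC(3)] BC(1) x y by auto
  qed
  then show "size M = weight A" "a ` set_mset M \<subseteq> {1..n}" by auto
qed

lemma exponents_in_labelled_parts: "a ` set_mset M \<subseteq> {1..n} \<Longrightarrow> exponents a M \<in> labelled_parts n"
  by (force simp: exponents_def labelled_parts_def)

text \<open>
  The parts chosen among those with label at most \<open>k\<close> are carried by letters of the alphabets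
  up to \<open>k\<close>, and a part needs a letter of the \<open>k\<close>-th alphabet only if its label is \<open>k\<close>.
\<close>

lemma power_product_support_letters:
  fixes a :: "'v \<Rightarrow> nat"
  assumes "A \<in> labelled_parts n" "coeff_series (power_product a A :: ('v, 'a::comm_ring_1) series) M \<noteq> 0"
    and "B \<subseteq># A" "\<forall>y\<in>#B. fst y \<le> k"
  shows "\<exists>T. finite T \<and> T \<subseteq> {v. a v = k} \<and> card T \<le> size {#y \<in># B. fst y = k#} \<and>
    weight B \<le> size {#v \<in># M. a v < k \<or> v \<in> T#}"
  using assms
proof (induction A arbitrary: M B)
  case empty then show ?case by (intro exI[of _ "{}"]) auto
next
  case (add y A)
  then have y: "snd y \<ge> 1" "A \<in> labelled_parts n" by (auto simp: labelled_parts_def)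
  obtain C M' where BC: "M = C + M'" "coeff_series (cumulative_power_sum a y :: ('v, 'a) series) C \<noteq> 0"
    "coeff_series (power_product a A :: ('v, 'a) series) M' \<noteq> 0"
    using add.prems(2) unfolding power_product_add_mset by (rule coeff_times_nonzeroE)
  then obtain x where x: "a x \<in> {1..fst y}" "C = replicate_mset (snd y) x"
    by (auto simp: cumulative_power_sum_def power_sum_def split: if_splits)
  show ?case
  proof (cases "B \<subseteq># A")
    case True
    then obtain T where T: "finite T" "T \<subseteq> {v. a v = k}" "card T \<le> size {#y \<in># B. fst y = k#}"
      "weight B \<le> size {#v \<in># M'. a v < k \<or> v \<in> T#}"
      using add.IH[OF y(2) BC(3) True add.prems(4)] by blast
    have "size {#v \<in># M'. a v < k \<or> v \<in> T#} \<le> size {#v \<in># M. a v < k \<or> v \<in> T#}"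
      using BC(1) by simp
    then show ?thesis using T by (intro exI[of _ T]) auto
  next
    case False
    then have yB: "y \<in># B" using add.prems(3)
      by (metis Diff_eq_empty_iff_mset add_mset_remove_trivial diff_single_trivial mset_subset_eq_add_right
          subset_eq_diff_conv add_mset_add_single)
    then obtain B' where B': "B = add_mset y B'" by (metis insert_DiffM)
    then have "B' \<subseteq># A" "\<forall>y\<in>#B'. fst y \<le> k" using add.prems by auto
    then obtain T where T: "finite T" "T \<subseteq> {v. a v = k}" "card T \<le> size {#y \<in># B'. fst y = k#}"
      "weight B' \<le> size {#v \<in># M'. a v < k \<or> v \<in> T#}"
      using add.IH[OF y(2) BC(3)] by blast
    have yk: "fst y \<le> k" using add.prems(4) B' by auto
    define T' where "T' = (if a x = k then insert x T else T)"
    have x': "a x < k \<or> x \<in> T'" using x yk by (auto simp: T'_def)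
    have card: "card T' \<le> size {#y \<in># B. fst y = k#}"
      using T(1,3) x yk card_insert_le_m1 by (auto simp: T'_def B' card_insert_if)
    have "size {#v \<in># M'. a v < k \<or> v \<in> T#} \<le> size {#v \<in># M'. a v < k \<or> v \<in> T'#}"
      by (intro size_mset_mono mset_subset_eqI) (auto simp: T'_def)
    moreover have "{#v \<in># C. a v < k \<or> v \<in> T'#} = C"
      unfolding x(2) using x' by (intro multiset_eqI) auto
    ultimately have "weight B \<le> size {#v \<in># M. a v < k \<or> v \<in> T'#}"
      using T(4) BC(1) x(2) by (simp add: B')
    moreover have "finite T'" "T' \<subseteq> {v. a v = k}" using T by (auto simp: T'_def)
    ultimately show ?thesis using card by blast
  qed
qed

lemma size_filter_eq_weight:
  "size {#v \<in># M. Q v#} = weight (image_mset (\<lambda>v. (a v, count M v)) (mset_set {v \<in> set_mset M. Q v}))"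
proof -
  have "set_mset {#v \<in># M. Q v#} = {v \<in> set_mset M. Q v}" by auto
  then show ?thesis
    by (simp add: weight_def image_mset.compositionality comp_def size_multiset_overloaded_eq
      flip: sum_unfold_sum_mset)
qed

text \<open>
  Letters of a monomial single out the parts that are their exponents.
\<close>

lemma submultiset_of_letters:
  assumes "finite T" "T \<subseteq> {v. a v = k}"
  shows "\<exists>B. B \<subseteq># exponents a M \<and> (\<forall>y\<in>#B. fst y \<le> k) \<and> size {#y \<in># B. fst y = k#} \<le> card T \<and>
    weight B = size {#v \<in># M. a v < k \<or> v \<in> T#}"
proof -
  let ?U = "{v \<in> set_mset M. a v < k \<or> v \<in> T}"
  let ?B = "image_mset (\<lambda>v. (a v, count M v)) (mset_set ?U)"
  have "?B \<subseteq># exponents a M"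
    unfolding exponents_def by (intro image_mset_subseteq_mono subset_imp_msubset_mset_set) auto
  moreover have "\<forall>y\<in>#?B. fst y \<le> k" using assms by auto
  moreover have "{v \<in> ?U. a v = k} \<subseteq> T" by auto
  then have "size {#y \<in># ?B. fst y = k#} \<le> card T"
    using assms by (simp add: filter_mset_image_mset card_mono)
  moreover have "weight ?B = size {#v \<in># M. a v < k \<or> v \<in> T#}"
    by (rule size_filter_eq_weight[symmetric])
  ultimately show ?thesis by blast
qed

text \<open>
  Conversely, parts of the exponent multiset are carried by distinct letters.
\<close>

lemma letters_of_submultiset:
  assumes "B \<subseteq># exponents a M" "\<forall>y\<in>#B. fst y \<le> k"
  shows "\<exists>T. finite T \<and> T \<subseteq> {v. a v = k} \<and> card T = size {#y \<in># B. fst y = k#} \<and>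
    weight B \<le> size {#v \<in># M. a v < k \<or> v \<in> T#}"
proof -
  from assms(1) have "image_mset (\<lambda>v. (a v, count M v)) (mset_set (set_mset M)) = B + (exponents a M - B)"
    by (simp add: exponents_def)
  then obtain U U' where U: "mset_set (set_mset M) = U + U'" "B = image_mset (\<lambda>v. (a v, count M v)) U"
    using image_mset_eq_plusD by blast
  have "U \<subseteq># mset_set (set_mset M)" using U(1) by simp
  then have set: "mset_set (set_mset U) = U" "set_mset U \<subseteq> set_mset M"
  proof -
    assume sub: "U \<subseteq># mset_set (set_mset M)"
    then show "set_mset U \<subseteq> set_mset M" using set_mset_mono by fastforce
    have "count U v \<le> 1" for v
      using mset_subset_eq_count[OF sub, of v] by (simp add: count_mset_set' split: if_splits)
    then show "mset_set (set_mset U) = U"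
      by (intro multiset_eqI) (metis One_nat_def count_eq_zero_iff count_greater_zero_iff count_mset_set(1,3) finite_set_mset le_antisym less_eq_Suc_le)
  qed
  let ?T = "{v \<in> set_mset U. a v = k}"
  have "card ?T = size {#v \<in># mset_set (set_mset U). a v = k#}"
    by simp
  also have "\<dots> = size {#y \<in># B. fst y = k#}"
    unfolding set(1) U(2) by (simp add: filter_mset_image_mset)
  finally have card: "card ?T = size {#y \<in># B. fst y = k#}" .
  have sub: "set_mset U \<subseteq> {v \<in> set_mset M. a v < k \<or> v \<in> ?T}"
    using assms(2) set(2) U(2) by (auto simp: order_less_le)
  have "weight B = weight (image_mset (\<lambda>v. (a v, count M v)) (mset_set (set_mset U)))"
    by (simp add: U(2) set(1))
  also have "\<dots> \<le> weight (image_mset (\<lambda>v. (a v, count M v)) (mset_set {v \<in> set_mset M. a v < k \<or> v \<in> ?T}))"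
    using sub by (intro weight_mono image_mset_subseteq_mono subset_imp_msubset_mset_set) auto
  also have "\<dots> = size {#v \<in># M. a v < k \<or> v \<in> ?T#}"
    by (rule size_filter_eq_weight[symmetric])
  finally show ?thesis using card by (intro exI[of _ ?T]) auto
qed

text \<open>
  Multiplying out a product of power sums merges parts and moves them to alphabets with smaller
  number, and both operations increase the partial sums.
\<close>

lemma parts_le_power_product:
  fixes a :: "'v \<Rightarrow> nat"
  assumes "A \<in> labelled_parts n" "coeff_series (power_product a A :: ('v, 'a::comm_ring_1) series) M \<noteq> 0"
  shows "parts_le n A (exponents a M)"
  unfolding parts_le_def
proof (intro ballI allI impI)
  fix k B assume B: "B \<subseteq># A" "\<forall>y\<in>#B. fst y \<le> k"
  obtain T where T: "finite T" "T \<subseteq> {v. a v = k}" "card T \<le> size {#y \<in># B. fst y = k#}"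
    "weight B \<le> size {#v \<in># M. a v < k \<or> v \<in> T#}"
    using power_product_support_letters[OF assms B] by blast
  obtain B' where B': "B' \<subseteq># exponents a M" "\<forall>y\<in>#B'. fst y \<le> k" "size {#y \<in># B'. fst y = k#} \<le> card T"
    "weight B' = size {#v \<in># M. a v < k \<or> v \<in> T#}"
    using submultiset_of_letters[OF T(1,2)] by blast
  show "\<exists>B'. B' \<subseteq># exponents a M \<and> (\<forall>y\<in>#B'. fst y \<le> k) \<and>
      size {#y \<in># B'. fst y = k#} \<le> size {#y \<in># B. fst y = k#} \<and> weight B \<le> weight B'"
    using B' T by (intro exI[of _ B']) auto
qed

lemma parts_leI_letters:
  assumes "\<And>k T. k \<in> {1..n} \<Longrightarrow> finite T \<Longrightarrow> T \<subseteq> {v. a v = k} \<Longrightarrow>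
    \<exists>B. B \<subseteq># A \<and> (\<forall>y\<in>#B. fst y \<le> k) \<and> size {#y \<in># B. fst y = k#} \<le> card T \<and>
      size {#v \<in># M. a v < k \<or> v \<in> T#} \<le> weight B"
  shows "parts_le n (exponents a M) A"
  unfolding parts_le_def
proof (intro ballI allI impI)
  fix k B assume k: "k \<in> {1..n}" and B: "B \<subseteq># exponents a M" "\<forall>y\<in>#B. fst y \<le> k"
  obtain T where T: "finite T" "T \<subseteq> {v. a v = k}" "card T = size {#y \<in># B. fst y = k#}"
    "weight B \<le> size {#v \<in># M. a v < k \<or> v \<in> T#}"
    using letters_of_submultiset[OF B] by blast
  obtain B' where "B' \<subseteq># A" "\<forall>y\<in>#B'. fst y \<le> k" "size {#y \<in># B'. fst y = k#} \<le> card T"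
      "size {#v \<in># M. a v < k \<or> v \<in> T#} \<le> weight B'"
    using assms[OF k T(1,2)] by blast
  then show "\<exists>B'. B' \<subseteq># A \<and> (\<forall>y\<in>#B'. fst y \<le> k) \<and>
      size {#y \<in># B'. fst y = k#} \<le> size {#y \<in># B. fst y = k#} \<and> weight B \<le> weight B'"
    using T by (intro exI[of _ B']) auto
qed

section \<open>Power sums form a basis\<close>

locale infinite_alphabets =
  fixes a :: "'v \<Rightarrow> nat" and n :: nat
  assumes infinite_alphabet: "i \<in> {1..n} \<Longrightarrow> infinite {v. a v = i}"
begin

lemma ex_exponents:
  assumes "A \<in> labelled_parts n"
  shows "\<exists>M. exponents a M = A"
  using assms
proof (induction A)
  case empty show ?case by (intro exI[of _ "{#}"]) simp
next
  case (add y A)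
  then obtain M where M: "exponents a M = A" by (auto simp: labelled_parts_def)
  have y: "fst y \<in> {1..n}" "snd y \<ge> 1" using add.prems by (auto simp: labelled_parts_def)
  obtain v where "a v = fst y" "v \<notin># M"
    using infinite_alphabet[OF y(1)] finite_set_mset[of M]
    by (metis (mono_tags, lifting) finite_subset mem_Collect_eq subsetI)
  then have "exponents a (M + replicate_mset (snd y) v) = add_mset y A"
    using exponents_add_fresh[of v M "snd y" a] y M by simp
  then show ?case by blast
qed

lemma monomial_series_independent:
  "inj_on (monomial_series a :: _ \<Rightarrow> ('v, 'a::field) series) (labelled_parts n)"
  "series.independent ((monomial_series a :: _ \<Rightarrow> ('v, 'a::field) series) ` labelled_parts n)"
proof -
  have *: "u A = 0" if "finite S" "S \<subseteq> labelled_parts n" "A \<in> S"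
      "(\<Sum>A\<in>S. scale_series (u A) (monomial_series a A :: ('v, 'a::field) series)) = 0" for S u A
  proof -
    have "\<exists>M. exponents a M = A" using ex_exponents that by blast
    then obtain M where M: "exponents a M = A" ..
    have "0 = coeff_series (\<Sum>A\<in>S. scale_series (u A) (monomial_series a A :: ('v, 'a::field) series)) M"
      using that by simp
    also have "\<dots> = (\<Sum>B\<in>S. if A = B then u B else 0)"
      by (simp add: coeff_monomial_series M if_distrib cong: if_cong)
    also have "\<dots> = u A" using that by simp
    finally show ?thesis ..
  qed
  show "inj_on (monomial_series a :: _ \<Rightarrow> ('v, 'a::field) series) (labelled_parts n)"
    by (rule independent_familyI) (rule *)
  show "series.independent ((monomial_series a :: _ \<Rightarrow> ('v, 'a::field) series) ` labelled_parts n)"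
    by (rule independent_familyI) (rule *)
qed

text \<open>
  Reversed dominance, restricted to multi-partitions of the same weight: among all multi-partitions
  infinitely many lie above a given one.
\<close>

definition parts_above :: "(nat \<times> nat) multiset \<Rightarrow> (nat \<times> nat) multiset \<Rightarrow> bool" where
  "parts_above B A \<longleftrightarrow> A \<in> labelled_parts n \<and> B \<in> labelled_parts n \<and> B \<noteq> A \<and> parts_le n A B \<and> weight B = weight A"

text \<open>
  In the order \<open>parts_above\<close> the product of power sums indexed by \<open>A\<close> is the monomial series of \<open>A\<close>,
  with a positive coefficient, plus terms below it.
\<close>

lemma triangular_power_product:
  "triangular_family (labelled_parts n) parts_above (monomial_series a)
     (power_product a :: _ \<Rightarrow> ('v, 'a::linordered_field) series)
     (\<lambda>A. coeff_series (power_product a A) (SOME M. exponents a M = A))"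
proof
  show "inj_on (monomial_series a :: _ \<Rightarrow> ('v, 'a) series) (labelled_parts n)"
    "series.independent ((monomial_series a :: _ \<Rightarrow> ('v, 'a) series) ` labelled_parts n)"
    by (rule monomial_series_independent)+
  show "\<not> parts_above A A" for A by (simp add: parts_above_def)
  show "parts_above A C" if "parts_above A B" "parts_above B C" for A B C
    using that parts_le_trans[of n C B A] parts_le_antisym[of B n C] by (auto simp: parts_above_def)
  show "finite {B \<in> labelled_parts n. parts_above B A}" for A
    by (rule finite_subset[OF _ finite_weight_le[of n "weight A"]]) (auto simp: parts_above_def)
next
  fix A :: "(nat \<times> nat) multiset" assume A: "A \<in> labelled_parts n"
  let ?M = "SOME M. exponents a M = A"
  let ?c = "coeff_series (power_product a A :: ('v, 'a) series) ?M"
  have M: "exponents a ?M = A" using ex_exponents[OF A] by (rule someI_ex)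
  show "?c \<noteq> 0"
    using coeff_power_product_pos[of a ?M n, where ?'a = 'a] A M by simp
  let ?f = "power_product a A - scale_series ?c (monomial_series a A) :: ('v, 'a) series"
  have sym: "symmetric_series a (power_product a A :: ('v, 'a) series)"
    by (rule symmetric_series_power_product[OF A])
  show "?f \<in> series.span (monomial_series a ` {B \<in> labelled_parts n. parts_above B A})"
  proof (rule in_span_monomial_series)
    show "symmetric_series a ?f"
      using symmetric_series_scale_add[OF symmetric_series_monomial_series sym, where c = "- ?c"] by simp
    show "finite {B \<in> labelled_parts n. parts_above B A}"
      by (rule finite_subset[OF _ finite_weight_le[of n "weight A"]]) (auto simp: parts_above_def)
    fix M assume ne: "coeff_series ?f M \<noteq> 0"
    have "exponents a M \<noteq> A"
    proof
      assume eq: "exponents a M = A"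
      then have "coeff_series (power_product a A :: ('v, 'a) series) M = ?c"
        using symmetric_seriesD[OF sym] M by simp
      with ne eq show False by (simp add: coeff_monomial_series)
    qed
    then have nz: "coeff_series (power_product a A :: ('v, 'a) series) M \<noteq> 0"
      using ne by (simp add: coeff_monomial_series)
    show "exponents a M \<in> {B \<in> labelled_parts n. parts_above B A}"
      using power_product_support[OF A nz] parts_le_power_product[OF A nz] \<open>exponents a M \<noteq> A\<close> A
        exponents_in_labelled_parts[of a M n]
      by (auto simp: parts_above_def weight_exponents)
  qed
qed

lemma power_product_independent:
  "inj_on (power_product a :: _ \<Rightarrow> ('v, 'a::linordered_field) series) (labelled_parts n)"
  "series.independent ((power_product a :: _ \<Rightarrow> ('v, 'a::linordered_field) series) ` labelled_parts n)"
  using triangular_family.independent[OF triangular_power_product] by blast+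

lemma span_power_product:
  assumes "D \<subseteq> labelled_parts n" "\<And>A B. A \<in> D \<Longrightarrow> B \<in> labelled_parts n \<Longrightarrow> weight B = weight A \<Longrightarrow> B \<in> D"
  shows "series.span ((power_product a :: _ \<Rightarrow> ('v, 'a::linordered_field) series) ` D) = series.span (monomial_series a ` D)"
  by (rule triangular_family.span_eq[OF triangular_power_product assms(1)])
    (use assms(2) in \<open>auto simp: parts_above_def\<close>)

end

section \<open>Monomial and power-sum functions indexed by tuples of partitions\<close>

definition parts_at :: "nat \<Rightarrow> (nat \<times> nat) multiset \<Rightarrow> nat multiset" where
  "parts_at i A = image_mset snd {#y \<in># A. fst y = i#}"

lemma count_parts_at: "count (parts_at i A) r = count A (i, r)"
  unfolding parts_at_def by (induction A) auto

lemma parts_at_eqI: "(\<And>i. parts_at i A = parts_at i B) \<Longrightarrow> A = B"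
  by (rule multiset_eqI) (metis count_parts_at surj_pair)

lemma parts_at_parts_of: "parts_at i (parts_of n L) = (if i \<in> {1..n} then mset (L i) else {#})"
  by (rule multiset_eqI) (auto simp: count_parts_at count_parts_of count_mset)

lemma parts_at_exponents:
  "parts_at i (exponents a M) = image_mset (count M) (mset_set {v \<in> set_mset M. a v = i})"
  by (simp add: parts_at_def exponents_def filter_mset_image_mset image_mset.compositionality comp_def)

text \<open>
  A monomial has a unique factorisation into monomials of the separate alphabets.
\<close>

lemma coeff_prod_alphabets:
  fixes f :: "nat \<Rightarrow> ('v, 'a::comm_ring_1) series"
  assumes "finite I" "\<And>i M. i \<in> I \<Longrightarrow> coeff_series (f i) M \<noteq> 0 \<Longrightarrow> a ` set_mset M \<subseteq> {i}"
  shows "coeff_series (\<Prod>i\<in>I. f i) M =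
    (if a ` set_mset M \<subseteq> I then \<Prod>i\<in>I. coeff_series (f i) {#v \<in># M. a v = i#} else 0)"
  using assms
proof (induction I arbitrary: M)
  case empty show ?case by (simp add: coeff_one)
next
  case (insert i I)
  let ?G = "\<Prod>j\<in>I. f j" and ?A = "{#v \<in># M. a v = i#}"
  have IH: "coeff_series ?G M =
    (if a ` set_mset M \<subseteq> I then \<Prod>i\<in>I. coeff_series (f i) {#v \<in># M. a v = i#} else 0)" for M
    using insert by auto
  have "coeff_series (f i * ?G) M = (\<Sum>A | A \<subseteq># M. coeff_series (f i) A * coeff_series ?G (M - A))"
    by (rule coeff_times)
  also have "\<dots> = (\<Sum>A\<in>{?A}. coeff_series (f i) A * coeff_series ?G (M - A))"
  proof (rule sum.mono_neutral_right)
    show "finite {A. A \<subseteq># M}" by (rule finite_submultisets)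
    show "{?A} \<subseteq> {A. A \<subseteq># M}" by simp
    show "\<forall>A\<in>{A. A \<subseteq># M} - {?A}. coeff_series (f i) A * coeff_series ?G (M - A) = 0"
    proof (intro ballI, rule ccontr)
      fix A assume A: "A \<in> {A. A \<subseteq># M} - {?A}" and ne: "coeff_series (f i) A * coeff_series ?G (M - A) \<noteq> 0"
      from ne have "coeff_series (f i) A \<noteq> 0" by auto
      then have 1: "a ` set_mset A \<subseteq> {i}" by (rule insert.prems[OF insertI1])
      from ne have "coeff_series ?G (M - A) \<noteq> 0" by auto
      then have 2: "a ` set_mset (M - A) \<subseteq> I" unfolding IH by (auto split: if_splits)
      have "{#v \<in># A. a v = i#} = A" using 1 by (intro multiset_eqI) (auto simp: not_in_iff image_subset_iff)
      moreover have "{#v \<in># M - A. a v = i#} = {#}"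
        unfolding filter_mset_eq_mempty_iff using 2 insert.hyps by auto
      moreover have "M = A + (M - A)" using A by simp
      ultimately have "?A = A" by (metis filter_union_mset add.right_neutral)
      with A show False by simp
    qed
  qed
  also have "\<dots> = coeff_series (f i) ?A * coeff_series ?G {#v \<in># M. a v \<noteq> i#}"
  proof -
    have "M - ?A = {#v \<in># M. a v \<noteq> i#}" by (rule multiset_eqI) auto
    then show ?thesis by simp
  qed
  also have "\<dots> = (if a ` set_mset M \<subseteq> insert i I then \<Prod>j\<in>insert i I. coeff_series (f j) {#v \<in># M. a v = j#} else 0)"
  proof -
    have "{#v \<in># {#v \<in># M. a v \<noteq> i#}. a v = j#} = {#v \<in># M. a v = j#}" if "j \<in> I" for j
      using that insert.hyps by (intro multiset_eqI) auto
    moreover have "a ` set_mset {#v \<in># M. a v \<noteq> i#} \<subseteq> I \<longleftrightarrow> a ` set_mset M \<subseteq> insert i I"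
      using insert.hyps by auto
    ultimately show ?thesis unfolding IH using insert.hyps by (auto intro!: prod.cong)
  qed
  finally show ?case using insert.hyps by simp
qed

lemma coeff_msym:
  "coeff_series (msym V l) M =
    (if set_mset M \<subseteq> V \<and> image_mset (count M) (mset_set (set_mset M)) = mset l then 1 else 0)"
  by (simp add: msym_def)

lemma prod_msym_eq_monomial_series:
  fixes a :: "'v \<Rightarrow> nat"
  shows "(\<Prod>i\<in>{1..n}. msym {v. a v = i} (L i)) = (monomial_series a (parts_of n L) :: ('v, 'a::comm_ring_1) series)"
proof (rule series_eqI)
  fix M
  have e: "image_mset (count {#v \<in># M. a v = i#}) (mset_set (set_mset {#v \<in># M. a v = i#})) = parts_at i (exponents a M)" for i
    unfolding parts_at_exponents set_mset_filter by (intro image_mset_cong) auto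
  have sub: "set_mset {#v \<in># M. a v = i#} \<subseteq> {v. a v = i}" for i by auto
  have "coeff_series (\<Prod>i\<in>{1..n}. msym {v. a v = i} (L i) :: ('v, 'a) series) M =
    (if a ` set_mset M \<subseteq> {1..n} then \<Prod>i\<in>{1..n}. coeff_series (msym {v. a v = i} (L i)) {#v \<in># M. a v = i#} else 0)"
    by (rule coeff_prod_alphabets) (auto simp: coeff_msym split: if_splits)
  also have "\<dots> = (if a ` set_mset M \<subseteq> {1..n} then \<Prod>i\<in>{1..n}. if parts_at i (exponents a M) = mset (L i) then 1 else 0 else 0)"
    by (simp only: coeff_msym e sub simp_thms)
  also have "\<dots> = (if exponents a M = parts_of n L then 1 else 0)"
  proof (cases "exponents a M = parts_of n L")
    case True
    have "a ` set_mset M = fst ` set_mset (exponents a M)" by (auto simp: exponents_def image_image)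
    then have "a ` set_mset M \<subseteq> {1..n}"
      unfolding True
      by (auto simp: count_greater_zero_iff[symmetric] count_parts_of simp del: count_greater_zero_iff split: if_splits)
    then show ?thesis using True by (simp add: parts_at_parts_of)
  next
    case False
    have "\<exists>i\<in>{1..n}. parts_at i (exponents a M) \<noteq> mset (L i)" if "a ` set_mset M \<subseteq> {1..n}"
    proof (rule ccontr)
      assume *: "\<not> (\<exists>i\<in>{1..n}. parts_at i (exponents a M) \<noteq> mset (L i))"
      have "exponents a M = parts_of n L"
      proof (rule parts_at_eqI)
        fix i
        have "{v \<in> set_mset M. a v = i} = {}" if "i \<notin> {1..n}"
          using that \<open>a ` set_mset M \<subseteq> {1..n}\<close> by auto
        then show "parts_at i (exponents a M) = parts_at i (parts_of n L)"
          using * by (cases "i \<in> {1..n}") (auto simp: parts_at_parts_of parts_at_exponents mset_set_empty_iff)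
      qed
      with False show False by simp
    qed
    then have zero: "(\<Prod>i\<in>{1..n}. if parts_at i (exponents a M) = mset (L i) then 1 else 0 :: 'a) = 0" if "a ` set_mset M \<subseteq> {1..n}"
      using that by (intro prod_zero) auto
    show ?thesis
      by (cases "a ` set_mset M \<subseteq> {1..n}") (simp_all only: zero False if_True if_False)
  qed
  finally show "coeff_series (\<Prod>i\<in>{1..n}. msym {v. a v = i} (L i) :: ('v, 'a) series) M = coeff_series (monomial_series a (parts_of n L)) M"
    by (simp add: coeff_monomial_series)
qed

lemma psym_eq_prod_mset: "psym V l = (\<Prod>r\<in>#mset l. power_sum V r)"
  unfolding psym_def by (simp flip: prod_mset_prod_list)

lemma power_product_sum: "power_product a (sum f K) = (\<Prod>k\<in>K. power_product a (f k))"
  by (induction K rule: infinite_finite_induct) auto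

lemma prod_psym_eq_power_product:
  "(\<Prod>i\<in>{1..n}. psym {v. a v \<in> {1..i}} (L i)) = power_product a (parts_of n L)"
  unfolding parts_of_def power_product_sum
  by (intro prod.cong refl) (simp add: psym_eq_prod_mset power_product_def
      image_mset.compositionality comp_def cumulative_power_sum_def)

lemma inj_on_reindex:
  assumes "bij_betw h I J" "inj_on b J" "\<And>i. b' i = b (h i)"
  shows "inj_on b' I"
proof -
  have "inj_on (b \<circ> h) I" using assms by (auto simp: bij_betw_def intro: comp_inj_on)
  then show "inj_on b' I" using assms(3) by (simp add: inj_on_def)
qed

lemma image_reindex:
  assumes "bij_betw h I J" "\<And>i. b' i = b (h i)"
  shows "b' ` I = b ` J"
  using bij_betw_imp_surj_on[OF assms(1)] assms(2) by (auto simp: image_image)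

section \<open>Several alphabets\<close>

interpretation pair_letters: infinite_alphabets "fst :: nat \<times> nat \<Rightarrow> nat" n for n
proof
  fix i :: nat
  have "{v :: nat \<times> nat. fst v = i} = Pair i ` UNIV" by auto
  then show "infinite {v :: nat \<times> nat. fst v = i}"
    by (simp add: range_inj_infinite inj_on_def)
qed

lemma alphabets_eq: "alphabets K = {v. fst v \<in> K}"
  by auto

lemma multi_msym_eq: "multi_msym n L = monomial_series fst (parts_of n L)"
  unfolding multi_msym_def alphabets_eq using prod_msym_eq_monomial_series[where n = n and a = fst and L = L] by simp

lemma multi_psym_eq: "multi_psym n L = power_product fst (parts_of n L)"
  unfolding multi_psym_def alphabets_eq by (rule prod_psym_eq_power_product)

lemma multi_msym_independent:
  "inj_on (multi_msym n) (multipartitions n)" "series.independent (multi_msym n ` multipartitions n)"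
  and multi_msym_image: "multi_msym n ` multipartitions n = monomial_series fst ` labelled_parts n"
proof -
  show "inj_on (multi_msym n) (multipartitions n)"
    by (rule inj_on_reindex[OF parts_of_bij pair_letters.monomial_series_independent(1) multi_msym_eq])
  show im: "multi_msym n ` multipartitions n = monomial_series fst ` labelled_parts n"
    by (rule image_reindex[OF parts_of_bij]) (rule multi_msym_eq)
  show "series.independent (multi_msym n ` multipartitions n)"
    unfolding im by (rule pair_letters.monomial_series_independent)
qed

lemma multi_psym_independent:
  "inj_on (multi_psym n) (multipartitions n)" "series.independent (multi_psym n ` multipartitions n)"
  and multi_psym_image: "multi_psym n ` multipartitions n = power_product fst ` labelled_parts n"
proof -
  show "inj_on (multi_psym n) (multipartitions n)"
    by (rule inj_on_reindex[OF parts_of_bij pair_letters.power_product_independent(1) multi_psym_eq])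
  show im: "multi_psym n ` multipartitions n = power_product fst ` labelled_parts n"
    by (rule image_reindex[OF parts_of_bij]) (rule multi_psym_eq)
  show "series.independent (multi_psym n ` multipartitions n)"
    unfolding im by (rule pair_letters.power_product_independent)
qed

lemma span_multi_psym: "series.span (multi_psym n ` multipartitions n) = series.span (multi_msym n ` multipartitions n)"
  unfolding multi_msym_image multi_psym_image by (rule pair_letters.span_power_product) auto

section \<open>One alphabet\<close>

text \<open>A set of letters is treated as the only alphabet of a system in which the other letters have label 0.\<close>

definition letter_label :: "'v set \<Rightarrow> 'v \<Rightarrow> nat" where
  "letter_label V v = (if v \<in> V then 1 else 0)"

lemma letter_label_alphabets: "infinite V \<Longrightarrow> infinite_alphabets (letter_label V) 1"
  by unfold_locales (auto simp: letter_label_def)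

definition single_parts :: "nat list \<Rightarrow> (nat \<times> nat) multiset" where
  "single_parts l = parts_of 1 (\<lambda>i. if i = 1 then l else [])"

lemma weight_parts_of: "weight (parts_of n L) = (\<Sum>i\<in>{1..n}. sum_list (L i))"
  by (simp add: parts_of_def weight_sum sum_mset_sum_list)

lemma weight_single_parts: "weight (single_parts l) = sum_list l"
  by (simp add: single_parts_def weight_parts_of)

lemma single_parts_bij: "bij_betw single_parts {l. is_partition l} (labelled_parts 1)"
proof -
  have "bij_betw (\<lambda>l i. if i = 1 then l else []) {l. is_partition l} (multipartitions 1)"
    by (rule bij_betwI[where g = "\<lambda>L. L 1"])
       (auto simp: multipartitions_def is_partition_def fun_eq_iff)
  from bij_betw_trans[OF this parts_of_bij] show ?thesis
    by (simp add: single_parts_def[abs_def] comp_def)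
qed

lemma msym_eq: "msym V l = monomial_series (letter_label V) (single_parts l)"
proof -
  have "{v. letter_label V v = 1} = V" by (auto simp: letter_label_def)
  then show ?thesis
    using prod_msym_eq_monomial_series[where n = 1 and a = "letter_label V" and L = "\<lambda>i. if i = 1 then l else []"]
    by (simp add: single_parts_def)
qed

lemma psym_eq: "psym V l = power_product (letter_label V) (single_parts l)"
proof -
  have "{v. letter_label V v \<in> {1..1}} = V" by (auto simp: letter_label_def)
  then show ?thesis
    using prod_psym_eq_power_product[where n = 1 and a = "letter_label V" and L = "\<lambda>i. if i = 1 then l else []"]
    by (simp add: single_parts_def)
qed

lemma psym_independent:
  assumes "infinite (V :: 'v set)"
  shows "inj_on (psym V :: _ \<Rightarrow> ('v, 'a::linordered_field) series) {l. is_partition l}"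
    "series.independent ((psym V :: _ \<Rightarrow> ('v, 'a) series) ` {l. is_partition l})"
proof -
  interpret infinite_alphabets "letter_label V" 1 by (rule letter_label_alphabets[OF assms])
  show "inj_on (psym V :: _ \<Rightarrow> ('v, 'a::linordered_field) series) {l. is_partition l}"
    by (rule inj_on_reindex[OF single_parts_bij power_product_independent(1) psym_eq])
  have im: "(psym V :: _ \<Rightarrow> ('v, 'a) series) ` {l. is_partition l} = power_product (letter_label V) ` labelled_parts 1"
    by (rule image_reindex[OF single_parts_bij]) (rule psym_eq)
  show "series.independent ((psym V :: _ \<Rightarrow> ('v, 'a) series) ` {l. is_partition l})"
    unfolding im by (rule power_product_independent)
qed

lemma span_psym:
  assumes "infinite (V :: 'v set)" "D \<subseteq> {l. is_partition l}"
    "\<And>l l'. l \<in> D \<Longrightarrow> is_partition l' \<Longrightarrow> sum_list l' = sum_list l \<Longrightarrow> l' \<in> D"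
  shows "series.span ((psym V :: _ \<Rightarrow> ('v, 'a::linordered_field) series) ` D) = series.span (msym V ` D)"
proof -
  interpret infinite_alphabets "letter_label V" 1 by (rule letter_label_alphabets[OF assms(1)])
  have "(psym V :: _ \<Rightarrow> ('v, 'a) series) ` D = power_product (letter_label V) ` single_parts ` D"
    "(msym V :: _ \<Rightarrow> ('v, 'a) series) ` D = monomial_series (letter_label V) ` single_parts ` D"
    by (simp_all add: image_image psym_eq msym_eq)
  moreover have "series.span ((power_product (letter_label V) :: _ \<Rightarrow> ('v, 'a) series) ` single_parts ` D) =
      series.span (monomial_series (letter_label V) ` single_parts ` D)"
  proof (rule span_power_product)
    show "single_parts ` D \<subseteq> labelled_parts 1"
      using assms(2) bij_betw_imp_surj_on[OF single_parts_bij] by auto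
    fix A B assume "A \<in> single_parts ` D" "B \<in> labelled_parts 1" "weight B = weight A"
    moreover obtain l' where "B = single_parts l'" "is_partition l'"
      using \<open>B \<in> labelled_parts 1\<close> bij_betw_imp_surj_on[OF single_parts_bij] by auto
    ultimately show "B \<in> single_parts ` D" using assms(3) by (auto simp: weight_single_parts)
  qed
  ultimately show ?thesis by simp
qed

section \<open>Specialisation of power sums\<close>

abbreviation partitions :: "nat list set" where
  "partitions \<equiv> {l. is_partition l}"

text \<open>
  The image of a symmetric function under the ring homomorphism sending the \<open>r\<close>-th power sum to
  \<open>Z r\<close>; plethysm is the case where \<open>Z r\<close> is the \<open>r\<close>-th power sum of a virtual alphabet.
\<close>

definition specialize ::
  "'v set \<Rightarrow> (nat \<Rightarrow> ('w, 'a::field) series) \<Rightarrow> ('v, 'a) series \<Rightarrow> ('w, 'a) series" where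
  "specialize V Z = extend_linearly partitions (psym V) (\<lambda>l. \<Prod>r\<leftarrow>l. Z r)"

lemma prod_list_partition_of: "(\<Prod>r\<leftarrow>partition_of (mset l). f r) = (\<Prod>r\<leftarrow>l. f r :: 'a::comm_monoid_mult)"
  by (simp flip: prod_mset_prod_list)

lemma psym_partition_of: "psym V (partition_of (mset l)) = psym V l"
  unfolding psym_def by (rule prod_list_partition_of)

lemma psym_Cons: "psym V (r # l) = power_sum V r * psym V l"
  by (simp add: psym_def)

lemma psym_in_span: "0 \<notin> set l \<Longrightarrow> psym V l \<in> series.span (psym V ` partitions)"
  using is_partition_partition_of[of "mset l"]
  by (subst psym_partition_of[symmetric]) (auto intro!: series.span_base)

context
  fixes V :: "'v set"
  assumes inf: "infinite V"
begin

lemma specialize_add: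
  assumes "f \<in> series.span (psym V ` partitions)" "g \<in> series.span (psym V ` partitions)"
  shows "specialize V Z (f + g) = specialize V Z f + specialize V (Z :: nat \<Rightarrow> ('w, 'a::linordered_field) series) g"
  unfolding specialize_def by (rule extend_linearly_add[OF psym_independent[OF inf] assms])

lemma specialize_scale:
  assumes "f \<in> series.span (psym V ` partitions)"
  shows "specialize V Z (scale_series c f) = scale_series c (specialize V (Z :: nat \<Rightarrow> ('w, 'a::linordered_field) series) f)"
  unfolding specialize_def by (rule extend_linearly_scale[OF psym_independent[OF inf] assms])

lemma specialize_zero: "specialize V (Z :: nat \<Rightarrow> ('w, 'a::linordered_field) series) 0 = 0"
  unfolding specialize_def by (rule extend_linearly_zero[OF psym_independent[OF inf]])

lemma specialize_sum:
  assumes "\<And>k. k \<in> K \<Longrightarrow> f k \<in> series.span (psym V ` partitions)"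
  shows "specialize V Z (sum f K) = (\<Sum>k\<in>K. specialize V (Z :: nat \<Rightarrow> ('w, 'a::linordered_field) series) (f k))"
  unfolding specialize_def by (rule extend_linearly_sum[OF psym_independent[OF inf] assms])

lemma specialize_psym:
  assumes "0 \<notin> set l"
  shows "specialize V Z (psym V l) = (\<Prod>r\<leftarrow>l. (Z :: nat \<Rightarrow> ('w, 'a::linordered_field) series) r)"
proof -
  have "specialize V Z (psym V (partition_of (mset l))) = (\<Prod>r\<leftarrow>partition_of (mset l). Z r)"
    unfolding specialize_def using assms is_partition_partition_of[of "mset l"]
    by (intro extend_linearly_basis[OF psym_independent[OF inf]]) auto
  then show ?thesis by (simp only: psym_partition_of prod_list_partition_of)
qed

lemma power_sum_times_in_span:
  assumes "f \<in> series.span ((psym V :: _ \<Rightarrow> ('v, 'a::linordered_field) series) ` partitions)" "r \<ge> 1"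
  shows "power_sum V r * f \<in> series.span (psym V ` partitions)"
  using assms(1)
proof (induction rule: series.span_induct_alt)
  case (step c x y)
  then obtain l where l: "is_partition l" "x = psym V l" by auto
  have "power_sum V r * x \<in> series.span (psym V ` partitions)"
    unfolding l(2) psym_Cons[symmetric] using l(1) assms(2)
    by (intro psym_in_span) (auto simp: is_partition_def)
  with step show ?case
    by (simp add: distrib_left mult_scale_series series.span_add series.span_scale)
qed (simp add: series.span_zero)

text \<open>
  Both sides are linear in \<open>f\<close>, which may therefore be taken as a product of power sums.
\<close>

lemma specialize_power_sum_times:
  assumes "f \<in> series.span (psym V ` partitions)" "r \<ge> 1"
  shows "specialize V Z (power_sum V r * f) = Z r * specialize V (Z :: nat \<Rightarrow> ('w, 'a::linordered_field) series) f"
proof -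
  have "f \<in> series.span (psym V ` partitions) \<and> specialize V Z (power_sum V r * f) = Z r * specialize V Z f"
    using assms(1)
  proof (induction rule: series.span_induct_alt)
    case base then show ?case by (simp add: series.span_zero specialize_zero)
  next
    case (step c x y)
    then obtain l where l: "is_partition l" "x = psym V l" by auto
    have 0: "0 \<notin> set l" using l by (simp add: is_partition_def)
    have x: "x \<in> series.span (psym V ` partitions)" unfolding l(2) by (rule psym_in_span[OF 0])
    have e: "power_sum V r * (scale_series c x + y) = scale_series c (power_sum V r * x) + power_sum V r * y"
      by (simp add: distrib_left mult_scale_series)
    have "specialize V Z (power_sum V r * x) = Z r * specialize V Z x"
      unfolding l(2) psym_Cons[symmetric] using 0 assms(2) by (simp add: specialize_psym)
    then show ?case
      unfolding e using step x assms(2)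
      by (simp add: specialize_add specialize_scale power_sum_times_in_span series.span_add series.span_scale
          distrib_left mult_scale_series)
  qed
  then show ?thesis ..
qed

end

section \<open>Slices\<close>

text \<open>The coefficient of the monomial \<open>N\<close> in the letters \<open>T\<close>, as a series in the other letters.\<close>

definition slice :: "'v set \<Rightarrow> 'v multiset \<Rightarrow> ('v, 'a::comm_ring_1) series \<Rightarrow> ('v, 'a) series" where
  "slice T N f = Series (\<lambda>M. if set_mset M \<inter> T = {} then coeff_series f (N + M) else 0)"

lemma coeff_slice: "coeff_series (slice T N f) M = (if set_mset M \<inter> T = {} then coeff_series f (N + M) else 0)"
  by (simp add: slice_def)

lemma slice_linear:
  "slice T N (f + g) = slice T N f + slice T N g"
  "slice T N (scale_series c f) = scale_series c (slice T N f)"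
  "slice T N 0 = 0"
  by (rule series_eqI; simp add: coeff_slice)+

lemma slice_one: "set_mset N \<subseteq> T \<Longrightarrow> slice T N 1 = (if N = {#} then 1 else 0)"
  by (rule series_eqI) (auto simp: coeff_slice coeff_one)

text \<open>
  The letter whose power is taken from the monomial either lies outside \<open>T\<close>, or belongs to \<open>T\<close> and
  then reduces \<open>N\<close>.
\<close>

lemma slice_power_sum_times:
  assumes r: "r \<ge> 1" and N: "set_mset N \<subseteq> T" and T: "T \<subseteq> V"
  shows "slice T N (power_sum V r * f) = power_sum (V - T) r * slice T N f +
    (\<Sum>x | x \<in> T \<and> r \<le> count N x. slice T (N - replicate_mset r x) f)"
proof (rule series_eqI)
  fix M
  let ?X = "{x. x \<in> T \<and> r \<le> count N x}" and ?Y = "{x. x \<in> V - T \<and> r \<le> count M x}"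
  show "coeff_series (slice T N (power_sum V r * f)) M = coeff_series (power_sum (V - T) r * slice T N f +
    (\<Sum>x\<in>?X. slice T (N - replicate_mset r x) f)) M"
  proof (cases "set_mset M \<inter> T = {}")
    case False
    have "coeff_series (slice T N f) (M - replicate_mset r x) = 0" if "x \<in> ?Y" for x
    proof -
      obtain y where y: "y \<in># M" "y \<in> T" using False by auto
      then have "y \<noteq> x" using that by auto
      then have "count (M - replicate_mset r x) y = count M y" by simp
      then have "y \<in># M - replicate_mset r x" using y by (simp flip: count_greater_zero_iff)
      then show ?thesis using y by (auto simp: coeff_slice)
    qed
    then show ?thesis using False by (simp add: coeff_power_sum_times[OF r]) (simp add: coeff_slice)
  next
    case True
    have MT: "count M x = 0" if "x \<in> T" for x using True that by (auto simp: not_in_iff[symmetric])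
    have NT: "count N x = 0" if "x \<notin> T" for x using N that by (auto simp: not_in_iff[symmetric])
    have "{x. x \<in> V \<and> r \<le> count (N + M) x} = ?X \<union> ?Y"
    proof (rule set_eqI)
      fix x
      show "x \<in> {x. x \<in> V \<and> r \<le> count (N + M) x} \<longleftrightarrow> x \<in> ?X \<union> ?Y"
        using T MT[of x] NT[of x] r by (cases "x \<in> T") auto
    qed
    then have "coeff_series (slice T N (power_sum V r * f)) M =
        (\<Sum>x\<in>?X \<union> ?Y. coeff_series f (N + M - replicate_mset r x))"
      using True by (simp add: coeff_slice coeff_power_sum_times[OF r])
    also have "\<dots> = (\<Sum>x\<in>?X. coeff_series f (N + M - replicate_mset r x)) +
        (\<Sum>x\<in>?Y. coeff_series f (N + M - replicate_mset r x))"
      using finite_letters_count_ge[OF r, of T N] finite_letters_count_ge[OF r, of "V - T" M]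
      by (intro sum.union_disjoint) auto
    also have "(\<Sum>x\<in>?X. coeff_series f (N + M - replicate_mset r x)) =
        (\<Sum>x\<in>?X. coeff_series (slice T (N - replicate_mset r x) f) M)"
    proof (rule sum.cong)
      fix x assume "x \<in> ?X"
      then have "N + M - replicate_mset r x = (N - replicate_mset r x) + M"
        by (simp add: count_le_replicate_mset_subset_eq)
      then show "coeff_series f (N + M - replicate_mset r x) = coeff_series (slice T (N - replicate_mset r x) f) M"
        using True by (simp add: coeff_slice)
    qed simp
    also have "(\<Sum>x\<in>?Y. coeff_series f (N + M - replicate_mset r x)) =
        (\<Sum>x\<in>?Y. coeff_series (slice T N f) (M - replicate_mset r x))"
    proof (rule sum.cong)
      fix x assume "x \<in> ?Y"
      then have "N + M - replicate_mset r x = N + (M - replicate_mset r x)"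
        by (simp add: count_le_replicate_mset_subset_eq)
      moreover have "set_mset (M - replicate_mset r x) \<inter> T = {}"
        using True by (auto dest: in_diffD)
      ultimately show "coeff_series f (N + M - replicate_mset r x) = coeff_series (slice T N f) (M - replicate_mset r x)"
        by (simp add: coeff_slice)
    qed simp
    finally show ?thesis by (simp add: coeff_power_sum_times[OF r])
  qed
qed

text \<open>
  Splitting the letters of \<open>T\<close> off the alphabet: the coefficient of a monomial \<open>N\<close> in these letters
  can be taken before the power sums of the remaining letters are specialised.
\<close>

lemma coeff_specialize_slice:
  fixes V T :: "'v set" and e :: "'v \<Rightarrow> 'w" and Z :: "nat \<Rightarrow> ('w, 'a::linordered_field) series"
  assumes inf: "infinite V" and fin: "finite T" and T: "T \<subseteq> V" and e: "inj e"
    and Z: "\<And>r M. r \<ge> 1 \<Longrightarrow> coeff_series (Z r) M \<noteq> 0 \<Longrightarrow> set_mset M \<inter> e ` T = {}"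
    and f: "f \<in> series.span (psym V ` partitions)"
    and N: "set_mset N \<subseteq> T" and R: "set_mset R \<inter> e ` T = {}"
  shows "coeff_series (specialize V (\<lambda>r. power_sum (e ` T) r + Z r) f) (image_mset e N + R) =
    coeff_series (specialize (V - T) Z (slice T N f)) R"
proof -
  let ?Y = "\<lambda>r. power_sum (e ` T) r + Z r"
  have inf': "infinite (V - T)" using inf fin by simp
  \<comment> \<open>The slice is followed together with its membership in the span, on which specialisation is linear.\<close>
  have main: "slice T N (psym V l :: ('v, 'a) series) \<in> series.span (psym (V - T) ` partitions) \<and>
      coeff_series (\<Prod>r\<leftarrow>l. ?Y r) (image_mset e N + R) = coeff_series (specialize (V - T) Z (slice T N (psym V l))) R"
    if "0 \<notin> set l" "set_mset N \<subseteq> T" "set_mset R \<inter> e ` T = {}" for l N R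
    using that
  proof (induction l arbitrary: N R)
    case Nil
    have one: "psym (V - T) [] = (1 :: ('v, 'a) series)" by (simp add: psym_def)
    have "(1 :: ('v, 'a) series) \<in> series.span (psym (V - T) ` partitions)"
      unfolding one[symmetric] by (rule psym_in_span) simp
    moreover have "specialize (V - T) Z 1 = 1"
      using specialize_psym[OF inf', of "[]" Z] by (simp add: one)
    moreover have "psym V [] = (1 :: ('v, 'a) series)" by (simp add: psym_def)
    moreover have "image_mset e N + R = {#} \<longleftrightarrow> N = {#} \<and> R = {#}" by simp
    ultimately show ?case
      using Nil by (auto simp: slice_one coeff_one series.span_zero specialize_zero[OF inf'])
  next
    case (Cons r l)
    have r: "r \<ge> 1" and l: "0 \<notin> set l" using Cons.prems by (auto simp: Suc_le_eq)
    note IH = Cons.IH[OF l]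
    let ?X = "{x. x \<in> T \<and> r \<le> count N x}"
    let ?P = "\<Prod>r\<leftarrow>l. ?Y r"
    have NX: "set_mset (N - replicate_mset r x) \<subseteq> T" for x
      using Cons.prems(2) by (auto dest: in_diffD)
    have sl: "slice T N (psym V (r # l) :: ('v, 'a) series) = power_sum (V - T) r * slice T N (psym V l) +
        (\<Sum>x\<in>?X. slice T (N - replicate_mset r x) (psym V l))"
      unfolding psym_Cons by (rule slice_power_sum_times[OF r Cons.prems(2) T])
    have span: "slice T N (psym V l :: ('v, 'a) series) \<in> series.span (psym (V - T) ` partitions)"
      "slice T (N - replicate_mset r x) (psym V l :: ('v, 'a) series) \<in> series.span (psym (V - T) ` partitions)" for x
      using IH[OF Cons.prems(2,3)] IH[OF NX Cons.prems(3)] by blast+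
    have "coeff_series (specialize (V - T) Z (slice T N (psym V (r # l)))) R =
      coeff_series (Z r * specialize (V - T) Z (slice T N (psym V l))) R +
      (\<Sum>x\<in>?X. coeff_series (specialize (V - T) Z (slice T (N - replicate_mset r x) (psym V l))) R)"
      unfolding sl using span r
      by (simp add: specialize_add[OF inf'] specialize_sum[OF inf'] power_sum_times_in_span[OF inf']
          specialize_power_sum_times[OF inf'] series.span_sum)
    also have "(\<Sum>x\<in>?X. coeff_series (specialize (V - T) Z (slice T (N - replicate_mset r x) (psym V l))) R) =
      (\<Sum>x\<in>?X. coeff_series ?P (image_mset e (N - replicate_mset r x) + R))"
      using IH[OF NX Cons.prems(3)] by simp
    also have "\<dots> = coeff_series (power_sum (e ` T) r * ?P) (image_mset e N + R)"
    proof -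
      have c: "count (image_mset e N) (e x) = count N x" for x by (rule count_image_mset_inj[OF e])
      have R0: "count R (e x) = 0" if "x \<in> T" for x using Cons.prems(3) that by (auto simp: not_in_iff[symmetric])
      have set: "{y. y \<in> e ` T \<and> r \<le> count (image_mset e N + R) y} = e ` ?X"
        using c R0 by auto
      have "image_mset e N + R - replicate_mset r (e x) = image_mset e (N - replicate_mset r x) + R" if "x \<in> ?X" for x
      proof -
        have sub: "replicate_mset r x \<subseteq># N" using that by (simp add: count_le_replicate_mset_subset_eq)
        then have "image_mset e N = image_mset e (N - replicate_mset r x) + replicate_mset r (e x)"
          by (metis image_mset_union image_replicate_mset subset_mset.diff_add)
        then show ?thesis by simp
      qed
      moreover have "inj_on e ?X" using e inj_on_subset by blast
      ultimately show ?thesis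
        unfolding coeff_power_sum_times[OF r] set by (simp add: sum.reindex)
    qed
    also have "coeff_series (Z r * specialize (V - T) Z (slice T N (psym V l))) R =
        coeff_series (Z r * ?P) (image_mset e N + R)"
    proof -
      have "coeff_series (Z r * ?P) (image_mset e N + R) =
        (\<Sum>A | A \<subseteq># R. coeff_series (Z r) A * coeff_series ?P (image_mset e N + R - A))"
        unfolding coeff_times
      proof (rule sum.mono_neutral_right)
        show "finite {A. A \<subseteq># image_mset e N + R}" by (rule finite_submultisets)
        show "{A. A \<subseteq># R} \<subseteq> {A. A \<subseteq># image_mset e N + R}" by (auto intro: subset_mset.add_increasing)
        have "A \<subseteq># R" if A: "A \<subseteq># image_mset e N + R" "coeff_series (Z r) A \<noteq> 0" for A
        proof (rule mset_subset_eqI)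
          fix y
          show "count A y \<le> count R y"
          proof (cases "y \<in> e ` T")
            case True
            then have "y \<notin># A" using Z[OF r A(2)] by auto
            then show ?thesis by (simp add: not_in_iff)
          next
            case False
            then have "count (image_mset e N) y = 0" using Cons.prems(2) by (auto simp: not_in_iff[symmetric])
            then show ?thesis using mset_subset_eq_count[OF A(1), of y] by simp
          qed
        qed
        then show "\<forall>A\<in>{A. A \<subseteq># image_mset e N + R} - {A. A \<subseteq># R}.
            coeff_series (Z r) A * coeff_series ?P (image_mset e N + R - A) = 0" by auto
      qed
      also have "\<dots> = (\<Sum>A | A \<subseteq># R. coeff_series (Z r) A * coeff_series (specialize (V - T) Z (slice T N (psym V l))) (R - A))"
      proof (rule sum.cong)
        fix A assume A: "A \<in> {A. A \<subseteq># R}"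
        then have "image_mset e N + R - A = image_mset e N + (R - A)" by simp
        moreover have "set_mset (R - A) \<inter> e ` T = {}" using Cons.prems(3) by (auto dest: in_diffD)
        ultimately show "coeff_series (Z r) A * coeff_series ?P (image_mset e N + R - A) =
            coeff_series (Z r) A * coeff_series (specialize (V - T) Z (slice T N (psym V l))) (R - A)"
          using IH[OF Cons.prems(2)] by simp
      qed simp
      finally show ?thesis by (simp add: coeff_times)
    qed
    finally have "coeff_series (\<Prod>r\<leftarrow>r # l. ?Y r) (image_mset e N + R) =
        coeff_series (specialize (V - T) Z (slice T N (psym V (r # l)))) R"
      by (simp add: distrib_right)
    moreover have "slice T N (psym V (r # l) :: ('v, 'a) series) \<in> series.span (psym (V - T) ` partitions)"
      unfolding sl using span r
      by (intro series.span_add series.span_sum power_sum_times_in_span[OF inf'])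
    ultimately show ?case by blast
  qed
  from f have "f \<in> series.span (psym V ` partitions) \<and> slice T N f \<in> series.span (psym (V - T) ` partitions) \<and>
    coeff_series (specialize V ?Y f) (image_mset e N + R) = coeff_series (specialize (V - T) Z (slice T N f)) R"
  proof (induction rule: series.span_induct_alt)
    case base
    then show ?case
      by (simp add: series.span_zero slice_linear specialize_zero[OF inf] specialize_zero[OF inf'])
  next
    case (step c x y)
    then obtain l where l: "is_partition l" "x = psym V l" by auto
    then have 0: "0 \<notin> set l" by (simp add: is_partition_def)
    have "x \<in> series.span (psym V ` partitions)" unfolding l(2) by (rule psym_in_span[OF 0])
    then show ?case
      using step main[OF 0 N R] specialize_psym[OF inf 0, of ?Y]
      by (simp add: l(2) slice_linear specialize_add[OF inf] specialize_add[OF inf']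
         specialize_scale[OF inf] specialize_scale[OF inf'] series.span_add series.span_scale)
  qed
  then show ?thesis by blast
qed

section \<open>Orthogonal changes of generators\<close>

text \<open>
  The squared norm of the monomial \<open>A\<close> in independent generators \<open>x\<close> of squared norm \<open>w x\<close>, for the
  form that the symmetric algebra inherits from its generators. With \<open>w r = r\<close> it is the number
  \<open>zee\<close> of a partition.
\<close>

definition multiset_norm :: "('j \<Rightarrow> 'a::comm_semiring_1) \<Rightarrow> 'j multiset \<Rightarrow> 'a" where
  "multiset_norm w A = of_nat (\<Prod>x\<in>set_mset A. fact (count A x)) * (\<Prod>x\<in>#A. w x)"

lemma multiset_norm_empty [simp]: "multiset_norm w {#} = 1"
  by (simp add: multiset_norm_def)

lemma multiset_norm_add_mset:
  "multiset_norm w (add_mset x A) = of_nat (Suc (count A x)) * w x * multiset_norm w A"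
proof -
  have A: "(\<Prod>y\<in>set_mset A. fact (count A y)) = (\<Prod>y\<in>insert x (set_mset A). fact (count A y) :: nat)"
    by (rule prod.mono_neutral_left) (auto simp: not_in_iff)
  have "(\<Prod>y\<in>insert x (set_mset A). fact (count (add_mset x A) y) :: nat) =
      fact (Suc (count A x)) * (\<Prod>y\<in>set_mset A - {x}. fact (count A y))"
    by (subst prod.insert_remove) (auto intro!: prod.cong split: if_splits)
  also have "\<dots> = Suc (count A x) * (\<Prod>y\<in>insert x (set_mset A). fact (count A y))"
    by (simp add: prod.insert_remove algebra_simps)
  finally show ?thesis
    unfolding multiset_norm_def A by (simp add: algebra_simps)
qed

text \<open>
  An algebra freely generated by the \<open>S x\<close>, with the form that makes the monomials in the generators
  orthogonal with these norms. The space \<open>W1\<close> spanned by the generators determines the form on the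
  whole algebra \<open>W\<close> independently of the choice of an orthogonal basis of \<open>W1\<close>: this is
  \<open>orthogonal_products\<close> below.
\<close>

locale gaussian_form =
  fixes J :: "'j set" and S :: "'j \<Rightarrow> ('v, 'a::field) series"
    and B :: "('v, 'a) series \<Rightarrow> ('v, 'a) series \<Rightarrow> 'a" and w :: "'j \<Rightarrow> 'a"
  assumes inj: "inj_on (\<lambda>A. \<Prod>x\<in>#A. S x) {A. set_mset A \<subseteq> J}"
    and indep: "series.independent ((\<lambda>A. \<Prod>x\<in>#A. S x) ` {A. set_mset A \<subseteq> J})"
    and add: "\<And>f g h. f \<in> series.span ((\<lambda>A. \<Prod>x\<in>#A. S x) ` {A. set_mset A \<subseteq> J}) \<Longrightarrow>
      g \<in> series.span ((\<lambda>A. \<Prod>x\<in>#A. S x) ` {A. set_mset A \<subseteq> J}) \<Longrightarrow> B (f + g) h = B f h + B g h"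
    and scale: "\<And>c f h. f \<in> series.span ((\<lambda>A. \<Prod>x\<in>#A. S x) ` {A. set_mset A \<subseteq> J}) \<Longrightarrow>
      B (scale_series c f) h = c * B f h"
    and commute: "\<And>f g. B f g = B g f"
    and B_basis: "\<And>A C. set_mset A \<subseteq> J \<Longrightarrow> set_mset C \<subseteq> J \<Longrightarrow>
      B (\<Prod>x\<in>#A. S x) (\<Prod>x\<in>#C. S x) = (if A = C then multiset_norm w A else 0)"
begin

abbreviation Ms :: "'j multiset set" where "Ms \<equiv> {A. set_mset A \<subseteq> J}"
abbreviation Sp :: "'j multiset \<Rightarrow> ('v, 'a) series" where "Sp A \<equiv> \<Prod>x\<in>#A. S x"
abbreviation W :: "('v, 'a) series set" where "W \<equiv> series.span (Sp ` Ms)"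
abbreviation W1 :: "('v, 'a) series set" where "W1 \<equiv> series.span (S ` J)"

lemma Sp_in: "A \<in> Ms \<Longrightarrow> Sp A \<in> W"
  by (intro series.span_base) auto

lemma W1_subset: "u \<in> W1 \<Longrightarrow> u \<in> W"
proof (induction rule: series.span_induct_alt)
  case (step c x y)
  then obtain j where "j \<in> J" "x = S j" by auto
  then have "x \<in> W" using Sp_in[of "{#j#}"] by simp
  with step show ?case by (simp add: series.span_add series.span_scale)
qed (simp add: series.span_zero)

lemma mult_in:
  assumes "u \<in> W1" "f \<in> W"
  shows "u * f \<in> W"
  using assms(1)
proof (induction rule: series.span_induct_alt)
  case (step c x y)
  then obtain j where j: "j \<in> J" "x = S j" by auto
  from assms(2) have "S j * f \<in> W"
  proof (induction rule: series.span_induct_alt)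
    case (step c x y)
    then obtain A where A: "A \<in> Ms" "x = Sp A" by auto
    have "S j * x \<in> W" using Sp_in[of "add_mset j A"] A j by simp
    with step show ?case
      by (simp add: distrib_left mult_scale_series series.span_add series.span_scale)
  qed (simp add: series.span_zero)
  with step j show ?case
    by (simp add: distrib_right scale_series_mult series.span_add series.span_scale)
qed (simp add: series.span_zero)

lemma prod_mset_in: "(\<And>k. k \<in># A \<Longrightarrow> Y k \<in> W1) \<Longrightarrow> (\<Prod>k\<in>#A. Y k) \<in> W"
  using Sp_in[of "{#}"] by (induction A) (auto intro: mult_in)

lemma zero: "B 0 h = 0"
  using scale[of 0 0 h] by (simp add: series.span_zero)

lemma zero_right: "B h 0 = 0"
  unfolding commute[of h] by (rule zero)

lemma sum_mset_left:
  assumes "\<And>k. k \<in># A \<Longrightarrow> f k \<in> W"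
  shows "B (\<Sum>k\<in>#A. f k) h = (\<Sum>k\<in>#A. B (f k) h) \<and> (\<Sum>k\<in>#A. f k) \<in> W"
  using assms by (induction A) (auto simp: zero add series.span_zero series.span_add)

text \<open>
  The derivation with value \<open>B u v\<close> on an element \<open>v\<close> of \<open>W1\<close>. For \<open>u\<close> in \<open>W1\<close> it is
  the adjoint of the multiplication by \<open>u\<close>, as the power sum \<open>p_r\<close> is adjoint to a multiple of the partial derivative
  with respect to \<open>p_r\<close>.
\<close>

definition derivation :: "('v, 'a) series \<Rightarrow> ('v, 'a) series \<Rightarrow> ('v, 'a) series" where
  "derivation u = extend_linearly Ms Sp (\<lambda>A. \<Sum>x\<in>#A. scale_series (B u (S x)) (Sp (A - {#x#})))"

lemma derivation_Sp: "A \<in> Ms \<Longrightarrow> derivation u (Sp A) = (\<Sum>x\<in>#A. scale_series (B u (S x)) (Sp (A - {#x#})))"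
  unfolding derivation_def by (rule extend_linearly_basis[OF inj indep])

lemma derivation_add: "f \<in> W \<Longrightarrow> g \<in> W \<Longrightarrow> derivation u (f + g) = derivation u f + derivation u g"
  unfolding derivation_def by (rule extend_linearly_add[OF inj indep])

lemma derivation_scale: "f \<in> W \<Longrightarrow> derivation u (scale_series c f) = scale_series c (derivation u f)"
  unfolding derivation_def by (rule extend_linearly_scale[OF inj indep])

lemma derivation_zero: "derivation u 0 = 0"
  unfolding derivation_def by (rule extend_linearly_zero[OF inj indep])

lemma derivation_one: "derivation u 1 = 0"
  using derivation_Sp[of "{#}" u] by simp

lemma diff_in_Ms: "A \<in> Ms \<Longrightarrow> A - C \<in> Ms"
  by (auto dest: in_diffD)

lemma derivation_Sp_in: "A \<in> Ms \<Longrightarrow> derivation u (Sp A) \<in> W"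
  unfolding derivation_Sp
  by (rule sum_mset_left[THEN conjunct2]) (intro series.span_scale Sp_in diff_in_Ms)

lemma derivation_in: "g \<in> W \<Longrightarrow> derivation u g \<in> W"
proof -
  assume "g \<in> W"
  then have "g \<in> W \<and> derivation u g \<in> W"
  proof (induction rule: series.span_induct_alt)
    case (step c x y)
    then obtain A where A: "A \<in> Ms" "x = Sp A" by auto
    with step show ?case using Sp_in[OF A(1)] derivation_Sp_in[OF A(1), of u]
      by (simp add: derivation_add derivation_scale series.span_add series.span_scale)
  qed (simp add: series.span_zero derivation_zero)
  then show ?thesis ..
qed

lemma derivation_generator:
  assumes j: "j \<in> J" and g: "g \<in> W"
  shows "derivation u (S j * g) = scale_series (B u (S j)) g + S j * derivation u g"
proof -
  have Sj: "S j \<in> W1" using j by (intro series.span_base) auto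
  from g have "g \<in> W \<and> derivation u (S j * g) = scale_series (B u (S j)) g + S j * derivation u g"
  proof (induction rule: series.span_induct_alt)
    case base show ?case by (simp add: series.span_zero derivation_zero)
  next
    case (step c x y)
    then obtain A where A: "A \<in> Ms" "x = Sp A" by auto
    have x: "x \<in> W" using A Sp_in by simp
    have "derivation u (S j * x) = derivation u (Sp (add_mset j A))" using A by simp
    also have "\<dots> = (\<Sum>x\<in>#add_mset j A. scale_series (B u (S x)) (Sp (add_mset j A - {#x#})))"
      using A j by (intro derivation_Sp) simp
    also have "\<dots> = scale_series (B u (S j)) (Sp A) + (\<Sum>x\<in>#A. scale_series (B u (S x)) (Sp (add_mset j A - {#x#})))"
      by simp
    also have "(\<Sum>x\<in>#A. scale_series (B u (S x)) (Sp (add_mset j A - {#x#}))) =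
        (\<Sum>x\<in>#A. S j * scale_series (B u (S x)) (Sp (A - {#x#})))"
      by (intro arg_cong[of _ _ sum_mset] image_mset_cong) (simp add: mult_scale_series)
    also have "\<dots> = S j * derivation u x"
      using A by (simp add: derivation_Sp sum_mset_distrib_left)
    finally have "derivation u (S j * x) = scale_series (B u (S j)) x + S j * derivation u x"
      using A by simp
    with step x mult_in[OF Sj] show ?case
      by (simp add: derivation_add derivation_scale series.span_add series.span_scale distrib_left mult_scale_series
          series.scale_right_distrib mult.commute)
  qed
  then show ?thesis ..
qed

lemma derivation_mult:
  assumes v: "v \<in> W1" and g: "g \<in> W"
  shows "derivation u (v * g) = scale_series (B u v) g + v * derivation u g"
proof -
  from v have "v \<in> W1 \<and> derivation u (v * g) = scale_series (B u v) g + v * derivation u g"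
  proof (induction rule: series.span_induct_alt)
    case base show ?case by (simp add: zero_right series.span_zero derivation_zero)
  next
    case (step c x y)
    then obtain j where j: "j \<in> J" "x = S j" by auto
    have x: "x \<in> W1" unfolding j(2) using j(1) by (intro series.span_base) auto
    have B: "B u (scale_series c x + y) = c * B u x + B u y"
      using x step W1_subset by (simp add: commute[of u] add scale series.span_scale)
    show ?case
      unfolding B using step x mult_in[OF _ g] derivation_generator[OF j(1) g, of u] j(2)
      by (simp add: derivation_add derivation_scale series.span_add series.span_scale distrib_right scale_series_mult
          series.scale_right_distrib series.scale_left_distrib)
  qed
  then show ?thesis ..
qed

text \<open>
  Both sides vanish unless \<open>C\<close> arises from \<open>A\<close> by adding \<open>j\<close>; in that case the multiplicity of
  \<open>j\<close> in \<open>C\<close> is the ratio of the two factorials.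
\<close>

lemma adjoint_Sp:
  assumes "j \<in> J" "A \<in> Ms" "C \<in> Ms"
  shows "B (S j * Sp A) (Sp C) = (\<Sum>x\<in>#C. B (S j) (S x) * B (Sp A) (Sp (C - {#x#})))"
proof -
  have B1: "B (S j) (S x) = (if x = j then w j else 0)" if "x \<in># C" for x
    using B_basis[of "{#j#}" "{#x#}"] assms that multiset_norm_add_mset[of w j "{#}"] by auto
  have "(\<Sum>x\<in>#C. B (S j) (S x) * B (Sp A) (Sp (C - {#x#}))) =
      (\<Sum>x\<in>#C. if x = j then w j * B (Sp A) (Sp (C - {#j#})) else 0)"
    by (intro arg_cong[of _ _ sum_mset] image_mset_cong) (simp add: B1)
  also have "\<dots> = of_nat (count C j) * (w j * B (Sp A) (Sp (C - {#j#})))"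
    by (simp add: sum_mset_delta)
  also have "\<dots> = B (Sp (add_mset j A)) (Sp C)"
  proof (cases "j \<in># C")
    case True
    then obtain C' where C': "C = add_mset j C'" by (metis insert_DiffM)
    then have "C' \<in> Ms" "C - {#j#} = C'" using assms by auto
    then show ?thesis
      using assms B_basis[of A C'] B_basis[of "add_mset j A" C] C'
      by (auto simp: multiset_norm_add_mset)
  next
    case False
    then have "add_mset j A \<noteq> C" by auto
    then show ?thesis using False assms B_basis[of "add_mset j A" C] by (simp add: not_in_iff)
  qed
  finally show ?thesis by simp
qed

lemma adjoint_basis:
  assumes u: "u \<in> W1" and f: "f \<in> W" and C: "C \<in> Ms"
  shows "B (u * f) (Sp C) = B f (derivation u (Sp C))"
proof -
  have CW: "Sp (C - {#x#}) \<in> W" for x by (rule Sp_in[OF diff_in_Ms[OF C]])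
  have D: "B f (derivation u (Sp C)) = (\<Sum>x\<in>#C. B u (S x) * B f (Sp (C - {#x#})))" for u f
    unfolding derivation_Sp[OF C] commute[of f]
    using CW by (subst sum_mset_left[THEN conjunct1]) (auto intro: series.span_scale simp: scale commute[of f])
  have gen: "B (S j * f) (Sp C) = (\<Sum>x\<in>#C. B (S j) (S x) * B f (Sp (C - {#x#})))" if j: "j \<in> J" for j
  proof -
    have Sj: "S j \<in> W1" using j by (intro series.span_base) auto
    from f have "f \<in> W \<and> B (S j * f) (Sp C) = (\<Sum>x\<in>#C. B (S j) (S x) * B f (Sp (C - {#x#})))"
    proof (induction rule: series.span_induct_alt)
      case base show ?case by (simp add: zero series.span_zero)
    next
      case (step c x y)
      then obtain A where A: "A \<in> Ms" "x = Sp A" by auto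
      have x: "x \<in> W" using A Sp_in by simp
      have "B (S j * (scale_series c x + y)) (Sp C) = c * B (S j * x) (Sp C) + B (S j * y) (Sp C)"
        using x step mult_in[OF Sj] by (simp add: distrib_left mult_scale_series add scale series.span_scale)
      also have "\<dots> = (\<Sum>z\<in>#C. B (S j) (S z) * (c * B x (Sp (C - {#z#})) + B y (Sp (C - {#z#}))))"
        using step adjoint_Sp[OF j A(1) C] A(2)
        by (simp add: distrib_left sum_mset.distrib sum_mset_distrib_left mult.left_commute)
      also have "\<dots> = (\<Sum>z\<in>#C. B (S j) (S z) * B (scale_series c x + y) (Sp (C - {#z#})))"
        using x step by (simp add: add scale series.span_scale)
      finally show ?case using x step by (simp add: series.span_add series.span_scale)
    qed
    then show ?thesis ..
  qed
  from u have "u \<in> W1 \<and> B (u * f) (Sp C) = (\<Sum>x\<in>#C. B u (S x) * B f (Sp (C - {#x#})))"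
  proof (induction rule: series.span_induct_alt)
    case base show ?case by (simp add: zero series.span_zero)
  next
    case (step c x y)
    then obtain j where j: "j \<in> J" "x = S j" by auto
    have x: "x \<in> W1" unfolding j(2) using j(1) by (intro series.span_base) auto
    have "B ((scale_series c x + y) * f) (Sp C) = c * B (x * f) (Sp C) + B (y * f) (Sp C)"
      using x step mult_in[OF _ f] by (simp add: distrib_right scale_series_mult add scale series.span_scale)
    also have "\<dots> = (\<Sum>z\<in>#C. (c * B x (S z) + B y (S z)) * B f (Sp (C - {#z#})))"
      using step gen[OF j(1)] j(2)
      by (simp add: distrib_right sum_mset.distrib sum_mset_distrib_left mult.assoc)
    also have "\<dots> = (\<Sum>z\<in>#C. B (scale_series c x + y) (S z) * B f (Sp (C - {#z#})))"
      using x step W1_subset by (simp add: add scale series.span_scale)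
    finally show ?case using x step by (simp add: series.span_add series.span_scale)
  qed
  then show ?thesis by (simp add: D)
qed

lemma adjoint:
  assumes u: "u \<in> W1" and f: "f \<in> W" and g: "g \<in> W"
  shows "B (u * f) g = B f (derivation u g)"
proof -
  from g have "g \<in> W \<and> B (u * f) g = B f (derivation u g)"
  proof (induction rule: series.span_induct_alt)
    case base show ?case by (simp add: zero_right series.span_zero derivation_zero)
  next
    case (step c x y)
    then obtain A where A: "A \<in> Ms" "x = Sp A" by auto
    have x: "x \<in> W" "derivation u x \<in> W" using A Sp_in derivation_Sp_in by auto
    have "B (u * f) (scale_series c x + y) = c * B (u * f) x + B (u * f) y"
      using x step by (simp add: commute[of "u * f"] add scale series.span_scale)
    also have "\<dots> = c * B f (derivation u x) + B f (derivation u y)"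
      using step adjoint_basis[OF u f A(1)] A(2) by simp
    also have "\<dots> = B f (derivation u (scale_series c x + y))"
      using x step derivation_in[of y u]
      by (simp add: derivation_add derivation_scale commute[of f] add scale series.span_scale)
    finally show ?case using x step by (simp add: series.span_add series.span_scale)
  qed
  then show ?thesis ..
qed

text \<open>
  A factor \<open>Y k\<close> on the left is moved to the right as a derivation. By orthogonality it acts there as
  a multiple of the partial derivative with respect to \<open>Y k\<close>, so it removes one \<open>k\<close> from \<open>C\<close> and
  produces the multiplicity of \<open>k\<close>.
\<close>

theorem orthogonal_products:
  assumes Y: "\<And>k. k \<in> K \<Longrightarrow> Y k \<in> W1"
    and orth: "\<And>k l. k \<in> K \<Longrightarrow> l \<in> K \<Longrightarrow> B (Y k) (Y l) = (if k = l then c k else 0)"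
    and A: "set_mset A \<subseteq> K" and C: "set_mset C \<subseteq> K"
  shows "B (\<Prod>k\<in>#A. Y k) (\<Prod>k\<in>#C. Y k) = (if A = C then multiset_norm c A else 0)"
proof -
  have YW: "(\<Prod>k\<in>#A. Y k) \<in> W" if "set_mset A \<subseteq> K" for A
    using that Y by (intro prod_mset_in) auto
  have D: "derivation (Y k) (\<Prod>l\<in>#C. Y l) = scale_series (of_nat (count C k) * c k) (\<Prod>l\<in>#C - {#k#}. Y l)"
    if k: "k \<in> K" and "set_mset C \<subseteq> K" for k C
    using that(2)
  proof (induction C)
    case empty show ?case by (simp add: derivation_one)
  next
    case (add l C)
    then have l: "l \<in> K" and C: "set_mset C \<subseteq> K" by auto
    have "derivation (Y k) (\<Prod>l\<in>#add_mset l C. Y l) =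
        scale_series (B (Y k) (Y l)) (\<Prod>l\<in>#C. Y l) + scale_series (of_nat (count C k) * c k) (Y l * (\<Prod>l\<in>#C - {#k#}. Y l))"
      using add.IH[OF C] derivation_mult[OF Y[OF l] YW[OF C], of "Y k"] by (simp add: mult_scale_series)
    also have "\<dots> = scale_series (of_nat (count (add_mset l C) k) * c k) (\<Prod>l\<in>#add_mset l C - {#k#}. Y l)"
    proof (cases "k \<in># C")
      case True
      then obtain C' where C': "C = add_mset k C'" by (metis insert_DiffM)
      show ?thesis
        unfolding orth[OF k l] C'
        by (cases "k = l") (simp_all add: algebra_simps flip: series.scale_left_distrib)
    next
      case False
      then have "count C k = 0" by (simp add: not_in_iff)
      then show ?thesis unfolding orth[OF k l] by (cases "k = l") simp_all
    qed
    finally show ?case .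
  qed
  have adj: "B (Y k * f) (\<Prod>l\<in>#C. Y l) = of_nat (count C k) * c k * B f (\<Prod>l\<in>#C - {#k#}. Y l)"
    if k: "k \<in> K" and C: "set_mset C \<subseteq> K" and f: "f \<in> W" for k C f
  proof -
    have "set_mset (C - {#k#}) \<subseteq> K" using C by (auto dest: in_diffD)
    then show ?thesis
      using adjoint[OF Y[OF k] f YW[OF C]] YW D[OF k C] scale commute by simp
  qed
  show ?thesis using A C
  proof (induction A arbitrary: C)
    case empty
    show ?case
    proof (cases C)
      case empty then show ?thesis using B_basis[of "{#}" "{#}"] by simp
    next
      case (add k C')
      then have k: "k \<in> K" "set_mset C' \<subseteq> K" using empty.prems by auto
      have "B (\<Prod>k\<in>#C. Y k) (\<Prod>k\<in>#{#}. Y k) = 0"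
        using adj[OF k(1) _ YW[OF k(2)], of "{#}"] by (simp add: add)
      then show ?thesis using commute add by simp
    qed
  next
    case (add k A)
    then have k: "k \<in> K" "set_mset A \<subseteq> K" by auto
    have "B (\<Prod>k\<in>#add_mset k A. Y k) (\<Prod>k\<in>#C. Y k) =
        of_nat (count C k) * c k * B (\<Prod>k\<in>#A. Y k) (\<Prod>l\<in>#C - {#k#}. Y l)"
      using adj[OF k(1) add.prems(2) YW[OF k(2)]] by simp
    also have "\<dots> = (if add_mset k A = C then multiset_norm c (add_mset k A) else 0)"
    proof (cases "k \<in># C")
      case True
      then obtain C' where C': "C = add_mset k C'" by (metis insert_DiffM)
      then show ?thesis using add.IH[OF k(2), of C'] add.prems
        by (simp add: multiset_norm_add_mset)
    next
      case False
      then show ?thesis by (auto simp: not_in_iff)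
    qed
    finally show ?case .
  qed
qed

end

section \<open>The substitution of powers for the two parameters\<close>

lemma qt_power_poly_add: "qt_power_poly r (a + b) = qt_power_poly r a + qt_power_poly r b"
proof -
  have "map_poly (\<lambda>p. pcompose p (monom 1 r)) (a + b) =
      map_poly (\<lambda>p. pcompose p (monom 1 r)) a + map_poly (\<lambda>p. pcompose p (monom 1 r)) b"
    by (rule poly_eqI) (simp add: coeff_map_poly pcompose_add)
  then show ?thesis by (simp add: qt_power_poly_def pcompose_add)
qed

lemma qt_power_poly_mult: "qt_power_poly r (a * b) = qt_power_poly r a * qt_power_poly r b"
proof -
  have "map_poly (\<lambda>p. pcompose p (monom 1 r)) (a * b) =
      map_poly (\<lambda>p. pcompose p (monom 1 r)) a * map_poly (\<lambda>p. pcompose p (monom 1 r)) b"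
    by (rule poly_eqI) (simp add: coeff_map_poly coeff_mult pcompose_sum pcompose_mult)
  then show ?thesis by (simp add: qt_power_poly_def pcompose_mult)
qed

lemma qt_power_poly_eq_0:
  assumes "r \<ge> 1" "qt_power_poly r a = 0"
  shows "a = 0"
proof -
  have inj: "p = 0" if "pcompose p (monom 1 r) = 0" for p :: "'a::idom poly"
    using that assms(1) by (intro pcompose_eq_0[of p "monom 1 r"]) (auto simp: degree_monom_eq)
  have m: "map_poly (\<lambda>p. pcompose p (monom 1 r)) a = 0"
    using assms(2) inj unfolding qt_power_poly_def by blast
  show ?thesis
  proof (rule poly_eqI)
    fix i
    have "pcompose (coeff a i) (monom 1 r) = coeff (map_poly (\<lambda>p. pcompose p (monom 1 r)) a) i"
      by (simp add: coeff_map_poly)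
    also have "\<dots> = 0" by (simp add: m)
    finally show "coeff a i = coeff 0 i" using inj by simp
  qed
qed

lemma qt_power_poly_0 [simp]: "qt_power_poly r 0 = 0"
  by (simp add: qt_power_poly_def)

lemma qt_power_poly_1 [simp]: "qt_power_poly r 1 = 1"
  by (simp add: qt_power_poly_def map_poly_1 pcompose_1)

text \<open>
  The substitution is defined through the reduced fraction; because it is an injective ring
  homomorphism on polynomials, every other representation gives the same value.
\<close>

lemma qt_power_Fract:
  assumes r: "r \<ge> 1" and b: "b \<noteq> 0"
  shows "qt_power r (Fract a b) = Fract (qt_power_poly r a) (qt_power_poly r b)"
proof -
  obtain a' b' where q: "quot_of_fract (Fract a b) = (a', b')" by (cases "quot_of_fract (Fract a b)")
  have b': "b' \<noteq> 0" using snd_quot_of_fract_nonzero[of "Fract a b"] q by simp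
  have "Fract a' b' = Fract a b" using Fract_quot_of_fract[of "Fract a b"] q by simp
  then have "a' * b = a * b'" using b b' by (simp add: eq_fract)
  then have "qt_power_poly r (a' * b) = qt_power_poly r (a * b')" by simp
  then have "qt_power_poly r a' * qt_power_poly r b = qt_power_poly r a * qt_power_poly r b'"
    by (simp only: qt_power_poly_mult)
  moreover have "qt_power_poly r b \<noteq> 0" "qt_power_poly r b' \<noteq> 0"
    using qt_power_poly_eq_0[OF r] b b' by blast+
  ultimately show ?thesis by (simp add: qt_power_def q eq_fract)
qed

lemma Fract_power: "Fract (a ^ k) 1 = Fract (a :: 'a::idom) 1 ^ k"
proof (induction k)
  case (Suc k)
  have "Fract (a ^ Suc k) 1 = Fract a 1 * Fract (a ^ k) 1" by simp
  with Suc show ?case by simp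
qed (simp add: One_fract_def)

context
  fixes r :: nat
  assumes r: "r \<ge> 1"
begin

lemma qt_power_poly_nonzero: "b \<noteq> 0 \<Longrightarrow> qt_power_poly r b \<noteq> 0"
  using qt_power_poly_eq_0[OF r] by blast

lemma qt_power_add: "qt_power r (x + y) = qt_power r x + qt_power r y"
proof -
  obtain a b c d where "x = Fract a b" "b \<noteq> 0" "y = Fract c d" "d \<noteq> 0"
    by (metis Fract_cases)
  then show ?thesis
    by (simp add: qt_power_Fract[OF r] qt_power_poly_add qt_power_poly_mult qt_power_poly_nonzero)
qed

lemma qt_power_mult: "qt_power r (x * y) = qt_power r x * qt_power r y"
proof -
  obtain a b c d where "x = Fract a b" "b \<noteq> 0" "y = Fract c d" "d \<noteq> 0"
    by (metis Fract_cases)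
  then show ?thesis
    by (simp add: qt_power_Fract[OF r] qt_power_poly_mult qt_power_poly_nonzero)
qed

lemma qt_power_0: "qt_power r 0 = 0"
  using qt_power_add[of 0 0] by simp

lemma qt_power_1: "qt_power r 1 = 1"
  using qt_power_Fract[OF r, of 1 1] by (simp add: One_fract_def)

lemma qt_power_diff: "qt_power r (x - y) = qt_power r x - qt_power r y"
  using qt_power_add[of "x - y" y] by simp

lemma qt_power_eq_0_iff: "qt_power r x = 0 \<longleftrightarrow> x = 0"
proof
  assume "qt_power r x = 0"
  then show "x = 0"
    using qt_power_mult[of x "inverse x"] qt_power_1 by (cases "x = 0") auto
qed (simp add: qt_power_0)

lemma qt_power_divide: "qt_power r (x / y) = qt_power r x / qt_power r y"
proof (cases "y = 0")
  case False
  then have "qt_power r (x / y) * qt_power r y = qt_power r x"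
    by (simp flip: qt_power_mult)
  then show ?thesis using False by (simp add: field_simps qt_power_eq_0_iff)
qed (simp add: qt_power_0)

lemma qt_power_power: "qt_power r (x ^ k) = qt_power r x ^ k"
  by (induction k) (simp_all add: qt_power_1 qt_power_mult)

lemma qt_power_qq: "qt_power r qq = qq ^ r"
proof -
  have "monom (1 :: 'a::comm_ring_1) k = [:0, 1:] ^ k" for k
    by (induction k) (simp_all add: monom_Suc one_pCons[symmetric])
  then have "qt_power_poly r [:[:0, 1:]:] = [:[:0, 1:]:] ^ r"
    by (simp add: qt_power_poly_def map_poly_pCons pcompose_pCons poly_const_pow)
  then show ?thesis by (simp add: qq_def qt_power_Fract[OF r] Fract_power)
qed

lemma qt_power_tt: "qt_power r tt = tt ^ r"
proof -
  have "monom (1 :: 'a::comm_ring_1) k = [:0, 1:] ^ k" for k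
    by (induction k) (simp_all add: monom_Suc one_pCons[symmetric])
  then have "qt_power_poly r [:0, 1:] = [:0, 1:] ^ r"
    by (simp add: qt_power_poly_def map_poly_pCons pcompose_pCons pcompose_1)
  then show ?thesis by (simp add: tt_def qt_power_Fract[OF r] Fract_power)
qed

end

lemma qq_nonzero: "qq \<noteq> 0"
  by (simp add: qq_def Zero_fract_def eq_fract)

lemma qq_neq_1: "qq \<noteq> 1"
  by (simp add: qq_def One_fract_def eq_fract one_pCons)

lemma qq_tt_neq_1: "qq ^ k * tt \<noteq> 1"
proof -
  have "qq ^ k * tt = Fract ([:[:0, 1:]:] ^ k * [:0, 1:]) 1"
    unfolding qq_def tt_def Fract_power[symmetric] by simp
  moreover have "[:[:0, 1:]:] ^ k * [:0, 1:] \<noteq> (1 :: rat poly poly)"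
  proof
    assume "[:[:0, 1:]:] ^ k * [:0, 1:] = (1 :: rat poly poly)"
    then have "poly ([:[:0, 1:]:] ^ k * [:0, 1:]) 0 = poly (1 :: rat poly poly) 0" by simp
    then show False by simp
  qed
  ultimately show ?thesis by (simp add: One_fract_def eq_fract)
qed

lemma one_minus_qt_power_nonzero:
  assumes "r \<ge> 1"
  shows "1 - qq ^ r \<noteq> 0" "1 - (qq ^ r) ^ k * tt ^ r \<noteq> 0"
  using qt_power_eq_0_iff[OF assms, of "1 - qq"] qt_power_eq_0_iff[OF assms, of "1 - qq ^ k * tt"]
    qq_neq_1 qq_tt_neq_1[of k]
  by (simp_all add: qt_power_diff[OF assms] qt_power_1[OF assms] qt_power_mult[OF assms]
      qt_power_power[OF assms] qt_power_qq[OF assms] qt_power_tt[OF assms])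

section \<open>The Gram matrix of the alphabets\<close>

text \<open>
  The scalar products of the generators, for a fixed \<open>r\<close>, with \<open>Q = q^r\<close>, \<open>T = t^r\<close> and \<open>\<rho> = r\<close>. Let
  \<open>S i = p_r(x^(1), ..., x^(i))\<close>, which are orthogonal with squared norms \<open>w i\<close>, and let \<open>Y i\<close> be the
  power sum of the \<open>i\<close>-th virtual alphabet, so that \<open>Y i = S i - S (i - 1) + c i * Y (i + 1)\<close>. Here
  \<open>s j i\<close> and \<open>b i j\<close> stand for the products of \<open>S j\<close> with \<open>Y i\<close> and of \<open>Y i\<close> with \<open>Y j\<close>. As \<open>Y i\<close>
  involves only the \<open>S j\<close> with \<open>j \<ge> i - 1\<close>, the only product of \<open>Y i\<close> with a later \<open>Y j\<close> that needs
  a computation is the one with \<open>Y (i + 1)\<close>, where the two contributions are \<open>- w i\<close> and \<open>c i\<close> times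
  the norm of \<open>Y (i + 1)\<close>; the ratios \<open>c i\<close> are exactly those for which they cancel.
\<close>

lemma alphabet_gram_matrix:
  fixes Q T \<rho> :: "'a::field" and s b :: "nat \<Rightarrow> nat \<Rightarrow> 'a" and w c :: "nat \<Rightarrow> 'a"
  assumes n: "n \<ge> 1"
    and D: "\<And>k. 1 - Q ^ k * T \<noteq> 0"
    and w: "\<And>i. w i = \<rho> * Q ^ (n - i) * (if i = n then (1 - Q) / (1 - T) else 1)"
    and c: "\<And>i. i < n \<Longrightarrow> c i = Q * (1 - Q ^ (n - Suc i) * T) / (1 - Q ^ (n - i) * T)"
    and s: "\<And>i j. i \<in> {1..n} \<Longrightarrow> s j i = (if j = i then w i else 0) - (if j = i - 1 \<and> j \<ge> 1 then w j else 0) +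
       (if i < n then c i * s j (i + 1) else 0)"
    and b: "\<And>i j. i \<in> {1..n} \<Longrightarrow> j \<in> {1..n} \<Longrightarrow> b i j = s i j - (if i = 1 then 0 else s (i - 1) j) +
       (if i < n then c i * b (i + 1) j else 0)"
    and sym: "\<And>i j. b i j = b j i"
    and ij: "i \<in> {1..n}" "j \<in> {1..n}"
  shows "b i j = (if i = j then \<rho> * Q ^ (n - i) * ((1 - (if i = 1 then Q else Q ^ (n - i + 1) * T)) / (1 - Q ^ (n - i) * T)) else 0)"
proof -
  define N where "N i = \<rho> * Q ^ (n - i) * ((1 - (if i = 1 then Q else Q ^ (n - i + 1) * T)) / (1 - Q ^ (n - i) * T))" for i
  have s_less: "s j i = (if j + 1 = i \<and> j \<ge> 1 then - w j else 0)" if "i \<in> {1..n}" "j < i" for i j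
    using that
  proof (induction "n - i" arbitrary: i)
    case 0
    then have "i = n" by simp
    with 0 s[of i j] show ?case by auto
  next
    case (Suc k)
    then have "i < n" by simp
    have "s j (i + 1) = (if j + 1 = i + 1 \<and> j \<ge> 1 then - w j else 0)"
      using Suc by (intro Suc.hyps(1)) auto
    then show ?case using Suc.prems s[of i j] by auto
  qed
  have s_eq: "s i i = w i - (if i < n then c i * w i else 0)" if "i \<in> {1..n}" for i
    using that s[of i i] s_less[of "i + 1" i] by auto
  have 1: "w i - c i * w i = \<rho> * Q ^ (n - i) * ((1 - Q) / (1 - Q ^ (n - i) * T))" if lt: "i < n" for i
  proof -
    obtain k where k: "n - i = Suc k" using lt by (cases "n - i") auto
    then have k': "n - Suc i = k" by simp
    have "w i - c i * w i = \<rho> * Q ^ Suc k * (1 - Q * (1 - Q ^ k * T) / (1 - Q ^ Suc k * T))"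
      using lt by (simp add: w c k k' algebra_simps)
    also have "1 - Q * (1 - Q ^ k * T) / (1 - Q ^ Suc k * T) = (1 - Q) / (1 - Q ^ Suc k * T)"
      using D[of "Suc k"] by (simp add: field_simps)
    finally show ?thesis by (simp add: k)
  qed
  have diag: "w i - (if i < n then c i * w i else 0) = \<rho> * Q ^ (n - i) * ((1 - Q) / (1 - Q ^ (n - i) * T))"
    if "i \<in> {1..n}" for i
    using 1[of i] that by (auto simp: w)
  have norm: "s i i - (if i = 1 then 0 else s (i - 1) i) = N i" if i: "i \<in> {1..n}" for i
  proof (cases "i = 1")
    case True
    then show ?thesis using s_eq[OF i] diag[OF i] by (simp add: N_def)
  next
    case False
    then obtain h where h: "i = Suc h" "h \<ge> 1" using i by (cases i) auto
    have "s h i = - w h" using s_less[OF i, of h] h by simp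
    then have "s i i - (if i = 1 then 0 else s (i - 1) i) = \<rho> * Q ^ (n - i) * ((1 - Q) / (1 - Q ^ (n - i) * T)) + w h"
      using s_eq[OF i] diag[OF i] h by simp
    also have "w h = \<rho> * Q ^ (n - i) * Q"
    proof -
      have "n - h = Suc (n - i)" "h \<noteq> n" using h i by auto
      then show ?thesis by (simp add: w)
    qed
    also have "\<rho> * Q ^ (n - i) * ((1 - Q) / (1 - Q ^ (n - i) * T)) + \<rho> * Q ^ (n - i) * Q =
        \<rho> * Q ^ (n - i) * ((1 - Q) / (1 - Q ^ (n - i) * T) + Q)"
      by (simp add: algebra_simps)
    also have "(1 - Q) / (1 - Q ^ (n - i) * T) + Q = (1 - Q ^ (n - i + 1) * T) / (1 - Q ^ (n - i) * T)"
      using D[of "n - i"] by (simp add: field_simps)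
    finally show ?thesis using False by (simp add: N_def)
  qed
  \<comment> \<open>The ratios \<open>c i\<close> enter only here and through the difference \<open>w i - c i * w i\<close> in the norm.\<close>
  have cancel: "c i * N (i + 1) = w i" if lt: "i < n" "i \<ge> 1" for i
  proof -
    obtain k where "n - i = Suc k" using lt by (cases "n - i") auto
    then have k: "n - i = Suc k" "n - Suc i = k" by simp_all
    have "c i * N (i + 1) = Q * (1 - Q ^ k * T) / (1 - Q ^ Suc k * T) *
        (\<rho> * Q ^ k * ((1 - Q ^ Suc k * T) / (1 - Q ^ k * T)))"
      using lt by (simp add: c N_def k)
    also have "\<dots> = \<rho> * (Q * Q ^ k)"
    proof -
      have "Q * x / y * (\<rho> * z * (y / x)) = \<rho> * (Q * z)" if "x \<noteq> 0" "y \<noteq> 0" for x y z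
        using that by (simp add: field_simps)
      from this[OF D D] show ?thesis .
    qed
    finally show ?thesis using lt by (simp add: w k)
  qed
  have main: "(\<forall>j. i < j \<and> j \<le> n \<longrightarrow> b i j = 0) \<and> b i i = N i" if "i \<in> {1..n}" for i
    using that
  proof (induction "n - i" arbitrary: i)
    case 0
    then have "i = n" by simp
    then show ?case using b[of n n] norm[of n] n by auto
  next
    case (Suc k)
    then have i: "i < n" "i \<ge> 1" by auto
    have IH: "(\<forall>j. i + 1 < j \<and> j \<le> n \<longrightarrow> b (i + 1) j = 0) \<and> b (i + 1) (i + 1) = N (i + 1)"
      using Suc.hyps(2) i by (intro Suc.hyps(1)) auto
    have up: "b i j = 0" if j: "i < j" "j \<le> n" for j
    proof -
      have bij: "b i j = s i j - (if i = 1 then 0 else s (i - 1) j) + c i * b (i + 1) j"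
        using b[of i j] i j by simp
      have s1: "s (i - 1) j = 0" if "i \<noteq> 1" using s_less[of j "i - 1"] i j that by auto
      show ?thesis
      proof (cases "j = i + 1")
        case True
        then have "s i j = - w i" using s_less[of j i] i j by auto
        then show ?thesis using bij s1 IH cancel[OF i] True by simp
      next
        case False
        then have "s i j = 0" "b (i + 1) j = 0" using s_less[of j i] i j IH by auto
        then show ?thesis using bij s1 by simp
      qed
    qed
    have "b (i + 1) i = 0" using up[of "i + 1"] i sym by simp
    then have "b i i = N i" using b[of i i] norm[of i] i by simp
    with up show ?case by blast
  qed
  show ?thesis
    using main[OF ij(1)] main[OF ij(2)] ij sym[of i j] unfolding N_def[symmetric]
    by (cases i j rule: linorder_cases) auto
qed

section \<open>The scalar product on multi-symmetric functions\<close>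

lemma multiset_norm_union:
  "set_mset A \<inter> set_mset C = {} \<Longrightarrow> multiset_norm w (A + C) = multiset_norm w A * multiset_norm w C"
proof (induction C)
  case (add x C)
  then have "count A x = 0" by (simp add: not_in_iff)
  with add show ?case by (simp add: multiset_norm_add_mset mult_ac)
qed simp

lemma multiset_norm_image_Pair: "multiset_norm w (image_mset (Pair i) X) = multiset_norm (\<lambda>r. w (i, r)) X"
proof (induction X)
  case (add x X)
  have "count (image_mset (Pair i) X) (i, x) = count X x"
    by (rule count_image_mset_inj) (simp add: inj_def)
  with add show ?case by (simp add: multiset_norm_add_mset)
qed simp

lemma multiset_norm_parts_of:
  "multiset_norm w (parts_of n L) = (\<Prod>i\<in>{1..n}. multiset_norm (\<lambda>r. w (i, r)) (mset (L i)))"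
proof -
  have "multiset_norm w (\<Sum>i\<in>I. image_mset (Pair i) (mset (L i))) = (\<Prod>i\<in>I. multiset_norm (\<lambda>r. w (i, r)) (mset (L i)))"
    if "finite I" for I
    using that
  proof (induction I)
    case (insert i I)
    have "set_mset (\<Sum>i\<in>I. image_mset (Pair i) (mset (L i))) \<subseteq> I \<times> UNIV"
      using insert.hyps by (induction I) auto
    then have "set_mset (image_mset (Pair i) (mset (L i))) \<inter> set_mset (\<Sum>i\<in>I. image_mset (Pair i) (mset (L i))) = {}"
      using insert.hyps by auto
    with insert show ?case by (simp add: multiset_norm_union multiset_norm_image_Pair del: mset_map)
  qed simp
  then show ?thesis by (simp add: parts_of_def)
qed

lemma multiset_norm_zee:
  fixes u :: "nat \<Rightarrow> 'a::comm_semiring_1"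
  shows "multiset_norm (\<lambda>r. of_nat r * u r) (mset l) = of_nat (zee l) * (\<Prod>r\<leftarrow>l. u r)"
proof -
  have "(of_nat (zee l) :: 'a) = of_nat (\<Prod>r\<in>set l. fact (count (mset l) r)) * (\<Prod>r\<in>set l. of_nat r ^ count (mset l) r)"
    by (simp add: zee_def prod.distrib count_mset mult.commute of_nat_prod of_nat_power)
  also have "(\<Prod>r\<in>set l. of_nat r ^ count (mset l) r) = (\<Prod>r\<in>#mset l. of_nat r)"
    by (simp add: image_prod_mset_multiplicity)
  finally show ?thesis
    by (simp add: multiset_norm_def prod_mset.distrib mult.assoc flip: prod_mset_prod_list)
qed

lemma multiset_norm_nonzero:
  "(\<And>x. x \<in># A \<Longrightarrow> w x \<noteq> (0::'a::field_char_0)) \<Longrightarrow> multiset_norm w A \<noteq> 0"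
  by (induction A) (auto simp: multiset_norm_add_mset simp del: of_nat_Suc)

text \<open>
  The factor that a part \<open>r\<close> with label \<open>i\<close> contributes to the scalar product of multi-symmetric
  functions, for \<open>y = (i, r)\<close>: the exponent of \<open>q\<close> there is the sum of the \<open>(n - i) r\<close> over all parts.
\<close>

definition cumulative_norm :: "nat \<Rightarrow> nat \<times> nat \<Rightarrow> qt_field" where
  "cumulative_norm n y = of_nat (snd y) *
     (qq ^ (snd y * (n - fst y)) * (if fst y = n then (1 - qq ^ snd y) / (1 - tt ^ snd y) else 1))"

lemma prod_list_power: "(\<Prod>r\<leftarrow>l. x ^ (r * k)) = (x :: 'a::comm_monoid_mult) ^ (k * sum_list l)"
  by (induction l) (simp_all add: power_add algebra_simps)

lemma prod_list_times: "(\<Prod>r\<leftarrow>l. f r * g r) = (\<Prod>r\<leftarrow>l. f r) * (\<Prod>r\<leftarrow>l. g r :: 'a::comm_monoid_mult)"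
  by (induction l) (simp_all add: algebra_simps)

lemma multi_norm_eq:
  assumes "n \<ge> 1"
  shows "qq ^ ((n - 1) * (\<Sum>i=1..n. sum_list (L i)) - (\<Sum>i=1..n. (i - 1) * sum_list (L i)))
        * (\<Prod>i=1..n. of_nat (zee (L i)))
        * (\<Prod>r\<leftarrow>L n. (1 - qq ^ r) / (1 - tt ^ r)) = multiset_norm (cumulative_norm n) (parts_of n L)"
proof -
  have "(n - 1) * (\<Sum>i=1..n. sum_list (L i)) = (\<Sum>i=1..n. (n - i) * sum_list (L i)) + (\<Sum>i=1..n. (i - 1) * sum_list (L i))"
    by (auto simp: sum_distrib_left simp flip: sum.distrib distrib_right intro!: sum.cong)
  then have e: "(n - 1) * (\<Sum>i=1..n. sum_list (L i)) - (\<Sum>i=1..n. (i - 1) * sum_list (L i)) = (\<Sum>i=1..n. (n - i) * sum_list (L i))"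
    by simp
  have u: "multiset_norm (\<lambda>r. cumulative_norm n (i, r)) (mset (L i)) = of_nat (zee (L i)) *
     (qq ^ ((n - i) * sum_list (L i)) * (\<Prod>r\<leftarrow>L i. if i = n then (1 - qq ^ r) / (1 - tt ^ r) else 1))" for i
    unfolding cumulative_norm_def fst_conv snd_conv multiset_norm_zee by (simp only: prod_list_times prod_list_power)
  have one: "(\<Prod>r\<leftarrow>l. 1 :: qt_field) = 1" for l :: "nat list" by (induction l) auto
  have "(\<Prod>i=1..n. \<Prod>r\<leftarrow>L i. if i = n then (1 - qq ^ r) / (1 - tt ^ r) else 1) =
    (\<Prod>i=1..n. if i = n then \<Prod>r\<leftarrow>L n. (1 - qq ^ r) / (1 - tt ^ r) else 1)"
    by (intro prod.cong refl) (auto simp: one)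
  also have "\<dots> = (\<Prod>r\<leftarrow>L n. (1 - qq ^ r) / (1 - tt ^ r))"
    using assms by simp
  finally show ?thesis
    unfolding e by (simp add: multiset_norm_parts_of u prod.distrib power_sum mult.assoc mult.left_commute)
qed

lemma cumulative_norm_nonzero:
  assumes "snd y \<ge> 1"
  shows "cumulative_norm n y \<noteq> 0"
  using assms one_minus_qt_power_nonzero(1)[OF assms] one_minus_qt_power_nonzero(2)[OF assms, of 0]
  by (auto simp: cumulative_norm_def qq_nonzero)

lemma parts_of_cases:
  assumes "A \<in> labelled_parts n"
  obtains L where "L \<in> multipartitions n" "A = parts_of n L"
  using assms bij_betw_imp_surj_on[OF parts_of_bij, of n] by blast

lemma labelled_parts_eq: "{A. set_mset A \<subseteq> {1..n} \<times> {1..}} = labelled_parts n"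
  by (simp add: labelled_parts_def)

lemma multi_form_add:
  assumes "f \<in> series.span (multi_msym n ` multipartitions n)" "g \<in> series.span (multi_msym n ` multipartitions n)"
  shows "multi_form n (f + g) h = multi_form n f h + multi_form n g h"
  using assms unfolding multi_form_def span_multi_psym[symmetric]
  by (rule bilinear_form_add_left[OF multi_psym_independent])

lemma multi_form_scale:
  assumes "f \<in> series.span (multi_msym n ` multipartitions n)"
  shows "multi_form n (scale_series c f) h = c * multi_form n f h"
  using assms unfolding multi_form_def span_multi_psym[symmetric]
  by (rule bilinear_form_scale_left[OF multi_psym_independent])

lemma multi_form_commute: "multi_form n f g = multi_form n g f"
  unfolding multi_form_def by (intro bilinear_form_commute multi_psym_independent) auto

lemma multi_form_psym:
  assumes "n \<ge> 1" "L \<in> multipartitions n" "L' \<in> multipartitions n"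
  shows "multi_form n (multi_psym n L) (multi_psym n L') =
    (if L = L' then multiset_norm (cumulative_norm n) (parts_of n L) else 0)"
  unfolding multi_form_def using assms
  by (subst bilinear_form_basis[OF multi_psym_independent]) (simp_all only: multi_norm_eq)

text \<open>
  Written over labelled parts, the scalar product of multi-symmetric functions is the Gaussian form
  of the power sums in the first \<open>i\<close> alphabets.
\<close>

lemma gaussian_form_multi:
  assumes n: "n \<ge> 1"
  shows "gaussian_form ({1..n} \<times> {1..}) (cumulative_power_sum fst) (multi_form n) (cumulative_norm n)"
proof (unfold_locales, unfold labelled_parts_eq power_product_def[symmetric])
  have W: "series.span (power_product fst ` labelled_parts n) = series.span (multi_msym n ` multipartitions n)"
    by (simp add: span_multi_psym flip: multi_psym_image)
  show "inj_on (power_product fst :: _ \<Rightarrow> msf) (labelled_parts n)"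
    "series.independent ((power_product fst :: _ \<Rightarrow> msf) ` labelled_parts n)"
    by (rule pair_letters.power_product_independent)+
  show "multi_form n (f + g) h = multi_form n f h + multi_form n g h"
    if "f \<in> series.span (power_product fst ` labelled_parts n)" "g \<in> series.span (power_product fst ` labelled_parts n)" for f g h
    using that unfolding W by (rule multi_form_add)
  show "multi_form n (scale_series c f) h = c * multi_form n f h"
    if "f \<in> series.span (power_product fst ` labelled_parts n)" for c f h
    using that unfolding W by (rule multi_form_scale)
  show "multi_form n f g = multi_form n g f" for f g by (rule multi_form_commute)
  show "multi_form n (power_product fst A) (power_product fst C) = (if A = C then multiset_norm (cumulative_norm n) A else 0)"
    if "set_mset A \<subseteq> {1..n} \<times> {1..}" "set_mset C \<subseteq> {1..n} \<times> {1..}" for A C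
  proof -
    have AC: "A \<in> labelled_parts n" "C \<in> labelled_parts n" using that by (simp_all add: labelled_parts_def)
    obtain L where L: "L \<in> multipartitions n" "A = parts_of n L" using AC(1) by (rule parts_of_cases)
    obtain L' where L': "L' \<in> multipartitions n" "C = parts_of n L'" using AC(2) by (rule parts_of_cases)
    have "A = C \<longleftrightarrow> L = L'" using parts_of_bij[of n] L L' by (auto simp: bij_betw_def inj_on_def)
    then show ?thesis using multi_form_psym[OF n L(1) L'(1)] L L' by (simp add: multi_psym_eq)
  qed
qed

section \<open>The power sums of the plethystic alphabets\<close>

text \<open>
  The \<open>r\<close>-th power sum of the alphabet \<open>A_(n - i)\<close>, for \<open>y = (i, r)\<close>.
\<close>

definition plethystic_power_sum :: "nat \<Rightarrow> nat \<times> nat \<Rightarrow> msf" where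
  "plethystic_power_sum n y = power_sum_plethysm n (alphabet_A n (n - fst y)) (snd y)"

text \<open>
  The coefficient of the recursion for the alphabets, after replacing \<open>q\<close>, \<open>t\<close> by \<open>q^r\<close>, \<open>t^r\<close>.
\<close>

definition alphabet_ratio :: "nat \<Rightarrow> nat \<Rightarrow> nat \<Rightarrow> qt_field" where
  "alphabet_ratio n r i = qq ^ r * (1 - (qq ^ r) ^ (n - Suc i) * tt ^ r) / (1 - (qq ^ r) ^ (n - i) * tt ^ r)"

lemma plethystic_power_sum_rec:
  assumes r: "r \<ge> 1" and i: "i \<in> {1..n}"
  shows "plethystic_power_sum n (i, r) = power_sum (alphabets {i}) r +
    (if i < n then scale_series (alphabet_ratio n r i) (plethystic_power_sum n (i + 1, r)) else 0)"
proof -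
  have single: "(\<Sum>j=1..n. scale_series (if j = i then c else 0) (f j)) = scale_series c (f i)" for c and f :: "nat \<Rightarrow> msf"
  proof -
    have "(\<Sum>j=1..n. scale_series (if j = i then c else 0) (f j)) = (\<Sum>j=1..n. if j = i then scale_series c (f j) else 0)"
      by (intro sum.cong) auto
    then show ?thesis using i by simp
  qed
  show ?thesis
  proof (cases "i = n")
    case True
    have "qt_power r (if j = n then 1 else 0) = (if j = n then 1 else 0)" for j
      by (simp add: qt_power_0[OF r] qt_power_1[OF r])
    then show ?thesis using single[of 1 "\<lambda>j. power_sum (alphabets {j}) r"] True
      by (simp add: plethystic_power_sum_def power_sum_plethysm_def)
  next
    case False
    then have lt: "i < n" using i by simp
    then obtain k where k: "n - i = Suc k" by (cases "n - i") auto
    then have k': "n - Suc i = k" "n - Suc k = i" using lt by simp_all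
    have c: "qt_power r (qq * (1 - qq ^ k * tt) / (1 - qq ^ Suc k * tt)) = alphabet_ratio n r i"
      unfolding alphabet_ratio_def k k'
      by (simp only: qt_power_divide[OF r] qt_power_mult[OF r] qt_power_diff[OF r] qt_power_1[OF r]
          qt_power_power[OF r] qt_power_qq[OF r] qt_power_tt[OF r])
    have one: "qt_power r (if j = i then 1 else 0) = (if j = i then 1 else 0)" for j
      by (simp add: qt_power_0[OF r] qt_power_1[OF r])
    have "qt_power r (alphabet_A n (Suc k) j) = (if j = i then 1 else 0) + alphabet_ratio n r i * qt_power r (alphabet_A n k j)" for j
      by (simp only: alphabet_A.simps k'(2) qt_power_add[OF r] qt_power_mult[OF r] c one)
    then have "plethystic_power_sum n (i, r) =
        (\<Sum>j=1..n. scale_series (if j = i then 1 else 0) (power_sum (alphabets {j}) r)) +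
        (\<Sum>j=1..n. scale_series (alphabet_ratio n r i) (scale_series (qt_power r (alphabet_A n k j)) (power_sum (alphabets {j}) r)))"
      by (simp add: plethystic_power_sum_def power_sum_plethysm_def k series.scale_left_distrib sum.distrib del: alphabet_A.simps)
    then show ?thesis using lt
      by (simp only: single if_True series.scale_sum_right[symmetric])
        (simp add: plethystic_power_sum_def power_sum_plethysm_def k')
  qed
qed

lemma power_sum_Un:
  assumes "r \<ge> 1" "U \<inter> V = {}"
  shows "power_sum (U \<union> V) r = power_sum U r + power_sum V r"
proof (rule series_eqI)
  fix M
  have "\<not> ((\<exists>x\<in>U. M = replicate_mset r x) \<and> (\<exists>x\<in>V. M = replicate_mset r x))"
  proof
    assume "(\<exists>x\<in>U. M = replicate_mset r x) \<and> (\<exists>x\<in>V. M = replicate_mset r x)"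
    then obtain x y where xy: "x \<in> U" "M = replicate_mset r x" "y \<in> V" "M = replicate_mset r y" by blast
    have "set_mset (replicate_mset r x) = {x}" "set_mset (replicate_mset r y) = {y}"
      using assms(1) by (simp_all add: set_mset_replicate_mset_subset)
    then have "{x} = {y}" using xy(2,4) by metis
    then show False using xy assms(2) by auto
  qed
  then show "coeff_series (power_sum (U \<union> V) r) M = coeff_series (power_sum U r + power_sum V r) M"
    by (auto simp: power_sum_def)
qed

text \<open>
  The empty alphabet, by which the first alphabet is a difference of cumulative ones like all others.
\<close>

lemma cumulative_power_sum_0: "cumulative_power_sum a (0, r) = 0"
  by (rule series_eqI) (simp add: cumulative_power_sum_def power_sum_def)

lemma power_sum_alphabet:
  assumes "r \<ge> 1" "i \<ge> 1"
  shows "power_sum (alphabets {i}) r = (cumulative_power_sum fst (i, r) - cumulative_power_sum fst (i - 1, r) :: msf)"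
proof -
  have set: "{v :: nat \<times> nat. fst v \<in> {1..i}} = alphabets {i} \<union> {v. fst v \<in> {1..i - 1}}"
    using assms(2) by auto
  have disj: "alphabets {i} \<inter> {v. fst v \<in> {1..i - 1}} = {}" using assms(2) by auto
  show ?thesis
    unfolding cumulative_power_sum_def fst_conv snd_conv set power_sum_Un[OF assms(1) disj] by simp
qed

lemma (in gaussian_form) span_form_zero:
  assumes "X \<subseteq> W" "Y \<subseteq> W" "\<And>x y. x \<in> X \<Longrightarrow> y \<in> Y \<Longrightarrow> B x y = 0"
    "f \<in> series.span X" "g \<in> series.span Y"
  shows "B f g = 0"
proof -
  have *: "B f h = 0" if "X \<subseteq> W" "f \<in> series.span X" "\<And>x. x \<in> X \<Longrightarrow> B x h = 0" for X f h
  proof -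
    from that(2) have "f \<in> W \<and> B f h = 0"
    proof (induction rule: series.span_induct_alt)
      case (step c x y)
      then show ?case using that
        by (auto simp: add scale series.span_add series.span_scale subset_iff)
    qed (simp add: zero series.span_zero)
    then show ?thesis ..
  qed
  have "B x g = 0" if x: "x \<in> X" for x
    unfolding commute[of x]
  proof (rule *[OF assms(2,5)])
    fix y assume "y \<in> Y"
    then show "B y x = 0" using assms(3)[OF x] commute[of y x] by simp
  qed
  then show ?thesis using *[OF assms(1,4)] by blast
qed

text \<open>
  Up to a power of \<open>q\<close> this is the squared norm of \<open>p_r\<close> for the Macdonald form with the parameters
  of the \<open>i\<close>-th factor.
\<close>

definition plethystic_norm :: "nat \<Rightarrow> nat \<times> nat \<Rightarrow> qt_field" where
  "plethystic_norm n y = of_nat (snd y) * (qq ^ (snd y * (n - fst y)) *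
     ((1 - param_q n (fst y) ^ snd y) / (1 - param_t n (fst y) ^ snd y)))"

context
  fixes n :: nat
  assumes n: "n \<ge> 1"
begin

interpretation G: gaussian_form "{1..n} \<times> {1..}" "cumulative_power_sum fst" "multi_form n" "cumulative_norm n"
  by (rule gaussian_form_multi[OF n])

lemma plethystic_power_sum_span:
  assumes "i \<in> {1..n}" "r \<ge> 1"
  shows "plethystic_power_sum n (i, r) \<in> series.span (cumulative_power_sum fst ` ({1..n} \<times> {r}))"
  using assms(1)
proof (induction "n - i" arbitrary: i)
  have S: "cumulative_power_sum fst (j, r) \<in> series.span (cumulative_power_sum fst ` ({1..n} \<times> {r}) :: msf set)" if "j \<le> n" for j
    using that by (cases "j = 0") (auto simp: cumulative_power_sum_0 series.span_zero intro!: series.span_base)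
  { case 0
    then have "i = n" by simp
    then show ?case using 0 S[of i] S[of "i - 1"]
      by (simp add: plethystic_power_sum_rec[OF assms(2)] power_sum_alphabet[OF assms(2)] series.span_diff) }
  { case (Suc k)
    then have "plethystic_power_sum n (i + 1, r) \<in> series.span (cumulative_power_sum fst ` ({1..n} \<times> {r}))"
      by (intro Suc.hyps(1)) auto
    then show ?case using Suc S[of i] S[of "i - 1"]
      by (simp add: plethystic_power_sum_rec[OF assms(2)] power_sum_alphabet[OF assms(2)] series.span_diff
          series.span_add series.span_scale) }
qed

lemma plethystic_power_sum_W1:
  assumes "y \<in> {1..n} \<times> {1..}"
  shows "plethystic_power_sum n y \<in> G.W1"
proof -
  have "series.span (cumulative_power_sum fst ` ({1..n} \<times> {snd y})) \<subseteq> G.W1"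
    using assms by (intro series.span_mono) auto
  then show ?thesis using plethystic_power_sum_span[of "fst y" "snd y"] assms by auto
qed

lemma cumulative_power_sum_W:
  assumes "y \<in> {1..n} \<times> {1..}"
  shows "cumulative_power_sum fst y \<in> G.W"
  using assms by (intro G.W1_subset series.span_base) auto

lemma form_cumulative:
  assumes "y \<in> {1..n} \<times> {1..}" "z \<in> {1..n} \<times> {1..}"
  shows "multi_form n (cumulative_power_sum fst y) (cumulative_power_sum fst z) =
    (if y = z then cumulative_norm n y else 0)"
  using G.B_basis[of "{#y#}" "{#z#}"] assms multiset_norm_add_mset[of "cumulative_norm n" y "{#}"] by auto

text \<open>
  Power sums of different degree are combinations of disjoint sets of generators; for equal degree the Gram matrix applies.
\<close>

lemma form_plethystic:
  assumes y: "y \<in> {1..n} \<times> {1..}" and z: "z \<in> {1..n} \<times> {1..}"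
  shows "multi_form n (plethystic_power_sum n y) (plethystic_power_sum n z) =
    (if y = z then plethystic_norm n y else 0)"
proof (cases "snd y = snd z")
  case False
  have "multi_form n (plethystic_power_sum n y) (plethystic_power_sum n z) = 0"
  proof (rule G.span_form_zero)
    show "plethystic_power_sum n y \<in> series.span (cumulative_power_sum fst ` ({1..n} \<times> {snd y}))"
      "plethystic_power_sum n z \<in> series.span (cumulative_power_sum fst ` ({1..n} \<times> {snd z}))"
      using plethystic_power_sum_span[of "fst y" "snd y"] plethystic_power_sum_span[of "fst z" "snd z"] y z by auto
    show "cumulative_power_sum fst ` ({1..n} \<times> {snd y}) \<subseteq> G.W"
      "cumulative_power_sum fst ` ({1..n} \<times> {snd z}) \<subseteq> G.W"
      by (intro image_subsetI cumulative_power_sum_W; use y z in auto)+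
    fix f g assume "f \<in> (cumulative_power_sum fst ` ({1..n} \<times> {snd y}) :: msf set)"
      "g \<in> (cumulative_power_sum fst ` ({1..n} \<times> {snd z}) :: msf set)"
    then obtain i j where "i \<in> {1..n}" "f = cumulative_power_sum fst (i, snd y)"
      "j \<in> {1..n}" "g = cumulative_power_sum fst (j, snd z)" by auto
    then show "multi_form n f g = 0" using form_cumulative[of "(i, snd y)" "(j, snd z)"] False y z by auto
  qed
  then show ?thesis using False by auto
next
  case True
  obtain i j r where yz: "y = (i, r)" "z = (j, r)" using True by (cases y; cases z) auto
  then have ij: "i \<in> {1..n}" "j \<in> {1..n}" and r: "r \<ge> 1" using y z by auto
  let ?S = "\<lambda>i. cumulative_power_sum fst (i, r) :: msf" and ?Y = "\<lambda>i. plethystic_power_sum n (i, r)"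
  define s where "s j i = (if j \<in> {1..n} then multi_form n (?S j) (?Y i) else 0)" for j i
  define b where "b i j = multi_form n (?Y i) (?Y j)" for i j
  have SW: "?S j \<in> G.W" if "j \<le> n" for j
  proof (cases "j = 0")
    case True
    then show ?thesis by (simp add: cumulative_power_sum_0 series.span_zero)
  next
    case False
    then show ?thesis using that r by (intro cumulative_power_sum_W) auto
  qed
  have YW: "?Y j \<in> G.W" if "j \<in> {1..n}" for j
    using that r by (intro G.W1_subset plethystic_power_sum_W1) auto
  have diff: "multi_form n (f - g) h = multi_form n f h - multi_form n g h" if "f \<in> G.W" "g \<in> G.W" for f g h
    using G.add[of "f - g" g h] that by (simp add: series.span_diff)
  have expand: "multi_form n (?Y i) h = multi_form n (?S i) h - multi_form n (?S (i - 1)) h +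
       (if i < n then alphabet_ratio n r i * multi_form n (?Y (i + 1)) h else 0)" if i: "i \<in> {1..n}" for i h
  proof -
    have SS: "?S i \<in> G.W" "?S (i - 1) \<in> G.W" by (intro SW; use i in auto)+
    have X: "power_sum (alphabets {i}) r = ?S i - ?S (i - 1)" using i by (intro power_sum_alphabet[OF r]) auto
    show ?thesis
    proof (cases "i < n")
      case True
      then have "?Y (i + 1) \<in> G.W" by (intro YW) auto
      then show ?thesis
        unfolding plethystic_power_sum_rec[OF r i] X
        using True G.add[OF series.span_diff[OF SS] series.span_scale] diff[OF SS] G.scale by simp
    next
      case False
      then show ?thesis unfolding plethystic_power_sum_rec[OF r i] X using diff[OF SS] by simp
    qed
  qed
  have S0: "multi_form n (?S 0) h = 0" for h by (simp add: cumulative_power_sum_0 G.zero)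
  have Sform: "multi_form n (?S i) (?S j) = (if i = j then cumulative_norm n (i, r) else 0)" if "i \<in> {1..n}" "j \<in> {1..n}" for i j
    using form_cumulative[of "(i, r)" "(j, r)"] that r by auto
  have "b i j = (if i = j then of_nat r * (qq ^ r) ^ (n - i) *
      ((1 - (if i = 1 then qq ^ r else (qq ^ r) ^ (n - i + 1) * tt ^ r)) / (1 - (qq ^ r) ^ (n - i) * tt ^ r)) else 0)"
  proof (rule alphabet_gram_matrix[OF n, where w = "\<lambda>i. cumulative_norm n (i, r)" and c = "alphabet_ratio n r" and s = s])
    show "1 - (qq ^ r) ^ k * tt ^ r \<noteq> 0" for k by (rule one_minus_qt_power_nonzero[OF r])
    show "cumulative_norm n (i, r) = of_nat r * (qq ^ r) ^ (n - i) * (if i = n then (1 - qq ^ r) / (1 - tt ^ r) else 1)" for i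
      by (simp add: cumulative_norm_def power_mult)
    show "alphabet_ratio n r i = qq ^ r * (1 - (qq ^ r) ^ (n - Suc i) * tt ^ r) / (1 - (qq ^ r) ^ (n - i) * tt ^ r)" for i
      by (simp add: alphabet_ratio_def)
    show "b i j = b j i" for i j unfolding b_def by (rule multi_form_commute)
    show "i \<in> {1..n}" "j \<in> {1..n}" by fact+
    show "b i j = s i j - (if i = 1 then 0 else s (i - 1) j) + (if i < n then alphabet_ratio n r i * b (i + 1) j else 0)"
      if "i \<in> {1..n}" "j \<in> {1..n}" for i j
      using expand[OF that(1), of "?Y j"] that S0 by (auto simp: b_def s_def)
    show "s j i = (if j = i then cumulative_norm n (i, r) else 0) - (if j = i - 1 \<and> j \<ge> 1 then cumulative_norm n (j, r) else 0) +
       (if i < n then alphabet_ratio n r i * s j (i + 1) else 0)" if i: "i \<in> {1..n}" for i j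
    proof (cases "j \<in> {1..n}")
      case False
      then show ?thesis using i by (auto simp: s_def)
    next
      case True
      have "multi_form n (?S i) (?S j) = (if j = i then cumulative_norm n (i, r) else 0)"
        using Sform[OF i True] by auto
      moreover have "multi_form n (?S (i - 1)) (?S j) = (if j = i - 1 \<and> j \<ge> 1 then cumulative_norm n (j, r) else 0)"
      proof (cases "i = 1")
        case True
        then show ?thesis using S0 \<open>j \<in> {1..n}\<close> by auto
      next
        case False
        then have "i - 1 \<in> {1..n}" using i by auto
        from Sform[OF this True] True show ?thesis by auto
      qed
      ultimately show ?thesis
        using expand[OF i, of "?S j"] True multi_form_commute[of n "?S j"] by (simp add: s_def)
    qed
  qed
  also have "\<dots> = (if y = z then plethystic_norm n y else 0)"
  proof -
    have p: "param_q n i ^ r = (if i = 1 then qq ^ r else (qq ^ r) ^ (n - i + 1) * tt ^ r)"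
      "param_t n i ^ r = (qq ^ r) ^ (n - i) * tt ^ r"
      by (auto simp: param_q_def param_t_def power_mult_distrib simp flip: power_mult) (simp_all add: mult.commute)
    show ?thesis
      by (simp only: yz plethystic_norm_def fst_conv snd_conv power_mult p prod.inject simp_thms mult.assoc)
  qed
  finally show ?thesis by (simp add: b_def yz)
qed

lemma form_plethystic_products:
  assumes "A \<in> labelled_parts n" "C \<in> labelled_parts n"
  shows "multi_form n (\<Prod>y\<in>#A. plethystic_power_sum n y) (\<Prod>y\<in>#C. plethystic_power_sum n y) =
    (if A = C then multiset_norm (plethystic_norm n) A else 0)"
  using assms by (intro G.orthogonal_products[where K = "{1..n} \<times> {1..}"] plethystic_power_sum_W1 form_plethystic)
    (auto simp: labelled_parts_def)

lemma plethystic_product_in_span: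
  assumes "A \<in> labelled_parts n"
  shows "(\<Prod>y\<in>#A. plethystic_power_sum n y) \<in> series.span (multi_msym n ` multipartitions n)"
proof -
  have "(\<Prod>y\<in>#A. plethystic_power_sum n y) \<in> G.W"
    using assms by (intro G.prod_mset_in plethystic_power_sum_W1) (auto simp: labelled_parts_def)
  then show ?thesis
    unfolding labelled_parts_eq power_product_def[symmetric] multi_psym_image[symmetric] span_multi_psym .
qed

end

section \<open>Orthogonality of the products\<close>

lemma plethysm_eq_specialize: "plethysm n f A = specialize UNIV (power_sum_plethysm n A) f"
  by (simp add: plethysm_def specialize_def extend_linearly_def)

definition psym_support :: "sym \<Rightarrow> nat list set" where
  "psym_support f = {l. is_partition l \<and> coord partitions (psym UNIV) f l \<noteq> 0}"

lemma finite_psym_support: "finite (psym_support f)"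
  unfolding psym_support_def using finite_coord[OF psym_independent[OF infinite_UNIV_nat], of f] by simp

lemma specialize_expand:
  "specialize UNIV Z f = (\<Sum>l\<in>psym_support f. scale_series (coord partitions (psym UNIV) f l) (\<Prod>r\<leftarrow>l. Z r))"
  by (simp add: specialize_def extend_linearly_def psym_support_def)

lemma prod_scale_series: "(\<Prod>i\<in>K. scale_series (c i) (f i)) = scale_series (\<Prod>i\<in>K. c i :: 'a::field) (\<Prod>i\<in>K. f i)"
  by (induction K rule: infinite_finite_induct)
    (simp_all add: scale_series_mult mult_scale_series mult.commute)

lemma prod_mset_parts_of: "(\<Prod>y\<in>#parts_of n L. f y) = (\<Prod>i\<in>{1..n}. \<Prod>r\<leftarrow>L i. f (i, r))"
proof -
  have "(\<Prod>y\<in>#(\<Sum>i\<in>I. image_mset (Pair i) (mset (L i))). f y) = (\<Prod>i\<in>I. \<Prod>r\<leftarrow>L i. f (i, r))" for I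
    by (induction I rule: infinite_finite_induct)
      (simp_all add: image_mset.compositionality comp_def flip: prod_mset_prod_list)
  then show ?thesis by (simp add: parts_of_def)
qed

lemma parts_of_in_labelled_parts:
  assumes "\<And>i. i \<in> {1..n} \<Longrightarrow> is_partition (g i)"
  shows "parts_of n g \<in> labelled_parts n"
proof -
  define g' where "g' i = (if i \<in> {1..n} then g i else [])" for i
  have "parts_of n g = parts_of n g'" unfolding parts_of_def g'_def by (intro sum.cong) auto
  moreover have "g' \<in> multipartitions n"
    using assms by (auto simp: multipartitions_def g'_def is_partition_def[of "[]"])
  ultimately show ?thesis using bij_betw_imp_surj_on[OF parts_of_bij, of n] by auto
qed

lemma parts_of_eq_iff:
  assumes "\<And>i. i \<in> {1..n} \<Longrightarrow> is_partition (g i)" "\<And>i. i \<in> {1..n} \<Longrightarrow> is_partition (h i)"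
  shows "parts_of n g = parts_of n h \<longleftrightarrow> (\<forall>i\<in>{1..n}. g i = h i)"
proof
  assume eq: "parts_of n g = parts_of n h"
  show "\<forall>i\<in>{1..n}. g i = h i"
  proof
    fix i assume i: "i \<in> {1..n}"
    have "mset (g i) = mset (h i)" using parts_at_parts_of[of i n g] parts_at_parts_of[of i n h] eq i by simp
    then show "g i = h i" using assms i partition_eqI by blast
  qed
qed (auto simp: parts_of_def)

text \<open>
  The squared norm of a product of power sums in the Macdonald form with the \<open>i\<close>-th parameters, times
  a power of \<open>q\<close> that depends only on the degree.
\<close>

definition factor_norm :: "nat \<Rightarrow> nat \<Rightarrow> nat list \<Rightarrow> qt_field" where
  "factor_norm n i l = qq ^ ((n - i) * sum_list l) * (of_nat (zee l) *
     (\<Prod>r\<leftarrow>l. (1 - param_q n i ^ r) / (1 - param_t n i ^ r)))"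

lemma multiset_norm_plethystic: "multiset_norm (plethystic_norm n) (parts_of n L) = (\<Prod>i\<in>{1..n}. factor_norm n i (L i))"
  unfolding multiset_norm_parts_of plethystic_norm_def factor_norm_def fst_conv snd_conv multiset_norm_zee
  by (intro prod.cong refl) (simp only: prod_list_times prod_list_power mult_ac)

definition product_series :: "nat \<Rightarrow> (nat \<Rightarrow> sym) \<Rightarrow> msf" where
  "product_series n f = (\<Prod>i=1..n. plethysm n (f i) (alphabet_A n (n - i)))"

lemma product_series_expand:
  "product_series n f = (\<Sum>g\<in>PiE {1..n} (\<lambda>i. psym_support (f i)).
     scale_series (\<Prod>i\<in>{1..n}. coord partitions (psym UNIV) (f i) (g i)) (\<Prod>y\<in>#parts_of n g. plethystic_power_sum n y))"
proof -
  have "product_series n f = (\<Prod>i\<in>{1..n}. \<Sum>l\<in>psym_support (f i).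
      scale_series (coord partitions (psym UNIV) (f i) l) (\<Prod>r\<leftarrow>l. plethystic_power_sum n (i, r)))"
    by (simp add: product_series_def plethysm_eq_specialize specialize_expand plethystic_power_sum_def)
  also have "\<dots> = (\<Sum>g\<in>PiE {1..n} (\<lambda>i. psym_support (f i)). \<Prod>i\<in>{1..n}.
      scale_series (coord partitions (psym UNIV) (f i) (g i)) (\<Prod>r\<leftarrow>g i. plethystic_power_sum n (i, r)))"
    by (rule prod_sum_PiE) (auto simp: finite_psym_support)
  finally show ?thesis by (simp add: prod_scale_series prod_mset_parts_of)
qed

lemma psym_support_PiE:
  assumes "g \<in> PiE {1..n} (\<lambda>i. psym_support (f i))" "i \<in> {1..n}"
  shows "is_partition (g i)"
  using PiE_mem[OF assms] by (simp add: psym_support_def)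

lemma product_series_in_span:
  assumes "n \<ge> 1"
  shows "product_series n f \<in> series.span (multi_msym n ` multipartitions n)"
  unfolding product_series_expand
  by (intro series.span_sum series.span_scale plethystic_product_in_span[OF assms] parts_of_in_labelled_parts)
    (rule psym_support_PiE)

text \<open>
  By the orthogonality of the plethystic power sums the scalar product of two products factorises
  over the alphabets.
\<close>

lemma form_product_series:
  assumes n: "n \<ge> 1"
  shows "multi_form n (product_series n f) (product_series n g) =
    (\<Prod>i\<in>{1..n}. \<Sum>l\<in>psym_support (f i). \<Sum>m\<in>psym_support (g i).
      coord partitions (psym UNIV) (f i) l * coord partitions (psym UNIV) (g i) m * (if l = m then factor_norm n i l else 0))"
proof -
  let ?F = "PiE {1..n} (\<lambda>i. psym_support (f i))" and ?G = "PiE {1..n} (\<lambda>i. psym_support (g i))"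
  let ?c = "\<lambda>f h. \<Prod>i\<in>{1..n}. coord partitions (psym UNIV) (f i) (h i)"
  let ?Y = "\<lambda>h. \<Prod>y\<in>#parts_of n h. plethystic_power_sum n y"
  have YW: "?Y h \<in> series.span (multi_msym n ` multipartitions n)" if "h \<in> PiE {1..n} (\<lambda>i. psym_support (f i))" for h f
    using that by (intro plethystic_product_in_span[OF n] parts_of_in_labelled_parts) (rule psym_support_PiE)
  have "multi_form n (product_series n f) (product_series n g) = (\<Sum>h\<in>?F. ?c f h * multi_form n (?Y h) (product_series n g))"
    unfolding product_series_expand[of n f]
    by (rule symmetric_form_sum_left[OF multi_form_add multi_form_scale YW])
  also have "\<dots> = (\<Sum>h\<in>?F. ?c f h * (\<Sum>k\<in>?G. ?c g k * multi_form n (?Y k) (?Y h)))"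
  proof -
    have "multi_form n (product_series n g) F = (\<Sum>k\<in>?G. ?c g k * multi_form n (?Y k) F)" for F
      unfolding product_series_expand[of n g]
      by (rule symmetric_form_sum_left[OF multi_form_add multi_form_scale YW])
    then show ?thesis by (simp only: multi_form_commute[of n _ "product_series n g"])
  qed
  also have "\<dots> = (\<Sum>h\<in>?F. \<Sum>k\<in>?G. \<Prod>i\<in>{1..n}. coord partitions (psym UNIV) (f i) (h i) *
      coord partitions (psym UNIV) (g i) (k i) * (if h i = k i then factor_norm n i (h i) else 0))"
    unfolding sum_distrib_left
  proof (intro sum.cong refl)
    fix h k assume hk: "h \<in> ?F" "k \<in> ?G"
    note p = psym_support_PiE[OF hk(1)] psym_support_PiE[OF hk(2)]
    have "multi_form n (?Y k) (?Y h) = (if parts_of n k = parts_of n h then multiset_norm (plethystic_norm n) (parts_of n k) else 0)"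
      using p by (intro form_plethystic_products[OF n] parts_of_in_labelled_parts)
    also have "\<dots> = (\<Prod>i\<in>{1..n}. if h i = k i then factor_norm n i (h i) else 0)"
    proof (cases "\<forall>i\<in>{1..n}. k i = h i")
      case True
      then have "parts_of n k = parts_of n h" using parts_of_eq_iff[of n k h] p by blast
      then show ?thesis using True by (simp add: multiset_norm_plethystic)
    next
      case False
      then have "parts_of n k \<noteq> parts_of n h" using parts_of_eq_iff[of n k h] p by blast
      moreover obtain i where "i \<in> {1..n}" "h i \<noteq> k i" using False by fastforce
      then have "(\<Prod>i\<in>{1..n}. if h i = k i then factor_norm n i (h i) else 0) = 0"
        by (intro prod_zero bexI[of _ i]) auto
      ultimately show ?thesis by simp
    qed
    finally show "?c f h * (?c g k * multi_form n (?Y k) (?Y h)) = (\<Prod>i\<in>{1..n}. coord partitions (psym UNIV) (f i) (h i) *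
      coord partitions (psym UNIV) (g i) (k i) * (if h i = k i then factor_norm n i (h i) else 0))"
      by (simp only: prod.distrib mult.assoc)
  qed
  also have "\<dots> = (\<Sum>h\<in>?F. \<Prod>i\<in>{1..n}. \<Sum>m\<in>psym_support (g i). coord partitions (psym UNIV) (f i) (h i) *
      coord partitions (psym UNIV) (g i) m * (if h i = m then factor_norm n i (h i) else 0))"
    by (intro sum.cong refl prod_sum_PiE[symmetric]) (auto simp: finite_psym_support)
  also have "\<dots> = (\<Prod>i\<in>{1..n}. \<Sum>l\<in>psym_support (f i). \<Sum>m\<in>psym_support (g i).
      coord partitions (psym UNIV) (f i) l * coord partitions (psym UNIV) (g i) m * (if l = m then factor_norm n i l else 0))"
    by (intro prod_sum_PiE[symmetric]) (auto simp: finite_psym_support)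
  finally show ?thesis .
qed

lemma macdonald_form_eq:
  "macdonald_form Q T f g = (\<Sum>l\<in>psym_support f. \<Sum>m\<in>psym_support g.
     coord partitions (psym UNIV) f l * coord partitions (psym UNIV) g m *
     (if l = m then of_nat (zee l) * (\<Prod>r\<leftarrow>l. (1 - Q ^ r) / (1 - T ^ r)) else 0))"
  by (simp add: macdonald_form_def bilinear_form_def psym_support_def)

section \<open>Monomials of a single factor\<close>

lemma size_eq_sum_mset_counts: "size K = \<Sum>\<^sub># (image_mset (count K) (mset_set (set_mset K)))"
  by (simp add: size_multiset_overloaded_eq flip: sum_unfold_sum_mset)

context
  fixes Q T :: qt_field and P :: "nat list \<Rightarrow> sym" and \<kappa> :: "nat list"
  assumes P: "macdonald_basis Q T P" and part: "is_partition \<kappa>"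
begin

lemma macdonald_diff:
  "P \<kappa> - msym UNIV \<kappa> \<in> series.span (msym UNIV ` {\<mu>. is_partition \<mu> \<and> dominance \<mu> \<kappa> \<and> \<mu> \<noteq> \<kappa>})"
  using P part by (auto simp: macdonald_basis_def unitriangular_orthogonal_basis_def)

lemma macdonald_in_span: "P \<kappa> \<in> series.span (msym UNIV ` {\<mu>. is_partition \<mu> \<and> dominance \<mu> \<kappa>})"
proof -
  have "P \<kappa> = (P \<kappa> - msym UNIV \<kappa>) + msym UNIV \<kappa>" by simp
  also have "\<dots> \<in> series.span (msym UNIV ` {\<mu>. is_partition \<mu> \<and> dominance \<mu> \<kappa>})"
  proof (rule series.span_add)
    show "P \<kappa> - msym UNIV \<kappa> \<in> series.span (msym UNIV ` {\<mu>. is_partition \<mu> \<and> dominance \<mu> \<kappa>})"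
      by (rule subsetD[OF series.span_mono macdonald_diff]) auto
    show "msym UNIV \<kappa> \<in> series.span (msym UNIV ` {\<mu>. is_partition \<mu> \<and> dominance \<mu> \<kappa>})"
      using part by (intro series.span_base) (auto simp: dominance_def)
  qed
  finally show ?thesis .
qed

lemma macdonald_in_psym_span: "P \<kappa> \<in> series.span (psym UNIV ` {l. is_partition l \<and> sum_list l = sum_list \<kappa>})"
proof -
  have "P \<kappa> \<in> series.span (msym UNIV ` {l. is_partition l \<and> sum_list l = sum_list \<kappa>})"
    by (rule subsetD[OF series.span_mono macdonald_in_span]) (auto simp: dominance_def)
  also have "series.span (msym UNIV ` {l. is_partition l \<and> sum_list l = sum_list \<kappa>} :: sym set) =
      series.span (psym UNIV ` {l. is_partition l \<and> sum_list l = sum_list \<kappa>})"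
    by (rule span_psym[symmetric]) auto
  finally show ?thesis .
qed

lemma macdonald_in_sym: "P \<kappa> \<in> series.span (psym UNIV ` partitions)"
  by (rule subsetD[OF series.span_mono macdonald_in_psym_span]) auto

text \<open>
  Each Macdonald polynomial is homogeneous, and the change of basis from monomial functions to power
  sums respects the degree.
\<close>

lemma macdonald_support_weight: "l \<in> psym_support (P \<kappa>) \<Longrightarrow> sum_list l = sum_list \<kappa>"
  using coord_outside[OF psym_independent[OF infinite_UNIV_nat] _ macdonald_in_psym_span, of l]
  by (auto simp: psym_support_def)

lemma macdonald_coeff_nonzero:
  assumes "coeff_series (P \<kappa>) K \<noteq> 0"
  shows "\<exists>\<mu>. is_partition \<mu> \<and> dominance \<mu> \<kappa> \<and> image_mset (count K) (mset_set (set_mset K)) = mset \<mu>"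
proof (rule ccontr)
  assume *: "\<not> ?thesis"
  from macdonald_in_span have "coeff_series (P \<kappa>) K = 0"
  proof (induction rule: series.span_induct_alt)
    case (step c x y)
    then obtain \<mu> where \<mu>: "is_partition \<mu>" "dominance \<mu> \<kappa>" "x = msym UNIV \<mu>" by auto
    then have "coeff_series x K = 0" using * by (auto simp: coeff_msym)
    then show ?case using step by simp
  qed simp
  with assms show False by simp
qed

lemma macdonald_coeff_leading:
  assumes "image_mset (count K) (mset_set (set_mset K)) = mset \<kappa>"
  shows "coeff_series (P \<kappa>) K = 1"
proof -
  from macdonald_diff have "coeff_series (P \<kappa> - msym UNIV \<kappa>) K = 0"
  proof (induction rule: series.span_induct_alt)
    case (step c x y)
    then obtain \<mu> where \<mu>: "is_partition \<mu>" "\<mu> \<noteq> \<kappa>" "x = msym UNIV \<mu>" by auto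
    then have "mset \<mu> \<noteq> mset \<kappa>" using part partition_eqI by blast
    then have "coeff_series x K = 0" using assms by (auto simp: coeff_msym \<mu>(3))
    then show ?case using step by simp
  qed simp
  moreover have "coeff_series (msym UNIV \<kappa> :: sym) K = 1" using assms by (simp add: coeff_msym)
  ultimately show ?thesis by simp
qed

lemma macdonald_homogeneous: "coeff_series (P \<kappa>) K \<noteq> 0 \<Longrightarrow> size K = sum_list \<kappa>"
  using macdonald_coeff_nonzero[of K] size_eq_sum_mset_counts[of K]
  by (auto simp: dominance_def sum_mset_sum_list)

lemma macdonald_letters_bound:
  assumes "coeff_series (P \<kappa>) K \<noteq> 0" "finite U"
  shows "size {#v \<in># K. v \<in> U#} \<le> sum_list (take (card U) \<kappa>)"
proof -
  obtain \<mu> where \<mu>: "is_partition \<mu>" "dominance \<mu> \<kappa>" "image_mset (count K) (mset_set (set_mset K)) = mset \<mu>"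
    using macdonald_coeff_nonzero[OF assms(1)] by blast
  let ?X = "image_mset (count K) (mset_set {v \<in> set_mset K. v \<in> U})"
  have "?X \<subseteq># mset \<mu>"
    unfolding \<mu>(3)[symmetric] by (intro image_mset_subseteq_mono subset_imp_msubset_mset_set) auto
  moreover have "size ?X \<le> card U" using assms(2) by (auto intro: card_mono)
  ultimately have "\<Sum>\<^sub># ?X \<le> sum_list (take (card U) \<mu>)"
    using \<mu>(1) by (intro sum_submultiset_le_take) (auto simp: is_partition_def)
  also have "\<dots> \<le> sum_list (take (card U) \<kappa>)" using \<mu>(2) by (simp add: dominance_def)
  finally show ?thesis
    using size_filter_eq_weight[of "\<lambda>v. v \<in> U" K id]
    by (simp add: weight_def image_mset.compositionality comp_def)
qed

end

section \<open>Triangularity of the products\<close>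

lemma coeff_power_sum_nonzero:
  "coeff_series (power_sum V r) M \<noteq> 0 \<Longrightarrow> \<exists>x\<in>V. M = replicate_mset r x"
  by (auto simp: power_sum_def split: if_splits)

lemma coeff_power_sum_alphabet_nonzero:
  "r \<ge> 1 \<Longrightarrow> coeff_series (power_sum (alphabets {i}) r) M \<noteq> 0 \<Longrightarrow> size M = r \<and> fst ` set_mset M \<subseteq> {i}"
  by (auto dest!: coeff_power_sum_nonzero)

lemma plethystic_power_sum_support:
  assumes r: "r \<ge> 1" and i: "i \<in> {1..n}" and "coeff_series (plethystic_power_sum n (i, r)) M \<noteq> 0"
  shows "size M = r \<and> fst ` set_mset M \<subseteq> {i..n}"
  using i assms(3)
proof (induction "n - i" arbitrary: i)
  case 0
  then have "coeff_series (power_sum (alphabets {i}) r :: msf) M \<noteq> 0"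
    by (simp add: plethystic_power_sum_rec[OF r])
  from coeff_power_sum_alphabet_nonzero[OF r this] show ?case using 0 by auto
next
  case (Suc k)
  then have lt: "i < n" by simp
  show ?case
  proof (cases "coeff_series (power_sum (alphabets {i}) r :: msf) M = 0")
    case True
    then have "coeff_series (plethystic_power_sum n (i + 1, r)) M \<noteq> 0"
      using Suc.prems(2) lt by (auto simp: plethystic_power_sum_rec[OF r Suc.prems(1)])
    then have "size M = r \<and> fst ` set_mset M \<subseteq> {i + 1..n}"
      using Suc.hyps(2) lt by (intro Suc.hyps(1)) auto
    then show ?thesis by force
  next
    case False
    from coeff_power_sum_alphabet_nonzero[OF r this] show ?thesis using lt by auto
  qed
qed

text \<open>
  The virtual alphabet \<open>A_(n - i)\<close> consists of the letters of the \<open>i\<close>-th alphabet, with coefficient 1,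
  and of multiples of later alphabets.
\<close>

lemma plethystic_power_sum_later_letters:
  assumes r: "r \<ge> 1" and i: "i \<in> {1..n}"
    and "coeff_series (plethystic_power_sum n (i, r) - power_sum (alphabets {i}) r) M \<noteq> 0"
  shows "fst ` set_mset M \<subseteq> {i + 1..n}"
proof -
  have "i < n \<and> coeff_series (plethystic_power_sum n (i + 1, r)) M \<noteq> 0"
    using assms(3) by (auto simp: plethystic_power_sum_rec[OF r i] split: if_splits)
  then show ?thesis using plethystic_power_sum_support[OF r, of "i + 1" n M] by auto
qed

lemma plethystic_product_support:
  assumes i: "i \<in> {1..n}" and "0 \<notin> set l" "coeff_series (\<Prod>r\<leftarrow>l. plethystic_power_sum n (i, r)) M \<noteq> 0"
  shows "size M = sum_list l \<and> fst ` set_mset M \<subseteq> {i..n}"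
  using assms(2,3)
proof (induction l arbitrary: M)
  case Nil
  then show ?case by (auto simp: coeff_one split: if_splits)
next
  case (Cons r l)
  then have "coeff_series (plethystic_power_sum n (i, r) * (\<Prod>r\<leftarrow>l. plethystic_power_sum n (i, r))) M \<noteq> 0" by simp
  then obtain A B where AB: "M = A + B" "coeff_series (plethystic_power_sum n (i, r)) A \<noteq> 0"
    "coeff_series (\<Prod>r\<leftarrow>l. plethystic_power_sum n (i, r)) B \<noteq> 0"
    by (rule coeff_times_nonzeroE)
  have "r \<ge> 1" using Cons.prems(1) by (auto simp: Suc_le_eq)
  then show ?case
    using plethystic_power_sum_support[OF _ i AB(2)] Cons.IH[OF _ AB(3)] Cons.prems(1) AB(1) by (auto simp: image_Un)
qed

lemma plethysm_factor:
  "plethysm n f (alphabet_A n (n - i)) = specialize UNIV (\<lambda>r. plethystic_power_sum n (i, r)) f"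
  by (simp add: plethysm_eq_specialize plethystic_power_sum_def)

context
  fixes Q T :: qt_field and P :: "nat list \<Rightarrow> sym" and \<kappa> :: "nat list" and n i :: nat
  assumes P: "macdonald_basis Q T P" and part: "is_partition \<kappa>" and i: "i \<in> {1..n}"
begin

lemma factor_support:
  assumes "coeff_series (plethysm n (P \<kappa>) (alphabet_A n (n - i))) M \<noteq> 0"
  shows "size M = sum_list \<kappa>" "fst ` set_mset M \<subseteq> {i..n}"
proof -
  from assms obtain l where l: "l \<in> psym_support (P \<kappa>)"
    "coeff_series (\<Prod>r\<leftarrow>l. plethystic_power_sum n (i, r)) M \<noteq> 0"
    unfolding plethysm_factor specialize_expand coeff_sum coeff_scale
    by (metis (no_types, lifting) mult_zero_right sum.neutral)
  have "0 \<notin> set l" using l(1) by (simp add: psym_support_def is_partition_def)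
  from plethystic_product_support[OF i this l(2)] macdonald_support_weight[OF P part l(1)]
  show "size M = sum_list \<kappa>" "fst ` set_mset M \<subseteq> {i..n}" by simp_all
qed

text \<open>
  The letters \<open>U\<close> of the \<open>i\<close>-th alphabet occur in \<open>A_(n - i)\<close> as genuine letters, so the slice of the
  plethysm is the plethysm of the slice of \<open>P \<kappa>\<close>.
\<close>

lemma factor_slice:
  assumes U: "finite U" "set_mset N \<subseteq> U" "set_mset R \<inter> Pair i ` U = {}"
  shows "coeff_series (plethysm n (P \<kappa>) (alphabet_A n (n - i))) (image_mset (Pair i) N + R) =
    coeff_series (specialize (UNIV - U) (\<lambda>r. plethystic_power_sum n (i, r) - power_sum (Pair i ` U) r) (slice U N (P \<kappa>))) R"
proof -
  let ?Z = "\<lambda>r. plethystic_power_sum n (i, r) - power_sum (Pair i ` U) r"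
  have Z: "set_mset M \<inter> Pair i ` U = {}" if r: "r \<ge> 1" and ne: "coeff_series (?Z r) M \<noteq> 0" for r M
  proof -
    have "alphabets {i} = Pair i ` U \<union> Pair i ` (- U)" by auto
    moreover have "Pair i ` U \<inter> Pair i ` (- U) = {}" by auto
    ultimately have X: "power_sum (alphabets {i}) r = (power_sum (Pair i ` U) r + power_sum (Pair i ` (- U)) r :: msf)"
      using power_sum_Un[OF r] by metis
    show ?thesis
    proof (cases "coeff_series (power_sum (Pair i ` (- U)) r :: msf) M = 0")
      case True
      then have "coeff_series (plethystic_power_sum n (i, r) - power_sum (alphabets {i}) r) M \<noteq> 0"
        using ne by (simp add: X)
      from plethystic_power_sum_later_letters[OF r i this] show ?thesis by force
    next
      case False
      from coeff_power_sum_nonzero[OF this] show ?thesis by (auto split: if_splits)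
    qed
  qed
  have "coeff_series (specialize UNIV (\<lambda>r. power_sum (Pair i ` U) r + ?Z r) (P \<kappa>)) (image_mset (Pair i) N + R) =
    coeff_series (specialize (UNIV - U) ?Z (slice U N (P \<kappa>))) R"
    using Z by (intro coeff_specialize_slice[OF infinite_UNIV_nat U(1) subset_UNIV _ _ macdonald_in_sym[OF P part] U(2,3)])
      (auto simp: inj_def)
  then show ?thesis by (simp add: plethysm_factor)
qed

text \<open>
  If a monomial occurs in the plethysm, the slice of \<open>P \<kappa>\<close> at its part in the letters \<open>U\<close> is nonzero.
  Hence some monomial of \<open>P \<kappa>\<close> itself has the same part in these letters, and the exponents of such a
  monomial are dominated by \<open>\<kappa>\<close>.
\<close>

lemma factor_letters_bound:
  assumes M: "coeff_series (plethysm n (P \<kappa>) (alphabet_A n (n - i))) M \<noteq> 0"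
    and U: "finite U" "U \<subseteq> {v. fst v = i}"
  shows "size {#v \<in># M. v \<in> U#} \<le> sum_list (take (card U) \<kappa>)"
proof -
  let ?U = "snd ` U" and ?N = "image_mset snd {#v \<in># M. v \<in> U#}" and ?R = "{#v \<in># M. v \<notin> U#}"
  have PU: "Pair i ` ?U = U" using U(2) by force
  have "image_mset (Pair i) ?N = {#v \<in># M. v \<in> U#}"
    unfolding image_mset.compositionality using U(2) by (intro trans[OF image_mset_cong multiset.map_ident]) auto
  then have split: "M = image_mset (Pair i) ?N + ?R" by (metis multiset_partition)
  let ?S = "slice ?U ?N (P \<kappa>)"
  let ?Z = "\<lambda>r. plethystic_power_sum n (i, r) - power_sum (Pair i ` ?U) r"
  have "finite ?U" "set_mset ?N \<subseteq> ?U" using U(1) by auto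
  moreover have "set_mset ?R \<inter> Pair i ` ?U = {}" unfolding PU by auto
  ultimately have "coeff_series (specialize (UNIV - ?U) ?Z ?S) ?R \<noteq> 0"
    using M factor_slice[of ?U ?N ?R] unfolding split[symmetric] by metis
  moreover have "infinite (UNIV - ?U)" using U(1) by simp
  ultimately have "?S \<noteq> 0" using specialize_zero[of "UNIV - ?U" ?Z] by fastforce
  then obtain K where "coeff_series ?S K \<noteq> 0"
    by (metis coeff_zero series_eqI)
  then have K: "set_mset K \<inter> ?U = {}" "coeff_series (P \<kappa>) (?N + K) \<noteq> 0"
    by (auto simp: coeff_slice split: if_splits)
  have "size {#v \<in># M. v \<in> U#} = size ?N" by simp
  also have "?N = {#v \<in># ?N. v \<in> ?U#}" by (rule sym, subst filter_mset_eq_conv) auto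
  also have "size \<dots> \<le> size {#v \<in># ?N + K. v \<in> ?U#}" by simp
  also have "\<dots> \<le> sum_list (take (card ?U) \<kappa>)"
    by (rule macdonald_letters_bound[OF P part K(2)]) (use U in simp)
  also have "card ?U = card U" using U(2) by (intro card_image) (auto simp: inj_on_def prod_eq_iff)
  finally show ?thesis .
qed

text \<open>
  For degree reasons the slice at a monomial of full degree is the constant 1, and a constant is not
  changed by the specialisation of the remaining letters.
\<close>

lemma factor_leading:
  assumes M: "fst ` set_mset M \<subseteq> {i}" "image_mset (count M) (mset_set (set_mset M)) = mset \<kappa>"
  shows "coeff_series (plethysm n (P \<kappa>) (alphabet_A n (n - i))) M = 1"
proof -
  let ?U = "snd ` set_mset M" and ?N = "image_mset snd M"
  have MN: "image_mset (Pair i) ?N = M"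
    unfolding image_mset.compositionality using M(1) by (intro trans[OF image_mset_cong multiset.map_ident]) auto
  have inj: "inj (Pair i)" by (simp add: inj_def)
  have "mset_set (set_mset M) = image_mset (Pair i) (mset_set (set_mset ?N))"
    by (subst MN[symmetric]) (simp add: image_mset_mset_set inj_on_def del: MN)
  then have "image_mset (count M) (mset_set (set_mset M)) = image_mset (\<lambda>v. count M (i, v)) (mset_set (set_mset ?N))"
    by (simp add: image_mset.compositionality comp_def)
  also have "(\<lambda>v. count M (i, v)) = count ?N"
    using count_image_mset_inj[OF inj, of ?N] MN by simp
  finally have N: "image_mset (count ?N) (mset_set (set_mset ?N)) = mset \<kappa>" using M(2) by simp
  have lead: "coeff_series (P \<kappa>) ?N = 1" by (rule macdonald_coeff_leading[OF P part N])
  have size: "size ?N = sum_list \<kappa>" by (rule macdonald_homogeneous[OF P part]) (simp add: lead)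
  have "slice ?U ?N (P \<kappa>) = 1"
  proof (rule series_eqI)
    fix K
    show "coeff_series (slice ?U ?N (P \<kappa>)) K = coeff_series 1 K"
    proof (cases "K = {#}")
      case True
      then show ?thesis by (simp add: coeff_slice coeff_one lead)
    next
      case False
      then have "size (?N + K) \<noteq> sum_list \<kappa>" using size by simp
      then have "coeff_series (P \<kappa>) (?N + K) = 0" using macdonald_homogeneous[OF P part] by blast
      then show ?thesis using False by (simp add: coeff_slice coeff_one)
    qed
  qed
  moreover have "infinite (UNIV - ?U)" by simp
  then have "specialize (UNIV - ?U) Z (psym (UNIV - ?U) []) = (1 :: msf)" for Z
    using specialize_psym[of "UNIV - ?U" "[]" Z] by simp
  ultimately show ?thesis
    using factor_slice[of ?U ?N "{#}"] MN by (simp add: psym_def coeff_one)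
qed

end

lemma coeff_prod_nonzeroE:
  assumes "finite K" "coeff_series (\<Prod>i\<in>K. f i) M \<noteq> 0"
  shows "\<exists>m. M = (\<Sum>i\<in>K. m i) \<and> (\<forall>i\<in>K. coeff_series (f i) (m i) \<noteq> 0)"
  using assms
proof (induction K arbitrary: M)
  case empty then show ?case by (auto simp: coeff_one split: if_splits)
next
  case (insert j K)
  then have "coeff_series (f j * (\<Prod>i\<in>K. f i)) M \<noteq> 0" by simp
  then obtain A B where AB: "M = A + B" "coeff_series (f j) A \<noteq> 0" "coeff_series (\<Prod>i\<in>K. f i) B \<noteq> 0"
    by (rule coeff_times_nonzeroE)
  obtain m where m: "B = (\<Sum>i\<in>K. m i)" "\<forall>i\<in>K. coeff_series (f i) (m i) \<noteq> 0"
    using insert.IH[OF AB(3)] by blast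
  have "(\<Sum>i\<in>K. (m(j := A)) i) = (\<Sum>i\<in>K. m i)"
    using insert.hyps by (intro sum.cong) auto
  then show ?case using AB m insert.hyps by (intro exI[of _ "m(j := A)"]) auto
qed

lemma filter_mset_sum: "{#v \<in># (\<Sum>i\<in>K. m i). Q v#} = (\<Sum>i\<in>K. {#v \<in># m i. Q v#})"
  by (induction K rule: infinite_finite_induct) auto

lemma size_sum: "size (\<Sum>i\<in>K. m i :: 'b multiset) = (\<Sum>i\<in>K. size (m i))"
  by (induction K rule: infinite_finite_induct) auto

context
  fixes n :: nat and R :: "nat \<Rightarrow> nat list \<Rightarrow> sym" and q' t' :: "nat \<Rightarrow> qt_field"
  assumes n: "n \<ge> 1" and R: "\<And>i. i \<in> {1..n} \<Longrightarrow> macdonald_basis (q' i) (t' i) (R i)"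
begin

text \<open>
  A letter of the \<open>k\<close>-th alphabet can come from any factor \<open>i \<le> k\<close>. The factors with \<open>i < k\<close>
  contribute at most their degree to a partial sum, the \<open>k\<close>-th factor at most a partial sum of its
  partition, and the later factors nothing.
\<close>

lemma product_series_dominance:
  assumes L: "L \<in> multipartitions n" and M: "coeff_series (product_series n (\<lambda>i. R i (L i))) M \<noteq> 0"
  shows "parts_le n (exponents fst M) (parts_of n L)"
proof (rule parts_leI_letters)
  fix k :: nat and U :: "(nat \<times> nat) set" assume k: "k \<in> {1..n}" and U: "finite U" "U \<subseteq> {v. fst v = k}"
  let ?F = "\<lambda>i. plethysm n (R i (L i)) (alphabet_A n (n - i))"
  have part: "is_partition (L i)" for i using L by (simp add: multipartitions_def)
  obtain m where m: "M = (\<Sum>i\<in>{1..n}. m i)" "\<forall>i\<in>{1..n}. coeff_series (?F i) (m i) \<noteq> 0"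
    using coeff_prod_nonzeroE[OF _ M[unfolded product_series_def]] by auto
  note supp = factor_support[OF R part _ m(2)[rule_format]]
  have bound: "size {#v \<in># m i. fst v < k \<or> v \<in> U#} \<le>
      (if i < k then sum_list (L i) else if i = k then sum_list (take (card U) (L k)) else 0)" if i: "i \<in> {1..n}" for i
  proof -
    consider "i < k" | "i = k" | "i > k" by linarith
    then show ?thesis
    proof cases
      case 1
      have "size {#v \<in># m i. fst v < k \<or> v \<in> U#} \<le> size (m i)" by (rule size_filter_mset_lesseq)
      then show ?thesis using 1 supp(1)[OF i i i] by simp
    next
      case 2
      have "{#v \<in># m i. fst v < k \<or> v \<in> U#} = {#v \<in># m i. v \<in> U#}"
        using supp(2)[OF i i i] 2 by (intro filter_mset_cong) auto
      then show ?thesis using 2 factor_letters_bound[OF R[OF i] part i m(2)[rule_format, OF i] U(1)] U(2) by simp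
    next
      case 3
      have e: "{#v \<in># m i. fst v < k \<or> v \<in> U#} = {#}"
        unfolding filter_mset_eq_mempty_iff using supp(2)[OF i i i] 3 U(2) by force
      show ?thesis unfolding e by simp
    qed
  qed
  obtain B where B: "B \<subseteq># parts_of n L" "\<forall>y\<in>#B. fst y \<le> k" "size {#y \<in># B. fst y = k#} \<le> card U"
    "weight B = (\<Sum>i\<in>{1..<k}. sum_list (L i)) + sum_list (take (card U) (L k))"
    using ex_submultiset_weight_eq[OF k] by blast
  have "size {#v \<in># M. fst v < k \<or> v \<in> U#} = (\<Sum>i\<in>{1..n}. size {#v \<in># m i. fst v < k \<or> v \<in> U#})"
    unfolding m(1) filter_mset_sum size_sum ..
  also have "\<dots> \<le> (\<Sum>i\<in>{1..n}. if i < k then sum_list (L i) else if i = k then sum_list (take (card U) (L k)) else 0)"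
    by (intro sum_mono bound)
  also have "\<dots> = (\<Sum>i\<in>insert k {1..<k}. if i < k then sum_list (L i) else if i = k then sum_list (take (card U) (L k)) else 0)"
    using k by (intro sum.mono_neutral_right) auto
  also have "\<dots> = weight B" using B(4) by simp
  finally show "\<exists>B. B \<subseteq># parts_of n L \<and> (\<forall>y\<in>#B. fst y \<le> k) \<and> size {#y \<in># B. fst y = k#} \<le> card U \<and>
      size {#v \<in># M. fst v < k \<or> v \<in> U#} \<le> weight B"
    using B by blast
qed

text \<open>
  The first alphabet occurs in the first factor only, so this factor has to supply all of the degree
  in it and has no degree left for later alphabets; the same argument applies to the remaining
  factors one after the other. Thus a single factorisation of the monomial contributes.
\<close>

lemma product_series_leading:
  assumes L: "L \<in> multipartitions n" and M: "exponents fst M = parts_of n L"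
  shows "coeff_series (product_series n (\<lambda>i. R i (L i))) M = 1"
proof -
  let ?F = "\<lambda>i. plethysm n (R i (L i)) (alphabet_A n (n - i))"
  have part: "is_partition (L i)" for i using L by (simp add: multipartitions_def)
  have at: "image_mset (count {#v \<in># M. fst v = i#}) (mset_set (set_mset {#v \<in># M. fst v = i#})) = mset (L i)"
    if "i \<in> {1..n}" for i
  proof -
    have "image_mset (count {#v \<in># M. fst v = i#}) (mset_set (set_mset {#v \<in># M. fst v = i#})) = parts_at i (exponents fst M)"
      unfolding parts_at_exponents set_mset_filter by (intro image_mset_cong) auto
    then show ?thesis using that by (simp add: M parts_at_parts_of)
  qed
  have letters: "fst v \<in> {1..n}" if "v \<in># M" for v
  proof -
    have "(fst v, count M v) \<in># parts_of n L"
      unfolding M[symmetric] exponents_def using that by auto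
    then show ?thesis
      by (auto simp: count_greater_zero_iff[symmetric] count_parts_of simp del: count_greater_zero_iff split: if_splits)
  qed
  \<comment> \<open>The first \<open>k - 1\<close> factors are split off together with the part of the monomial in their alphabets.\<close>
  have main: "coeff_series (\<Prod>i\<in>{k..n}. ?F i) {#v \<in># M. k \<le> fst v#} = 1" if "1 \<le> k" "k \<le> Suc n" for k
    using that
  proof (induction "Suc n - k" arbitrary: k)
    case 0
    then have "{#v \<in># M. k \<le> fst v#} = {#}" unfolding filter_mset_eq_mempty_iff using letters by fastforce
    then show ?case using 0 by (simp add: coeff_one)
  next
    case (Suc d)
    then have k: "k \<in> {1..n}" by auto
    let ?G = "\<Prod>i\<in>{Suc k..n}. ?F i" and ?M = "{#v \<in># M. k \<le> fst v#}" and ?A = "{#v \<in># M. fst v = k#}"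
    have "{k..n} = insert k {Suc k..n}" using k by auto
    then have "(\<Prod>i\<in>{k..n}. ?F i) = ?F k * ?G" by simp
    then have "coeff_series (\<Prod>i\<in>{k..n}. ?F i) ?M = (\<Sum>A | A \<subseteq># ?M. coeff_series (?F k) A * coeff_series ?G (?M - A))"
      by (simp add: coeff_times)
    also have "\<dots> = (\<Sum>A\<in>{?A}. coeff_series (?F k) A * coeff_series ?G (?M - A))"
    proof (rule sum.mono_neutral_right)
      show "finite {A. A \<subseteq># ?M}" by (rule finite_submultisets)
      show "{?A} \<subseteq> {A. A \<subseteq># ?M}" by (auto intro!: mset_subset_eqI)
      show "\<forall>A\<in>{A. A \<subseteq># ?M} - {?A}. coeff_series (?F k) A * coeff_series ?G (?M - A) = 0"
      proof (intro ballI, rule ccontr)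
        fix A assume A: "A \<in> {A. A \<subseteq># ?M} - {?A}" and ne: "coeff_series (?F k) A * coeff_series ?G (?M - A) \<noteq> 0"
        then have FA: "coeff_series (?F k) A \<noteq> 0" and GA: "coeff_series ?G (?M - A) \<noteq> 0" by auto
        obtain m where m: "?M - A = (\<Sum>i\<in>{Suc k..n}. m i)" "\<forall>i\<in>{Suc k..n}. coeff_series (?F i) (m i) \<noteq> 0"
          using coeff_prod_nonzeroE[OF _ GA] by auto
        have later: "fst v \<in> {Suc k..n}" if i: "i \<in> {Suc k..n}" and v: "v \<in># m i" for i v
          using factor_support(2)[OF R part _ m(2)[rule_format, OF i]] i v by force
        have rest: "fst v \<noteq> k" if v: "v \<in># ?M - A" for v
        proof -
          obtain i where "i \<in> {Suc k..n}" "v \<in># m i"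
            using v unfolding m(1) by (auto simp: set_mset_sum)
          from later[OF this] show ?thesis by auto
        qed
        have "?A \<subseteq># A"
        proof (rule mset_subset_eqI)
          fix v
          show "count ?A v \<le> count A v"
          proof (cases "fst v = k")
            case True
            then have "v \<notin># ?M - A" using rest by blast
            then have "count (?M - A) v = 0" by (simp only: not_in_iff)
            then show ?thesis using True by simp
          qed simp
        qed
        moreover have "size A = sum_list (L k)" by (rule factor_support(1)[OF R[OF k] part k FA])
        moreover have "size ?A = sum_list (L k)"
          using size_eq_sum_mset_counts[of ?A] at[OF k] by (simp add: sum_mset_sum_list)
        ultimately have "?A = A" by (metis mset_subset_size nat_neq_iff subset_mset.le_imp_less_or_eq)
        with A show False by simp
      qed
    qed
    also have "\<dots> = coeff_series (?F k) ?A * coeff_series ?G {#v \<in># M. Suc k \<le> fst v#}"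
    proof -
      have "?M - ?A = {#v \<in># M. Suc k \<le> fst v#}" by (rule multiset_eqI) auto
      then show ?thesis by simp
    qed
    also have "coeff_series (?F k) ?A = 1"
      by (rule factor_leading[OF R[OF k] part k _ at[OF k]]) auto
    also have "coeff_series ?G {#v \<in># M. Suc k \<le> fst v#} = 1"
      using Suc.hyps(2) k by (intro Suc.hyps(1)) auto
    finally show ?case by simp
  qed
  have "{#v \<in># M. 1 \<le> fst v#} = M"
    using letters by (subst filter_mset_eq_conv) force+
  then show ?thesis using main[of 1] n by (simp add: product_series_def)
qed

end

section \<open>The explicit formula\<close>

text \<open>
  In a factor where the two partitions differ, the power of \<open>q\<close> is constant because the Macdonald
  polynomial is homogeneous, so what remains is a multiple of the Macdonald scalar product.
\<close>

lemma product_series_orthogonal: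
  assumes n: "n \<ge> 1"
    and R: "\<And>i. i \<in> {1..n} \<Longrightarrow> macdonald_basis (param_q n i) (param_t n i) (R i)"
    and L: "L \<in> multipartitions n" and M: "M \<in> multipartitions n" and ne: "L \<noteq> M"
  shows "multi_form n (product_series n (\<lambda>i. R i (L i))) (product_series n (\<lambda>i. R i (M i))) = 0"
proof -
  have part: "is_partition (L i)" "is_partition (M i)" for i using L M by (simp_all add: multipartitions_def)
  have "\<exists>i\<in>{1..n}. L i \<noteq> M i"
  proof (rule ccontr)
    assume "\<not> (\<exists>i\<in>{1..n}. L i \<noteq> M i)"
    then have "L i = M i" for i using L M by (cases "i \<in> {1..n}") (auto simp: multipartitions_def)
    with ne show False by auto
  qed
  then obtain i where i: "i \<in> {1..n}" "L i \<noteq> M i" by blast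
  let ?c = "\<lambda>N l. coord partitions (psym UNIV) (R i (N i)) l"
  have "(\<Sum>l\<in>psym_support (R i (L i)). \<Sum>m\<in>psym_support (R i (M i)). ?c L l * ?c M m * (if l = m then factor_norm n i l else 0)) =
    (\<Sum>l\<in>psym_support (R i (L i)). \<Sum>m\<in>psym_support (R i (M i)). qq ^ ((n - i) * sum_list (L i)) * (?c L l * ?c M m *
     (if l = m then of_nat (zee l) * (\<Prod>r\<leftarrow>l. (1 - param_q n i ^ r) / (1 - param_t n i ^ r)) else 0)))"
    using macdonald_support_weight[OF R[OF i(1)] part(1)]
    by (intro sum.cong refl) (auto simp: factor_norm_def mult_ac)
  also have "\<dots> = qq ^ ((n - i) * sum_list (L i)) * macdonald_form (param_q n i) (param_t n i) (R i (L i)) (R i (M i))"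
    by (simp only: macdonald_form_eq sum_distrib_left)
  also have "macdonald_form (param_q n i) (param_t n i) (R i (L i)) (R i (M i)) = 0"
    using R[OF i(1)] part i(2) by (simp add: macdonald_basis_def unitriangular_orthogonal_basis_def)
  finally show ?thesis
    unfolding form_product_series[OF n] using i(1) by (intro prod_zero bexI[of _ i]) auto
qed

lemma multi_dominance_trans:
  assumes "multi_dominance n L M" "multi_dominance n M N"
  shows "multi_dominance n L N"
  unfolding multi_dominance_def
proof (intro ballI allI)
  fix k j assume "k \<in> {1..n}"
  then show "(\<Sum>i\<in>{1..<k}. sum_list (L i)) + sum_list (take j (L k)) \<le>
     (\<Sum>i\<in>{1..<k}. sum_list (N i)) + sum_list (take j (N k))"
    using assms unfolding multi_dominance_def by (meson order_trans)
qed

lemma parts_le_weight: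
  assumes "n \<ge> 1" "A \<in> labelled_parts n" "parts_le n A A'"
  shows "weight A \<le> weight A'"
proof -
  have 1: "\<forall>y\<in>#A. fst y \<le> n" using assms(2) by (auto simp: labelled_parts_def)
  have 2: "n \<in> {1..n}" using assms(1) by simp
  obtain B where "B \<subseteq># A'" "\<forall>y\<in>#B. fst y \<le> n"
    "size {#y \<in># B. fst y = n#} \<le> size {#y \<in># A. fst y = n#}" "weight A \<le> weight B"
    by (rule parts_leE[OF assms(3) 2 subset_mset.order_refl 1])
  then show ?thesis using weight_mono[of B A'] by linarith
qed

lemma finite_multi_dominance_below:
  assumes "n \<ge> 1" "L \<in> multipartitions n"
  shows "finite {M \<in> multipartitions n. multi_dominance n M L}"
proof -
  have "parts_of n ` {M \<in> multipartitions n. multi_dominance n M L} \<subseteq> {A \<in> labelled_parts n. weight A \<le> weight (parts_of n L)}"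
  proof clarify
    fix M assume M: "M \<in> multipartitions n" "multi_dominance n M L"
    have "parts_of n M \<in> labelled_parts n" using bij_betw_imp_surj_on[OF parts_of_bij, of n] M(1) by blast
    moreover have "parts_le n (parts_of n M) (parts_of n L)"
      using parts_le_iff_multi_dominance[OF M(1) assms(2)] M(2) by simp
    ultimately show "parts_of n M \<in> labelled_parts n \<and> weight (parts_of n M) \<le> weight (parts_of n L)"
      using parts_le_weight[OF assms(1)] by blast
  qed
  then have "finite (parts_of n ` {M \<in> multipartitions n. multi_dominance n M L})"
    using finite_weight_le finite_subset by blast
  moreover have "inj_on (parts_of n) {M \<in> multipartitions n. multi_dominance n M L}"
    using parts_of_bij[of n] by (auto simp: bij_betw_def inj_on_def)
  ultimately show ?thesis by (simp add: finite_image_iff)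
qed

text \<open>
  The form is diagonal in the basis of power sums, with nonzero diagonal entries.
\<close>

lemma multi_form_nondegenerate:
  assumes n: "n \<ge> 1" and f: "f \<in> series.span (multi_msym n ` multipartitions n)"
    and zero: "\<And>g. g \<in> series.span (multi_msym n ` multipartitions n) \<Longrightarrow> multi_form n f g = 0"
  shows "f = 0"
proof -
  let ?c = "coord (multipartitions n) (multi_psym n) f"
  let ?S = "{L. L \<in> multipartitions n \<and> ?c L \<noteq> 0}"
  have f': "f \<in> series.span (multi_psym n ` multipartitions n)" using f span_multi_psym by blast
  have fin: "finite ?S" by (rule finite_coord[OF multi_psym_independent])
  have eq: "f = (\<Sum>L\<in>?S. scale_series (?c L) (multi_psym n L))"
    by (rule sum_coord[OF multi_psym_independent f', symmetric])
  have psym: "multi_psym n L \<in> series.span (multi_msym n ` multipartitions n)" if "L \<in> multipartitions n" for L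
    unfolding span_multi_psym[symmetric] using that by (intro series.span_base) auto
  have "?S = {}"
  proof (rule ccontr)
    assume "?S \<noteq> {}"
    then obtain L where L: "L \<in> ?S" by blast
    have "0 = multi_form n f (multi_psym n L)" using zero psym L by simp
    also have "\<dots> = multi_form n (\<Sum>L\<in>?S. scale_series (?c L) (multi_psym n L)) (multi_psym n L)"
      by (rule arg_cong[OF eq, of "\<lambda>g. multi_form n g (multi_psym n L)"])
    also have "\<dots> = (\<Sum>M\<in>?S. ?c M * multi_form n (multi_psym n M) (multi_psym n L))"
      by (rule symmetric_form_sum_left[OF multi_form_add multi_form_scale]) (use psym in auto)
    also have "\<dots> = (\<Sum>M\<in>?S. if M = L then ?c L * multiset_norm (cumulative_norm n) (parts_of n L) else 0)"
      using L by (intro sum.cong refl) (auto simp: multi_form_psym[OF n])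
    also have "\<dots> = ?c L * multiset_norm (cumulative_norm n) (parts_of n L)"
      using fin L by simp
    finally have "multiset_norm (cumulative_norm n) (parts_of n L) = 0" using L by simp
    moreover have "parts_of n L \<in> labelled_parts n" using L bij_betw_imp_surj_on[OF parts_of_bij, of n] by blast
    then have "multiset_norm (cumulative_norm n) (parts_of n L) \<noteq> 0"
      by (intro multiset_norm_nonzero cumulative_norm_nonzero) (auto simp: labelled_parts_def)
    ultimately show False by blast
  qed
  then show ?thesis using eq by (simp only: sum.empty)
qed

lemma product_series_basis:
  assumes n: "n \<ge> 1"
    and R: "\<And>i. i \<in> {1..n} \<Longrightarrow> macdonald_basis (param_q n i) (param_t n i) (R i)"
  shows "multi_macdonald_basis n (\<lambda>L. product_series n (\<lambda>i. R i (L i)))"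
proof -
  let ?F = "\<lambda>L. product_series n (\<lambda>i. R i (L i))" and ?I = "multipartitions n"
  have diff: "?F L - multi_msym n L \<in> series.span (multi_msym n ` {M \<in> ?I. multi_dominance n M L \<and> M \<noteq> L})"
    if L: "L \<in> ?I" for L
  proof -
    let ?D = "{M \<in> ?I. multi_dominance n M L \<and> M \<noteq> L}"
    let ?f = "?F L - multi_msym n L"
    have "?f \<in> series.span (multi_msym n ` ?I)"
      by (rule series.span_diff[OF product_series_in_span[OF n] series.span_base]) (use L in blast)
    then have fW: "?f \<in> series.span (monomial_series fst ` labelled_parts n)"
      by (simp only: multi_msym_image)
    have "?f \<in> series.span (monomial_series fst ` parts_of n ` ?D)"
    proof (rule in_span_monomial_series)
      show "symmetric_series fst ?f" by (rule span_monomial_series_symmetric[OF fW])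
      show "finite (parts_of n ` ?D)"
        by (intro finite_imageI finite_subset[OF _ finite_multi_dominance_below[OF n L]]) auto
      fix K assume K: "coeff_series ?f K \<noteq> 0"
      have "exponents fst K \<in> labelled_parts n" by (rule span_monomial_series_support[OF fW K])
      then obtain M where M: "M \<in> ?I" "exponents fst K = parts_of n M" by (rule parts_of_cases)
      have "M \<noteq> L"
      proof
        assume "M = L"
        then have "coeff_series (?F L) K = 1" using product_series_leading[OF n R L] M by simp
        then show False using K M \<open>M = L\<close> by (simp add: multi_msym_eq coeff_monomial_series)
      qed
      then have "parts_of n M \<noteq> parts_of n L"
        using parts_of_bij[of n] M L by (auto simp: bij_betw_def inj_on_def)
      then have "coeff_series (?F L) K \<noteq> 0" using K M by (simp add: multi_msym_eq coeff_monomial_series)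
      from product_series_dominance[OF n R L this] have "parts_le n (parts_of n M) (parts_of n L)"
        by (simp only: M(2))
      then show "exponents fst K \<in> parts_of n ` ?D"
        using M L \<open>M \<noteq> L\<close> parts_le_iff_multi_dominance by auto
    qed
    moreover have "(monomial_series fst ` parts_of n ` ?D :: msf set) = multi_msym n ` ?D"
      by (simp add: multi_msym_eq image_image)
    ultimately show ?thesis by simp
  qed
  interpret triangular_family ?I "\<lambda>M L. M \<in> ?I \<and> L \<in> ?I \<and> multi_dominance n M L \<and> M \<noteq> L" "multi_msym n" ?F "\<lambda>_. 1"
  proof
    show "inj_on (multi_msym n) ?I" "series.independent (multi_msym n ` ?I)" by (rule multi_msym_independent)+
    show "L \<in> ?I \<and> N \<in> ?I \<and> multi_dominance n L N \<and> L \<noteq> N"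
      if "L \<in> ?I \<and> M \<in> ?I \<and> multi_dominance n L M \<and> L \<noteq> M" "M \<in> ?I \<and> N \<in> ?I \<and> multi_dominance n M N \<and> M \<noteq> N" for L M N
      using that multi_dominance_trans[of n L M N] multi_dominance_antisym[of L n M] by blast
    show "finite {M \<in> ?I. M \<in> ?I \<and> L \<in> ?I \<and> multi_dominance n M L \<and> M \<noteq> L}" if "L \<in> ?I" for L
      by (rule finite_subset[OF _ finite_multi_dominance_below[OF n that]]) auto
    show "?F L - scale_series 1 (multi_msym n L) \<in> series.span (multi_msym n ` {M \<in> ?I. M \<in> ?I \<and> L \<in> ?I \<and> multi_dominance n M L \<and> M \<noteq> L})"
      if L: "L \<in> ?I" for L
    proof -
      have "{M \<in> ?I. M \<in> ?I \<and> L \<in> ?I \<and> multi_dominance n M L \<and> M \<noteq> L} = {M \<in> ?I. multi_dominance n M L \<and> M \<noteq> L}"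
        using L by blast
      then show ?thesis using diff[OF L] by simp
    qed
  qed auto
  show ?thesis
    unfolding multi_macdonald_basis_def unitriangular_orthogonal_basis_def
    using family_basis diff product_series_orthogonal[OF n R] by blast
qed

theorem proposition2:
  fixes n :: nat
    and L :: "nat \<Rightarrow> nat list"
    and P :: "qt_field \<Rightarrow> qt_field \<Rightarrow> nat list \<Rightarrow> sym"
  assumes "n \<ge> 1"
    and "L \<in> multipartitions n"
    and "\<And>i. i \<in> {1..n} \<Longrightarrow>
      macdonald_basis (param_q n i) (param_t n i) (P (param_q n i) (param_t n i))"
  shows "multi_macdonald n L =
    (\<Prod>i=1..n. plethysm n (P (param_q n i) (param_t n i) (L i)) (alphabet_A n (n - i)))"
proof -
  let ?F = "\<lambda>L. product_series n (\<lambda>i. P (param_q n i) (param_t n i) (L i))"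
  have F: "multi_macdonald_basis n ?F" by (rule product_series_basis[OF assms(1,3)])
  have unique: "R L = ?F L" if R: "multi_macdonald_basis n R" for R
  proof (rule unitriangular_orthogonal_basis_unique
      [where I = "multipartitions n" and le = "multi_dominance n" and m = "multi_msym n" and B = "multi_form n"])
    show "inj_on (multi_msym n) (multipartitions n)" "series.independent (multi_msym n ` multipartitions n)"
      by (rule multi_msym_independent)+
    show "M = N" if "M \<in> multipartitions n" "N \<in> multipartitions n" "multi_dominance n M N" "multi_dominance n N M" for M N
      using that by (rule multi_dominance_antisym)
    show "multi_dominance n K N" if "multi_dominance n K M" "multi_dominance n M N" for K M N
      using that by (rule multi_dominance_trans)
    show "finite {M \<in> multipartitions n. multi_dominance n M N}" if "N \<in> multipartitions n" for N
      using that by (rule finite_multi_dominance_below[OF assms(1)])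
    show "multi_form n (f + g) h = multi_form n f h + multi_form n g h"
      if "f \<in> series.span (multi_msym n ` multipartitions n)" "g \<in> series.span (multi_msym n ` multipartitions n)" for f g h
      using that by (rule multi_form_add)
    show "multi_form n (scale_series c f) h = c * multi_form n f h"
      if "f \<in> series.span (multi_msym n ` multipartitions n)" for c f h
      using that by (rule multi_form_scale)
    show "multi_form n f g = multi_form n g f" for f g by (rule multi_form_commute)
    show "f = 0" if "f \<in> series.span (multi_msym n ` multipartitions n)"
        "\<And>g. g \<in> series.span (multi_msym n ` multipartitions n) \<Longrightarrow> multi_form n f g = 0" for f
      using that by (rule multi_form_nondegenerate[OF assms(1)])
    show "unitriangular_orthogonal_basis (multipartitions n) (multi_dominance n) (multi_msym n) (multi_form n) R"
      "unitriangular_orthogonal_basis (multipartitions n) (multi_dominance n) (multi_msym n) (multi_form n) ?F"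
      using R F by (simp_all only: multi_macdonald_basis_def)
    show "L \<in> multipartitions n" by (rule assms(2))
  qed
  have "multi_macdonald n L = ?F L"
    unfolding multi_macdonald_def
  proof (rule the_equality)
    show "\<exists>R. multi_macdonald_basis n R \<and> ?F L = R L"
      by (rule exI[of _ ?F], rule conjI[OF F refl])
    fix G assume "\<exists>R. multi_macdonald_basis n R \<and> G = R L"
    then obtain R where "multi_macdonald_basis n R" "G = R L" by (elim exE conjE)
    then show "G = ?F L" by (simp only: unique)
  qed
  then show ?thesis by (simp add: product_series_def)
qed

end
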